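(* Let $N>K\ge2$, let $V\in\mathcal C(\mathbb{R}^N)$ with $\inf V>0$, and let $f$ satisfy (F1)–(F4). Then every nonnegative weak solution $u\in X_1$ of $$-\Delta u+\frac{u}{|y|^2}+V(x)u=f(u)\quad\text{in }\mathbb{R}^N$$ belongs to $L^\infty(\mathbb{R}^N)$ and satisfies $\limsup_{|x|\to\infty}|x|^\nu u(x)=0$ for every $\nu<\frac{N-2+\sqrt{(N-2)^2+4}}{2}$.
   Context: Points of $\mathbb{R}^N$ are written $x=(y,z)\in\mathbb{R}^K\times\mathbb{R}^{N-K}$, $N>K\ge2$, $2^*=\frac{2N}{N-2}$. Assumptions on $f$, $F(u)=\int_0^uf$: (F1) $f$ continuous, $|f(u)|\le C(1+|u|^{p-1})$ for some $p\in(2,2^* )$; (F2) $f(u)=o(u)$ as $u\to0$; (F3) $F(u)/u^2\to\infty$ as $|u|\to\infty$; (F4) $f(u)/|u|$ increasing on $(-\infty,0)$ and on $(0,\infty)$. $X_1=\{u\in H^1(\mathbb{R}^N):\int\frac{u^2}{|y|^2}+Vu^2\,dx<\infty\}$; a weak solution $u\in X_1$ is a critical point of $\frac12\int|\nabla u|^2+\frac{u^2}{|y|^2}+Vu^2\,dx-\int F(u)\,dx$ on $X_1$. *)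

theory Defs
  imports "HOL-Analysis.Analysis"
begin

fun iter_pd :: "'a::euclidean_space list \<Rightarrow> ('a \<Rightarrow> real) \<Rightarrow> 'a \<Rightarrow> real" where
  "iter_pd [] \<phi> = \<phi>"
| "iter_pd (b # bs) \<phi> = (\<lambda>x. frechet_derivative (iter_pd bs \<phi>) (at x) b)"

definition smooth_fun :: "('a::euclidean_space \<Rightarrow> real) \<Rightarrow> bool" where
  "smooth_fun \<phi> \<longleftrightarrow> (\<forall>bs. set bs \<subseteq> Basis \<longrightarrow> (\<forall>x. iter_pd bs \<phi> differentiable (at x)))"

definition test_fun :: "('a::euclidean_space \<Rightarrow> real) \<Rightarrow> bool" where
  "test_fun \<phi> \<longleftrightarrow> smooth_fun \<phi> \<and> compact (closure {x. \<phi> x \<noteq> 0})"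

definition weak_grad :: "('a::euclidean_space \<Rightarrow> real) \<Rightarrow> ('a \<Rightarrow> 'a) \<Rightarrow> bool" where
  "weak_grad u g \<longleftrightarrow>
     (\<forall>\<phi>. test_fun \<phi> \<longrightarrow> (\<forall>b\<in>Basis.
        integrable lebesgue (\<lambda>x. u x * iter_pd [b] \<phi> x) \<and>
        integrable lebesgue (\<lambda>x. (g x \<bullet> b) * \<phi> x) \<and>
        (LINT x|lebesgue. u x * iter_pd [b] \<phi> x) = - (LINT x|lebesgue. (g x \<bullet> b) * \<phi> x)))"

definition L2grad :: "('a::euclidean_space \<Rightarrow> real) \<Rightarrow> ('a \<Rightarrow> 'a) \<Rightarrow> bool" where
  "L2grad u g \<longleftrightarrow> g \<in> borel_measurable lebesgue \<and>
     integrable lebesgue (\<lambda>x. (norm (g x))\<^sup>2) \<and> weak_grad u g"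

definition H1 :: "('a::euclidean_space \<Rightarrow> real) \<Rightarrow> bool" where
  "H1 u \<longleftrightarrow> u \<in> borel_measurable lebesgue \<and> integrable lebesgue (\<lambda>x. (u x)\<^sup>2) \<and> (\<exists>g. L2grad u g)"

text \<open>The weak gradient (unique up to null sets).\<close>
definition wgrad :: "('a::euclidean_space \<Rightarrow> real) \<Rightarrow> 'a \<Rightarrow> 'a" where
  "wgrad u = (SOME g. L2grad u g)"

text \<open>Points x = (y,z); |y| = norm (fst x).\<close>
definition X1 :: "(('k::euclidean_space \<times> 'm::euclidean_space) \<Rightarrow> real)
    \<Rightarrow> (('k \<times> 'm) \<Rightarrow> real) \<Rightarrow> bool" where
  "X1 V u \<longleftrightarrow> H1 u \<and>
     integrable lebesgue (\<lambda>x. (u x)\<^sup>2 / (norm (fst x))\<^sup>2 + V x * (u x)\<^sup>2)"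

definition primF :: "(real \<Rightarrow> real) \<Rightarrow> real \<Rightarrow> real" where
  "primF f t = (LBINT s=0..t. f s)"

definition energy :: "(('k::euclidean_space \<times> 'm::euclidean_space) \<Rightarrow> real)
    \<Rightarrow> (real \<Rightarrow> real) \<Rightarrow> (('k \<times> 'm) \<Rightarrow> real) \<Rightarrow> real" where
  "energy V f u =
     (1/2) * (LINT x|lebesgue. (norm (wgrad u x))\<^sup>2 + (u x)\<^sup>2 / (norm (fst x))\<^sup>2 + V x * (u x)\<^sup>2)
     - (LINT x|lebesgue. primF f (u x))"

definition weak_solution :: "(('k::euclidean_space \<times> 'm::euclidean_space) \<Rightarrow> real)
    \<Rightarrow> (real \<Rightarrow> real) \<Rightarrow> (('k \<times> 'm) \<Rightarrow> real) \<Rightarrow> bool" where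
  "weak_solution V f u \<longleftrightarrow> X1 V u \<and>
     (\<forall>v. X1 V v \<longrightarrow> ((\<lambda>t. energy V f (\<lambda>x. u x + t * v x)) has_real_derivative 0) (at 0))"

end

theory Submission
  imports Defs
begin

text \<open>
  Since \<open>inf V > 0\<close>, solutions decay faster than every power, so the Hardy term only needs to be
  nonnegative. Testing the equation away from \<open>y = 0\<close> and removing the cutoff (a set of codimension at
  least two is negligible for square integrable gradients) shows that \<open>u\<close> is a distributional
  subsolution, \<open>- \<Delta>u + c u \<le> |f(u)|\<close>. Testing with the truncated Newtonian kernel
  \<open>(|x|\<^sup>2 + \<rho>\<^sup>2) powr (- (n - 2) / 2)\<close>, whose negative Laplacian is an approximate identity, turns weak
  identities into pointwise bounds by Riesz potentials. From the gradient one gets \<open>u \<in> L\<^sup>q\<close> for all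
  subcritical \<open>q\<close>. From the equation one gets \<open>u \<le> A + T u\<close> with \<open>T\<close> the potential of \<open>W u\<close> on small
  balls, \<open>W = 1 + u powr (p - 2)\<close>; subcriticality makes \<open>W\<close> a small Kato weight, so \<open>T\<close> contracts both
  constants and \<open>L\<^sup>1(W dx)\<close>, and \<open>u\<close> is bounded. The potential bound then gives \<open>u \<rightarrow> 0\<close> at infinity, so
  \<open>|f(u)| \<le> c u / 2\<close> there, and the maximum principle for the mollified function, compared with
  \<open>(1 + |x|\<^sup>2) powr (- m)\<close>, gives the decay.
\<close>


section \<open>A differential algebra of smooth functions\<close>

text \<open>Criticality is given only as the derivative at 0 of \<open>energy\<close> along
  \<open>u + t v\<close>, where the gradient is a Hilbert choice and the integral of a
  non-integrable function is 0. Before this yields an equation, weak gradients must be known to be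
  unique and \<open>primF f (u x)\<close> must be known to be integrable over the whole space. The
  second point needs u in L^p, so the embedding has to be derived from the square integrable
  gradient alone, before any equation is available.

  The same regularised kernel is tested twice: its gradient, of size |z|^(1-n), gives the embedding,
  and the kernel itself, of size |z|^(2-n), gives the potential bound. All constants must be uniform
  in the regularisation \<rho>, because \<rho> is sent to 0 only after the estimates.

  Boundedness needs no iteration over exponents: p below the critical exponent leaves room for some
  q with (p - 2) n / 2 < q < 2 n / (n - 2), and this single gap gives the smallness of the weight W
  on small balls, uniformly in the centre.\<close>

definition flat_exp :: "nat \<Rightarrow> real \<Rightarrow> real" where
  "flat_exp k t = (if t > 0 then exp (- inverse t) * inverse t ^ k else 0)"

lemma flat_exp_tendsto_0: "(flat_exp k \<longlongrightarrow> 0) (at 0)"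
proof -
  have "((\<lambda>x::real. x ^ k / exp x) \<longlongrightarrow> 0) at_top" by (rule tendsto_power_div_exp_0)
  then have "((\<lambda>t::real. inverse t ^ k / exp (inverse t)) \<longlongrightarrow> 0) (at_right 0)"
    by (rule filterlim_compose) (rule filterlim_inverse_at_top_right)
  then have r: "(flat_exp k \<longlongrightarrow> 0) (at_right 0)"
    by (rule Lim_transform_eventually)
       (auto simp: eventually_at_filter flat_exp_def exp_minus field_simps)
  have l: "(flat_exp k \<longlongrightarrow> 0) (at_left 0)"
    by (rule Lim_transform_eventually[OF tendsto_const[of 0]])
       (auto simp: eventually_at_filter flat_exp_def)
  show ?thesis using l r by (simp add: filterlim_split_at)
qed

text \<open>The power of 1/t indexed by \<open>k\<close> keeps the family closed under
  differentiation: the exponential raises it by two, the power factor by one. At 0 the difference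
  quotient of \<open>flat_exp k\<close> is \<open>flat_exp (Suc k)\<close>, so the limit of the next
  member gives the derivative there.\<close>

lemma flat_exp_has_derivative:
  "(flat_exp k has_real_derivative flat_exp (k+2) t - real k * flat_exp (k+1) t) (at t)"
proof -
  consider "t > 0" | "t < 0" | "t = 0" by linarith
  then show ?thesis
  proof cases
    case 1
    have "((\<lambda>t. exp (- inverse t) * inverse t ^ k) has_real_derivative
        flat_exp (k+2) t - real k * flat_exp (k+1) t) (at t)"
      using 1
      apply (auto intro!: derivative_eq_intros simp: flat_exp_def)
      apply (cases k)
       apply (auto simp: field_simps power2_eq_square)
      done
    then show ?thesis
      by (rule has_field_derivative_transform_within_open[where S = "{0<..}"])
         (use 1 in \<open>auto simp: flat_exp_def\<close>)
  next
    case 2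
    have "((\<lambda>t. 0) has_real_derivative flat_exp (k+2) t - real k * flat_exp (k+1) t) (at t)"
      using 2 by (auto simp: flat_exp_def)
    then show ?thesis
      by (rule has_field_derivative_transform_within_open[where S = "{..<0}"])
         (use 2 in \<open>auto simp: flat_exp_def\<close>)
  next
    case 3
    have "((\<lambda>h. flat_exp k h / h) \<longlongrightarrow> 0) (at 0)"
      by (rule Lim_transform_eventually[OF flat_exp_tendsto_0[of "Suc k"]])
         (auto simp: eventually_at_filter flat_exp_def field_simps)
    then show ?thesis using 3 by (simp add: has_field_derivative_iff flat_exp_def)
  qed
qed

text \<open>\<open>smooth_fun\<close> speaks of all iterated partial derivatives at once. The
  generators are chosen so that a directional derivative of a member is again a member, which turns
  smoothness of an explicit formula into a rule application. The base of \<open>powr\<close> must be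
  positive everywhere because the derivative lowers the exponent.\<close>

inductive smooth_alg :: "('a::euclidean_space \<Rightarrow> real) \<Rightarrow> bool" where
  const: "smooth_alg (\<lambda>x. c)"
| linear: "bounded_linear l \<Longrightarrow> smooth_alg l"
| add: "smooth_alg \<phi> \<Longrightarrow> smooth_alg \<psi> \<Longrightarrow> smooth_alg (\<lambda>x. \<phi> x + \<psi> x)"
| mult: "smooth_alg \<phi> \<Longrightarrow> smooth_alg \<psi> \<Longrightarrow> smooth_alg (\<lambda>x. \<phi> x * \<psi> x)"
| powr: "smooth_alg \<phi> \<Longrightarrow> (\<And>x. \<phi> x > 0) \<Longrightarrow> smooth_alg (\<lambda>x. \<phi> x powr s)"
| flat: "smooth_alg \<phi> \<Longrightarrow> smooth_alg (\<lambda>x. flat_exp k (\<phi> x))"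

lemma smooth_alg_derivative:
  assumes "smooth_alg \<phi>"
  shows "\<exists>\<phi>'. (\<forall>x. (\<phi> has_derivative \<phi>' x) (at x)) \<and> (\<forall>b. smooth_alg (\<lambda>x. \<phi>' x b))"
  using assms
proof induction
  case (const c)
  show ?case by (rule exI[of _ "\<lambda>x v. 0"]) (auto intro: smooth_alg.const)
next
  case (linear l)
  then show ?case
    by (intro exI[of _ "\<lambda>x. l"]) (auto intro: smooth_alg.const bounded_linear_imp_has_derivative)
next
  case (add \<phi> \<psi>)
  then obtain \<phi>' \<psi>' where "\<forall>x. (\<phi> has_derivative \<phi>' x) (at x)" "\<forall>b. smooth_alg (\<lambda>x. \<phi>' x b)"
    "\<forall>x. (\<psi> has_derivative \<psi>' x) (at x)" "\<forall>b. smooth_alg (\<lambda>x. \<psi>' x b)" by blast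
  then show ?case
    by (intro exI[of _ "\<lambda>x v. \<phi>' x v + \<psi>' x v"]) (auto intro!: smooth_alg.add derivative_intros)
next
  case (mult \<phi> \<psi>)
  then obtain \<phi>' \<psi>' where "\<forall>x. (\<phi> has_derivative \<phi>' x) (at x)" "\<forall>b. smooth_alg (\<lambda>x. \<phi>' x b)"
    "\<forall>x. (\<psi> has_derivative \<psi>' x) (at x)" "\<forall>b. smooth_alg (\<lambda>x. \<psi>' x b)" by blast
  with mult show ?case
    by (intro exI[of _ "\<lambda>x v. \<phi> x * \<psi>' x v + \<phi>' x v * \<psi> x"])
       (auto intro!: smooth_alg.add smooth_alg.mult has_derivative_mult)
next
  case (powr \<phi> s)
  then obtain \<phi>' where d: "\<forall>x. (\<phi> has_derivative \<phi>' x) (at x)" "\<forall>b. smooth_alg (\<lambda>x. \<phi>' x b)"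
    by blast
  have "((\<lambda>x. \<phi> x powr s) has_derivative (\<lambda>v. s * \<phi> x powr (s - 1) * \<phi>' x v)) (at x)" for x
  proof -
    have "((\<lambda>t. t powr s) has_real_derivative s * \<phi> x powr (s - 1)) (at (\<phi> x))"
      using powr.hyps(2)[of x] by (auto intro!: derivative_eq_intros has_real_derivative_powr)
    then have "((\<lambda>t. t powr s) has_derivative (\<lambda>v. v * (s * \<phi> x powr (s - 1)))) (at (\<phi> x))"
      by (simp add: has_field_derivative_def mult_commute_abs)
    from has_derivative_compose[OF d(1)[rule_format, of x] this] show ?thesis
      by (simp add: mult.commute)
  qed
  then show ?case using powr d(2)
    by (intro exI[of _ "\<lambda>x v. s * \<phi> x powr (s - 1) * \<phi>' x v"])
       (auto intro!: smooth_alg.mult smooth_alg.const smooth_alg.powr)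
next
  case (flat \<phi> k)
  then obtain \<phi>' where d: "\<forall>x. (\<phi> has_derivative \<phi>' x) (at x)" "\<forall>b. smooth_alg (\<lambda>x. \<phi>' x b)"
    by blast
  have "((\<lambda>x. flat_exp k (\<phi> x)) has_derivative
      (\<lambda>v. (flat_exp (k+2) (\<phi> x) + (- real k) * flat_exp (k+1) (\<phi> x)) * \<phi>' x v)) (at x)" for x
  proof -
    have "(flat_exp k has_derivative
       (\<lambda>v. v * (flat_exp (k+2) (\<phi> x) - real k * flat_exp (k+1) (\<phi> x)))) (at (\<phi> x))"
      using flat_exp_has_derivative[of k "\<phi> x"]
      by (simp add: has_field_derivative_def mult_commute_abs)
    from has_derivative_compose[OF d(1)[rule_format, of x] this] show ?thesis
      by (simp add: mult.commute)
  qed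
  then show ?case using flat d(2)
    by (intro exI[of _ "\<lambda>x v. (flat_exp (k+2) (\<phi> x) + (- real k) * flat_exp (k+1) (\<phi> x)) * \<phi>' x v"])
       (intro conjI allI smooth_alg.mult smooth_alg.add smooth_alg.flat smooth_alg.const; blast)
qed

lemma smooth_alg_iter_pd: "smooth_alg \<phi> \<Longrightarrow> smooth_alg (iter_pd bs \<phi>)"
proof (induction bs)
  case (Cons b bs)
  then have "smooth_alg (iter_pd bs \<phi>)" by simp
  then obtain \<phi>' where "\<forall>x. (iter_pd bs \<phi> has_derivative \<phi>' x) (at x)"
      "\<forall>b. smooth_alg (\<lambda>x. \<phi>' x b)"
    using smooth_alg_derivative by blast
  moreover from this(1) have "frechet_derivative (iter_pd bs \<phi>) (at x) = \<phi>' x" for x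
    using frechet_derivative_at by metis
  ultimately show ?case by simp
qed simp

lemma smooth_alg_differentiable: "smooth_alg \<phi> \<Longrightarrow> \<phi> differentiable (at x)"
  using smooth_alg_derivative differentiable_def by blast

lemma smooth_alg_imp_smooth_fun: "smooth_alg \<phi> \<Longrightarrow> smooth_fun \<phi>"
  unfolding smooth_fun_def using smooth_alg_iter_pd smooth_alg_differentiable by blast

lemma smooth_alg_continuous: "smooth_alg \<phi> \<Longrightarrow> continuous_on UNIV \<phi>"
  by (simp add: continuous_on_eq_continuous_at smooth_alg_differentiable
      differentiable_imp_continuous_within)

lemma smooth_alg_diff: "smooth_alg \<phi> \<Longrightarrow> smooth_alg \<psi> \<Longrightarrow> smooth_alg (\<lambda>x. \<phi> x - \<psi> x)"
  using smooth_alg.add[OF _ smooth_alg.mult[OF smooth_alg.const[of "-1"]], of \<phi> \<psi>] by simp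

lemma smooth_alg_sum: "finite A \<Longrightarrow> (\<And>i. i \<in> A \<Longrightarrow> smooth_alg (\<phi> i)) \<Longrightarrow> smooth_alg (\<lambda>x. \<Sum>i\<in>A. \<phi> i x)"
  by (induction A rule: finite_induct) (auto intro: smooth_alg.const smooth_alg.add)

text \<open>The linear map \<open>L\<close> is the identity for radial functions around
  \<open>a\<close>, and a multiple of \<open>fst\<close> for the cutoff around the singular
  set.\<close>

lemma smooth_alg_norm_sq:
  fixes L :: "'a::euclidean_space \<Rightarrow> 'b::euclidean_space"
  assumes "bounded_linear L"
  shows "smooth_alg (\<lambda>x. (norm (L x - a))\<^sup>2)"
proof -
  have "smooth_alg (\<lambda>x. \<Sum>b\<in>Basis. (L x \<bullet> b - a \<bullet> b) * (L x \<bullet> b - a \<bullet> b))"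
    by (intro smooth_alg_sum smooth_alg.mult smooth_alg_diff smooth_alg.const smooth_alg.linear
        bounded_linear_compose[OF bounded_linear_inner_left] assms) auto
  also have "(\<lambda>x. \<Sum>b\<in>Basis. (L x \<bullet> b - a \<bullet> b) * (L x \<bullet> b - a \<bullet> b)) = (\<lambda>x. (norm (L x - a))\<^sup>2)"
    unfolding power2_norm_eq_inner
    by (subst euclidean_inner) (simp add: inner_diff_left)
  finally show ?thesis .
qed

section \<open>A smooth cutoff\<close>

text \<open>The argument will be a squared norm, so the plateau s \<le> 1/4 is the ball of radius
  1/2. The quotient is written as a product with a power -1, whose base is positive everywhere, so
  that it falls under \<open>smooth_alg\<close>.\<close>

definition cutoff :: "real \<Rightarrow> real" where
  "cutoff s = flat_exp 0 (1 - s) * (flat_exp 0 (1 - s) + flat_exp 0 (s - 1/4)) powr (- 1)"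

lemma flat_exp_nonneg: "flat_exp k t \<ge> 0"
  by (simp add: flat_exp_def)

lemma flat_exp_pos: "t > 0 \<Longrightarrow> flat_exp k t > 0"
  by (simp add: flat_exp_def)

lemma flat_exp_sum_pos: "flat_exp 0 (1 - s) + flat_exp 0 (s - 1/4) > 0"
  using flat_exp_nonneg[of 0 "1-s"] flat_exp_nonneg[of 0 "s-1/4"]
    flat_exp_pos[of "1-s" 0] flat_exp_pos[of "s-1/4" 0]
  by (cases "s < 1") auto

lemma smooth_alg_cutoff: "smooth_alg \<phi> \<Longrightarrow> smooth_alg (\<lambda>x. cutoff (\<phi> x))"
  unfolding cutoff_def
  by (intro smooth_alg.mult smooth_alg.powr smooth_alg.add smooth_alg.flat smooth_alg_diff
      smooth_alg.const flat_exp_sum_pos)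

lemma cutoff_eq_1: "s \<le> 1/4 \<Longrightarrow> cutoff s = 1"
  using flat_exp_pos[of "1-s" 0]
  by (simp add: cutoff_def flat_exp_def[of 0 "s-1/4"] powr_minus)

lemma cutoff_eq_0: "s \<ge> 1 \<Longrightarrow> cutoff s = 0"
  by (simp add: cutoff_def flat_exp_def[of 0 "1-s"])

lemma cutoff_nonneg: "cutoff s \<ge> 0"
  by (simp add: cutoff_def flat_exp_nonneg)

lemma cutoff_le_1: "cutoff s \<le> 1"
  using flat_exp_sum_pos[of s] flat_exp_nonneg[of 0 "1-s"] flat_exp_nonneg[of 0 "s-1/4"]
  by (simp add: cutoff_def powr_minus field_simps)

text \<open>Outside [1/4, 1] the cutoff is locally constant, so both derivatives vanish there; on
  that compact interval they are bounded by continuity.\<close>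

lemma cutoff_derivatives:
  obtains c1 c2 M where
    "\<And>s. (cutoff has_real_derivative c1 s) (at s)"
    "\<And>s. (c1 has_real_derivative c2 s) (at s)"
    "\<And>s. s < 1/4 \<Longrightarrow> c1 s = 0 \<and> c2 s = 0"
    "\<And>s. s > 1 \<Longrightarrow> c1 s = 0 \<and> c2 s = 0"
    "\<And>s. \<bar>c1 s\<bar> \<le> M" "\<And>s. \<bar>c2 s\<bar> \<le> M" "M > 0"
proof -
  have id: "smooth_alg (\<lambda>s::real. s)" by (intro smooth_alg.linear bounded_linear_ident)
  have real_deriv: "\<exists>\<phi>'. (\<forall>x. (\<phi> has_real_derivative \<phi>' x) (at x)) \<and> smooth_alg \<phi>'"
    if "smooth_alg \<phi>" for \<phi> :: "real \<Rightarrow> real"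
  proof -
    obtain D where D: "\<forall>x. (\<phi> has_derivative D x) (at x)" "\<forall>b. smooth_alg (\<lambda>x. D x b)"
      using smooth_alg_derivative[OF \<open>smooth_alg \<phi>\<close>] by blast
    have "(\<phi> has_real_derivative D x 1) (at x)" for x
    proof -
      have "linear (D x)" using D(1) has_derivative_linear by blast
      then have "D x = (*) (D x 1)"
        by (auto simp: fun_eq_iff linear_iff) (metis mult.commute mult.right_neutral real_scaleR_def)
      then show ?thesis using D(1) by (metis has_field_derivative_def)
    qed
    then show ?thesis using D(2) by (intro exI[of _ "\<lambda>x. D x 1"]) auto
  qed
  obtain c1 where c1: "\<And>s. (cutoff has_real_derivative c1 s) (at s)" "smooth_alg c1"
    using real_deriv[OF smooth_alg_cutoff[OF id]] by auto
  obtain c2 where c2: "\<And>s. (c1 has_real_derivative c2 s) (at s)" "smooth_alg c2"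
    using real_deriv[OF c1(2)] by auto
  have c1z: "c1 s = 0" if "s < 1/4 \<or> s > 1" for s
  proof -
    have "((\<lambda>s. cutoff s) has_real_derivative 0) (at s)"
    proof (cases "s < 1/4")
      case True
      show ?thesis
        by (rule has_field_derivative_transform_within_open[OF DERIV_const, where S = "{..<1/4}"])
           (use True in \<open>auto simp: cutoff_eq_1\<close>)
    next
      case False
      show ?thesis
        by (rule has_field_derivative_transform_within_open[OF DERIV_const, where S = "{1<..}"])
           (use False that in \<open>auto simp: cutoff_eq_0\<close>)
    qed
    then show ?thesis using c1(1) DERIV_unique by blast
  qed
  have c2z: "c2 s = 0" if "s < 1/4 \<or> s > 1" for s
  proof -
    have "((\<lambda>s. c1 s) has_real_derivative 0) (at s)"
      by (rule has_field_derivative_transform_within_open[OF DERIV_const, where S = "{..<1/4} \<union> {1<..}"])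
         (use that in \<open>auto simp: c1z\<close>)
    then show ?thesis using c2(1) DERIV_unique by blast
  qed
  have bdd: "\<exists>M>0. \<forall>s\<in>{1/4..1}. \<bar>d s\<bar> \<le> M" if "smooth_alg d" for d :: "real \<Rightarrow> real"
  proof -
    have "compact (d ` {1/4..1})"
      by (intro compact_continuous_image continuous_on_subset[OF smooth_alg_continuous[OF that]]) auto
    then show ?thesis using compact_imp_bounded[of "d ` {1/4..1}"] by (auto simp: bounded_pos)
  qed
  obtain M1 where M1: "M1 > 0" "\<forall>s\<in>{1/4..1}. \<bar>c1 s\<bar> \<le> M1" using bdd[OF c1(2)] by blast
  obtain M2 where M2: "M2 > 0" "\<forall>s\<in>{1/4..1}. \<bar>c2 s\<bar> \<le> M2" using bdd[OF c2(2)] by blast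
  show ?thesis
  proof (rule that[of c1 c2 "M1 + M2"])
    show "\<bar>c1 s\<bar> \<le> M1 + M2" for s
      using M1 M2 c1z[of s] by (cases "s < 1/4 \<or> s > 1") (auto intro: add_increasing add_increasing2)
    show "\<bar>c2 s\<bar> \<le> M1 + M2" for s
      using M1 M2 c2z[of s] by (cases "s < 1/4 \<or> s > 1") (auto intro: add_increasing add_increasing2)
  qed (use c1 c2 c1z c2z M1 M2 in auto)
qed


section \<open>Radial functions and the regularised Newtonian kernel\<close>

definition lap :: "('a::euclidean_space \<Rightarrow> real) \<Rightarrow> 'a \<Rightarrow> real" where
  "lap \<phi> x = (\<Sum>b\<in>Basis. iter_pd [b, b] \<phi> x)"

definition pgrad :: "('a::euclidean_space \<Rightarrow> real) \<Rightarrow> 'a \<Rightarrow> 'a" where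
  "pgrad \<phi> x = (\<Sum>b\<in>Basis. iter_pd [b] \<phi> x *\<^sub>R b)"

lemma iter_pd_eqI:
  assumes "\<And>x. (\<phi> has_derivative D x) (at x)"
  shows "iter_pd [b] \<phi> = (\<lambda>x. D x b)"
  using frechet_derivative_at[OF assms] by (simp add: fun_eq_iff)

lemma has_derivative_norm_sq_shift:
  fixes a :: "'a::euclidean_space"
  shows "((\<lambda>y. (norm (y - a))\<^sup>2) has_derivative (\<lambda>v. 2 * ((y - a) \<bullet> v))) (at y)"
  unfolding power2_norm_eq_inner
  by (auto intro!: derivative_eq_intros simp: inner_commute)

lemma radial_has_derivative:
  fixes a :: "'a::euclidean_space"
  assumes "\<And>s. s \<ge> 0 \<Longrightarrow> (H has_real_derivative Ha s) (at s)"
  shows "((\<lambda>y. H ((norm (y - a))\<^sup>2)) has_derivative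
    (\<lambda>v. 2 * Ha ((norm (y - a))\<^sup>2) * ((y - a) \<bullet> v))) (at y)"
proof -
  have "(H has_derivative (\<lambda>v. Ha ((norm (y - a))\<^sup>2) * v)) (at ((norm (y - a))\<^sup>2))"
    using assms[of "(norm (y - a))\<^sup>2"] by (simp add: has_field_derivative_def)
  from has_derivative_compose[OF has_derivative_norm_sq_shift this]
  show ?thesis by (simp add: mult.assoc mult.left_commute)
qed

lemma radial_iter_pd:
  fixes a :: "'a::euclidean_space"
  assumes "\<And>s. s \<ge> 0 \<Longrightarrow> (H has_real_derivative Ha s) (at s)"
  shows "iter_pd [b] (\<lambda>y. H ((norm (y - a))\<^sup>2)) = (\<lambda>y. 2 * Ha ((norm (y - a))\<^sup>2) * ((y - a) \<bullet> b))"
  by (rule iter_pd_eqI) (rule radial_has_derivative[OF assms])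

lemma radial_pgrad:
  fixes a :: "'a::euclidean_space"
  assumes "\<And>s. s \<ge> 0 \<Longrightarrow> (H has_real_derivative Ha s) (at s)"
  shows "pgrad (\<lambda>y. H ((norm (y - a))\<^sup>2)) y = (2 * Ha ((norm (y - a))\<^sup>2)) *\<^sub>R (y - a)"
proof -
  have "pgrad (\<lambda>y. H ((norm (y - a))\<^sup>2)) y
      = (\<Sum>b\<in>Basis. (2 * Ha ((norm (y - a))\<^sup>2) * ((y - a) \<bullet> b)) *\<^sub>R b)"
    unfolding pgrad_def using radial_iter_pd[OF assms, of _ a] by simp
  also have "\<dots> = (2 * Ha ((norm (y - a))\<^sup>2)) *\<^sub>R (\<Sum>b\<in>Basis. ((y - a) \<bullet> b) *\<^sub>R b)"
    unfolding scaleR_right.sum scaleR_scaleR ..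
  finally show ?thesis by (simp only: euclidean_representation)
qed

lemma iter_pd_pair: "iter_pd [b, c] \<phi> = iter_pd [b] (iter_pd [c] \<phi>)"
  by simp

text \<open>Two applications of the chain rule with s = |y - a|^2. The coordinates of the H'' terms
  sum to |y - a|^2, while H' is collected once per dimension. The variable s instead of |y - a|
  avoids a singularity at the centre.\<close>

lemma radial_lap:
  fixes a :: "'a::euclidean_space" and H Ha Hb :: "real \<Rightarrow> real"
  assumes H: "\<And>s. s \<ge> 0 \<Longrightarrow> (H has_real_derivative Ha s) (at s)"
    and Ha: "\<And>s. s \<ge> 0 \<Longrightarrow> (Ha has_real_derivative Hb s) (at s)"
  shows "lap (\<lambda>y. H ((norm (y - a))\<^sup>2)) y
    = 4 * (norm (y - a))\<^sup>2 * Hb ((norm (y - a))\<^sup>2) + 2 * real DIM('a) * Ha ((norm (y - a))\<^sup>2)"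
proof -
  have "iter_pd [b, b] (\<lambda>y. H ((norm (y - a))\<^sup>2)) y
     = 4 * Hb ((norm (y - a))\<^sup>2) * (((y - a) \<bullet> b) * ((y - a) \<bullet> b)) + 2 * Ha ((norm (y - a))\<^sup>2)"
    if b: "b \<in> Basis" for b
  proof -
    have "((\<lambda>y. 2 * Ha ((norm (y - a))\<^sup>2) * ((y - a) \<bullet> b)) has_derivative
      (\<lambda>v. 4 * Hb ((norm (y - a))\<^sup>2) * ((y - a) \<bullet> v) * ((y - a) \<bullet> b) + 2 * Ha ((norm (y - a))\<^sup>2) * (v \<bullet> b))) (at y)" for y
      by (rule derivative_eq_intros radial_has_derivative[OF Ha] refl | simp)+
         (simp add: fun_eq_iff algebra_simps)
    note D2 = iter_pd_eqI[OF this, of b]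
    have "iter_pd [b, b] (\<lambda>y. H ((norm (y - a))\<^sup>2)) = iter_pd [b] (\<lambda>y. 2 * Ha ((norm (y - a))\<^sup>2) * ((y - a) \<bullet> b))"
      by (simp only: iter_pd_pair radial_iter_pd[OF H])
    then show ?thesis unfolding D2 using b by (simp only: fun_eq_iff) (simp add: inner_Basis)
  qed
  then have "lap (\<lambda>y. H ((norm (y - a))\<^sup>2)) y
    = (\<Sum>b\<in>Basis. 4 * Hb ((norm (y - a))\<^sup>2) * (((y - a) \<bullet> b) * ((y - a) \<bullet> b)) + 2 * Ha ((norm (y - a))\<^sup>2))"
    unfolding lap_def by simp
  also have "\<dots> = 4 * Hb ((norm (y - a))\<^sup>2) * ((y - a) \<bullet> (y - a)) + 2 * real DIM('a) * Ha ((norm (y - a))\<^sup>2)"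
    by (simp add: sum.distrib sum_distrib_left euclidean_inner[of "y - a" "y - a"])
  finally show ?thesis by (simp add: power2_norm_eq_inner mult_ac)
qed

text \<open>\<open>bubble \<rho>\<close> is \<open>- \<Delta>\<close> of \<open>(|z|\<^sup>2 + \<rho>\<^sup>2) powr (- (n - 2) / 2)\<close>.\<close>

definition bubble :: "real \<Rightarrow> 'a::euclidean_space \<Rightarrow> real" where
  "bubble \<rho> z = real DIM('a) * (real DIM('a) - 2) * \<rho>\<^sup>2 *
     ((norm z)\<^sup>2 + \<rho>\<^sup>2) powr (- (real DIM('a) + 2) / 2)"

text \<open>The bubble is positive everywhere; the cutoff makes it a test function. The mass is left
  unnormalised, so the constant \<open>LINT z|lborel. bubble 1 z\<close> accompanies every limit
  \<rho> \<rightarrow> 0.\<close>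

definition moll :: "real \<Rightarrow> 'a::euclidean_space \<Rightarrow> real" where
  "moll \<rho> z = cutoff ((norm z)\<^sup>2) * bubble \<rho> z"

text \<open>At \<rho> = 0 the power is |z|^(2-n), a multiple of the fundamental solution of the
  Laplacian. The parameter \<rho> removes its singularity and the cutoff its tail.\<close>

definition newt :: "real \<Rightarrow> 'a::euclidean_space \<Rightarrow> real" where
  "newt \<rho> z = cutoff ((norm z)\<^sup>2) * ((norm z)\<^sup>2 + \<rho>\<^sup>2) powr (- (real DIM('a) - 2) / 2)"

lemma smooth_alg_radial_powr:
  "\<rho> > 0 \<Longrightarrow> smooth_alg (\<lambda>y::'a::euclidean_space. ((norm (y - a))\<^sup>2 + \<rho>\<^sup>2) powr s)"
  by (intro smooth_alg.powr smooth_alg.add smooth_alg_norm_sq[of "\<lambda>x. x"] smooth_alg.const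
      bounded_linear_ident) (simp add: add_nonneg_pos)

lemma smooth_alg_radial_cutoff: "smooth_alg (\<lambda>y::'a::euclidean_space. cutoff ((norm (y - a))\<^sup>2))"
  by (intro smooth_alg_cutoff smooth_alg_norm_sq[of "\<lambda>x. x"] bounded_linear_ident)

lemma smooth_alg_moll: "\<rho> > 0 \<Longrightarrow> smooth_alg (\<lambda>y::'a::euclidean_space. moll \<rho> (y - a))"
  unfolding moll_def bubble_def
  by (intro smooth_alg.mult smooth_alg_radial_cutoff smooth_alg_radial_powr smooth_alg.const)

lemma smooth_alg_newt: "\<rho> > 0 \<Longrightarrow> smooth_alg (\<lambda>y::'a::euclidean_space. newt \<rho> (y - a))"
  unfolding newt_def
  by (intro smooth_alg.mult smooth_alg_radial_cutoff smooth_alg_radial_powr)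

lemma moll_eq_0: "norm z \<ge> 1 \<Longrightarrow> moll \<rho> z = 0"
  by (simp add: moll_def cutoff_eq_0)

lemma newt_eq_0: "norm z \<ge> 1 \<Longrightarrow> newt \<rho> z = 0"
  by (simp add: newt_def cutoff_eq_0)

lemma test_funI:
  assumes "smooth_alg \<phi>" "\<And>x. \<phi> x \<noteq> 0 \<Longrightarrow> x \<in> cball a r"
  shows "test_fun \<phi>"
proof -
  have "{x. \<phi> x \<noteq> 0} \<subseteq> cball a r" using assms(2) by blast
  then have "bounded {x. \<phi> x \<noteq> 0}" using bounded_subset bounded_cball by blast
  then show ?thesis
    using smooth_alg_imp_smooth_fun[OF assms(1)] by (simp add: test_fun_def compact_closure)
qed

lemma test_fun_moll: "\<rho> > 0 \<Longrightarrow> test_fun (\<lambda>y::'a::euclidean_space. moll \<rho> (y - a))"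
  by (rule test_funI[OF smooth_alg_moll, of _ _ a 1])
     (use moll_eq_0 in \<open>force simp: dist_norm norm_minus_commute\<close>)+

lemma test_fun_newt: "\<rho> > 0 \<Longrightarrow> test_fun (\<lambda>y::'a::euclidean_space. newt \<rho> (y - a))"
  by (rule test_funI[OF smooth_alg_newt, of _ _ a 1])
     (use newt_eq_0 in \<open>force simp: dist_norm norm_minus_commute\<close>)+

lemma bubble_nonneg: "DIM('a) \<ge> 2 \<Longrightarrow> bubble \<rho> (z::'a::euclidean_space) \<ge> 0"
  by (simp add: bubble_def)

lemma moll_nonneg: "DIM('a) \<ge> 2 \<Longrightarrow> moll \<rho> (z::'a::euclidean_space) \<ge> 0"
  by (simp add: moll_def bubble_nonneg cutoff_nonneg)

lemma newt_nonneg: "newt \<rho> z \<ge> 0"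
  by (simp add: newt_def cutoff_nonneg)

lemma newt_le:
  fixes z :: "'a::euclidean_space"
  assumes "DIM('a) \<ge> 2" "z \<noteq> 0"
  shows "newt \<rho> z \<le> norm z powr (2 - real DIM('a))"
proof -
  have "((norm z)\<^sup>2 + \<rho>\<^sup>2) powr (- (real DIM('a) - 2) / 2) \<le> ((norm z)\<^sup>2) powr (- (real DIM('a) - 2) / 2)"
    using assms by (intro powr_mono2') auto
  also have "\<dots> = norm z powr (2 - real DIM('a))"
    using assms by (simp add: powr_powr diff_divide_distrib flip: powr_numeral)
  finally have "1 * ((norm z)\<^sup>2 + \<rho>\<^sup>2) powr (- (real DIM('a) - 2) / 2) \<le> norm z powr (2 - real DIM('a))"
    by simp
  then show ?thesis unfolding newt_def
    by (meson cutoff_le_1 mult_right_mono order_trans powr_ge_zero)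
qed

text \<open>\<open>M\<close> does not depend on \<rho>: apart from the bubble, every term of the
  Laplacian contains a derivative of the cutoff and so lives on 1/2 \<le> |y - a| \<le> 1, away from
  the singularity. The gradient has the size of the gradient of |z|^(2-n).\<close>

lemma newt_kernel_bounds:
  assumes n: "DIM('a::euclidean_space) \<ge> 3"
  obtains M where "M > 0"
    "\<And>\<rho> a (y::'a). \<rho> > 0 \<Longrightarrow>
       \<bar>lap (\<lambda>y. newt \<rho> (y - a)) y + moll \<rho> (y - a)\<bar> \<le> M * indicator (cball a 1) y"
    "\<And>\<rho> a (y::'a). \<rho> > 0 \<Longrightarrow>
       norm (pgrad (\<lambda>y. newt \<rho> (y - a)) y) \<le> M * norm (y - a) powr (1 - real DIM('a)) * indicator (cball a 1) y"
proof -
  obtain c1 c2 M0 where c: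
    "\<And>s. (cutoff has_real_derivative c1 s) (at s)"
    "\<And>s. (c1 has_real_derivative c2 s) (at s)"
    "\<And>s. s < 1/4 \<Longrightarrow> c1 s = 0 \<and> c2 s = 0"
    "\<And>s. s > 1 \<Longrightarrow> c1 s = 0 \<and> c2 s = 0"
    "\<And>s. \<bar>c1 s\<bar> \<le> M0" "\<And>s. \<bar>c2 s\<bar> \<le> M0" "M0 > 0" by (rule cutoff_derivatives) blast
  define n where "n = real DIM('a)"
  define m where "m = (n - 2) / 2"
  have n3: "n \<ge> 3" "m > 0" "n = 2 * m + 2" using n by (auto simp: n_def m_def field_simps)
  define h where "h \<rho> s = (s + \<rho>\<^sup>2) powr (- m)" for \<rho> s :: real
  define h1 where "h1 \<rho> s = - m * (s + \<rho>\<^sup>2) powr (- m - 1)" for \<rho> s :: real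
  define h2 where "h2 \<rho> s = m * (m + 1) * (s + \<rho>\<^sup>2) powr (- m - 2)" for \<rho> s :: real
  define Ha where "Ha \<rho> s = c1 s * h \<rho> s + cutoff s * h1 \<rho> s" for \<rho> s
  define Hb where "Hb \<rho> s = c2 s * h \<rho> s + 2 * c1 s * h1 \<rho> s + cutoff s * h2 \<rho> s" for \<rho> s
  have pos: "s + \<rho>\<^sup>2 > 0" if "s \<ge> 0" "\<rho> > 0" for s \<rho> :: real using that by (simp add: add_nonneg_pos)
  have dh: "(h \<rho> has_real_derivative h1 \<rho> s) (at s)" if "s \<ge> 0" "\<rho> > 0" for s \<rho>
    unfolding h_def h1_def
    using pos[OF that] by (auto intro!: derivative_eq_intros)
  have dh1: "(h1 \<rho> has_real_derivative h2 \<rho> s) (at s)" if "s \<ge> 0" "\<rho> > 0" for s \<rho>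
    unfolding h2_def h1_def
    using pos[OF that] by (auto intro!: derivative_eq_intros simp: algebra_simps)
  have dH: "((\<lambda>s. cutoff s * h \<rho> s) has_real_derivative Ha \<rho> s) (at s)" if "s \<ge> 0" "\<rho> > 0" for s \<rho>
    unfolding Ha_def using dh[OF that] c(1)[of s]
    by (auto intro!: derivative_eq_intros simp: mult_ac)
  have dHa: "(Ha \<rho> has_real_derivative Hb \<rho> s) (at s)" if "s \<ge> 0" "\<rho> > 0" for s \<rho>
    unfolding Ha_def Hb_def using dh[OF that] dh1[OF that] c(1)[of s] c(2)[of s]
    by (auto intro!: derivative_eq_intros simp: algebra_simps)
  have newt: "newt \<rho> (y - a) = cutoff ((norm (y - a))\<^sup>2) * h \<rho> ((norm (y - a))\<^sup>2)" for \<rho> and a y :: 'a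
    unfolding newt_def h_def m_def n_def by (simp only: minus_divide_left)
  \<comment> \<open>With n = 2 m + 2 both terms carry the factor 4 m (m + 1), which is n (n - 2),
    and s - (s + \<rho>^2) leaves only - \<rho>^2.\<close>
  have bub: "4 * s * h2 \<rho> s + 2 * n * h1 \<rho> s = - (n * (n - 2) * \<rho>\<^sup>2 * (s + \<rho>\<^sup>2) powr (- (n + 2) / 2))"
    if "s \<ge> 0" "\<rho> > 0" for s \<rho>
  proof -
    have e: "(s + \<rho>\<^sup>2) powr (- m - 1) = (s + \<rho>\<^sup>2) * (s + \<rho>\<^sup>2) powr (- m - 2)"
    proof -
      have "(s + \<rho>\<^sup>2) powr (1 + (- m - 2)) = (s + \<rho>\<^sup>2) * (s + \<rho>\<^sup>2) powr (- m - 2)"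
        using pos[OF that] by (subst powr_add) simp
      moreover have "1 + (- m - 2) = - m - 1" by simp
      ultimately show ?thesis by (simp only:)
    qed
    have e2: "- (n + 2) / 2 = - m - 2" using n3 by simp
    show ?thesis unfolding h1_def h2_def e e2 using n3(3) by (simp add: algebra_simps power2_eq_square)
  qed
  \<comment> \<open>\<open>J\<close> collects exactly the terms of the Laplacian in which the cutoff
    has been differentiated.\<close>
  define J where "J \<rho> s = 4 * s * c2 s * h \<rho> s + 8 * s * c1 s * h1 \<rho> s + 2 * n * c1 s * h \<rho> s" for \<rho> s
  have lap: "lap (\<lambda>y. newt \<rho> (y - a)) y + moll \<rho> (y - a) = J \<rho> ((norm (y - a))\<^sup>2)"
    if "\<rho> > 0" for \<rho> and a y :: 'a
  proof -
    define s where "s = (norm (y - a))\<^sup>2"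
    have s: "s \<ge> 0" by (simp add: s_def)
    have "lap (\<lambda>y. newt \<rho> (y - a)) y = 4 * s * Hb \<rho> s + 2 * n * Ha \<rho> s"
      unfolding newt s_def n_def
      by (rule radial_lap[of "\<lambda>s. cutoff s * h \<rho> s" "Ha \<rho>" "Hb \<rho>"]) (use that dH dHa in auto)
    also have "\<dots> = J \<rho> s + cutoff s * (4 * s * h2 \<rho> s + 2 * n * h1 \<rho> s)"
      by (simp add: Ha_def Hb_def J_def algebra_simps)
    also have "\<dots> = J \<rho> s - moll \<rho> (y - a)"
      unfolding bub[OF s that] by (simp add: moll_def bubble_def s_def n_def)
    finally show ?thesis by (simp add: s_def)
  qed
  have h_le: "0 \<le> h \<rho> s" "h \<rho> s \<le> s powr (- m)" if "s > 0" "\<rho> > 0" for s \<rho>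
    using that n3 by (auto simp: h_def intro!: powr_mono2')
  have h1_le: "\<bar>h1 \<rho> s\<bar> \<le> m * s powr (- m - 1)" if "s > 0" "\<rho> > 0" for s \<rho>
    using that n3 by (auto simp: h1_def abs_mult intro!: powr_mono2' mult_left_mono)
  \<comment> \<open>The first three summands bound the three terms of \<open>J\<close> for s \<ge>
    1/4, where a negative power of s is at most the same power of 1/4; the last one bounds the
    gradient.\<close>
  define M where "M = 4 * M0 * 4 powr m + 8 * M0 * m * 4 powr (m + 1) + 2 * n * M0 * 4 powr m + 2 * (M0 + m)"
  have parts: "4 * M0 * 4 powr m \<ge> 0" "8 * M0 * m * 4 powr (m + 1) \<ge> 0" "2 * n * M0 * 4 powr m \<ge> 0" "2 * (M0 + m) > 0"
    using n3 c(7) by auto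
  have M: "M > 0" using parts unfolding M_def by linarith
  have J: "\<bar>J \<rho> s\<bar> \<le> M * (if s \<le> 1 then 1 else 0)" if "s \<ge> 0" "\<rho> > 0" for s \<rho>
  proof (cases "1/4 \<le> s \<and> s \<le> 1")
    case True
    have q: "(1/4::real) powr (- m) = 4 powr m" "(1/4::real) powr (- m - 1) = 4 powr (m + 1)"
    proof -
      show "(1/4::real) powr (- m) = 4 powr m" by (simp add: powr_minus powr_divide)
      have "(1/4::real) powr (- m - 1) = inverse ((1/4) powr (m + 1))"
        by (simp flip: powr_minus)
      then show "(1/4::real) powr (- m - 1) = 4 powr (m + 1)" by (simp add: powr_divide)
    qed
    have hb: "\<bar>h \<rho> s\<bar> \<le> 4 powr m"
    proof -
      have "s powr (- m) \<le> (1/4) powr (- m)" using True n3 by (intro powr_mono2') auto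
      then show ?thesis using h_le[of s \<rho>] True that q by auto
    qed
    have h1b: "\<bar>h1 \<rho> s\<bar> \<le> m * 4 powr (m + 1)"
    proof -
      have "s powr (- m - 1) \<le> (1/4) powr (- m - 1)" using True n3 by (intro powr_mono2') auto
      then have "m * s powr (- m - 1) \<le> m * 4 powr (m + 1)" using n3 q by (intro mult_left_mono) auto
      then show ?thesis using h1_le[of s \<rho>] True that by auto
    qed
    have "\<bar>J \<rho> s\<bar> \<le> \<bar>4 * s * c2 s * h \<rho> s\<bar> + \<bar>8 * s * c1 s * h1 \<rho> s\<bar> + \<bar>2 * n * c1 s * h \<rho> s\<bar>"
      unfolding J_def by linarith
    also have "\<dots> \<le> 4 * 1 * M0 * 4 powr m + 8 * 1 * M0 * (m * 4 powr (m + 1)) + 2 * n * M0 * 4 powr m"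
      unfolding abs_mult using True n3 hb h1b c(5)[of s] c(6)[of s] c(7)
      by (intro add_mono mult_mono) auto
    also have "\<dots> \<le> M" using parts by (simp add: M_def)
    finally show ?thesis using True by simp
  next
    case False
    then have "c1 s = 0" "c2 s = 0" using c(3,4)[of s] by auto
    then have "J \<rho> s = 0" by (simp add: J_def)
    then show ?thesis using M by simp
  qed
  have grad: "norm (pgrad (\<lambda>y. newt \<rho> (y - a)) y) \<le> M * norm (y - a) powr (1 - n) * indicator (cball a 1) y"
    if \<rho>: "\<rho> > 0" for \<rho> and a y :: 'a
  proof -
    define s where "s = (norm (y - a))\<^sup>2"
    have pg: "pgrad (\<lambda>y. newt \<rho> (y - a)) y = (2 * Ha \<rho> s) *\<^sub>R (y - a)"
      unfolding newt s_def by (rule radial_pgrad[of "\<lambda>s. cutoff s * h \<rho> s"]) (use that dH in auto)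
    show ?thesis
    proof (cases "y = a")
      case False
      then have s: "s > 0" by (simp add: s_def)
      show ?thesis
      proof (cases "s \<le> 1")
        case True
        have "\<bar>Ha \<rho> s\<bar> \<le> \<bar>c1 s * h \<rho> s\<bar> + \<bar>cutoff s * h1 \<rho> s\<bar>" unfolding Ha_def by linarith
        also have "\<dots> \<le> M0 * s powr (- m) + 1 * (m * s powr (- m - 1))"
          unfolding abs_mult using c(5)[of s] c(7) h_le[OF s \<rho>] h1_le[OF s \<rho>] cutoff_nonneg[of s] cutoff_le_1[of s] n3
          by (intro add_mono mult_mono) auto
        also have "s powr (- m) \<le> s powr (- m - 1)" using s True by (intro powr_mono') auto
        finally have Ha: "\<bar>Ha \<rho> s\<bar> \<le> (M0 + m) * s powr (- m - 1)" using c(7) by (simp add: algebra_simps)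
        have "s powr (- m - 1) * norm (y - a) = norm (y - a) powr (2 * (- m - 1)) * norm (y - a) powr 1"
          using False by (simp add: s_def powr_powr flip: powr_numeral)
        also have "\<dots> = norm (y - a) powr (1 - n)"
          unfolding powr_add[symmetric] using n3(3) by (simp add: algebra_simps)
        finally have e: "s powr (- m - 1) * norm (y - a) = norm (y - a) powr (1 - n)" .
        have "norm (pgrad (\<lambda>y. newt \<rho> (y - a)) y) = 2 * (\<bar>Ha \<rho> s\<bar> * norm (y - a))"
          unfolding pg by (simp add: abs_mult)
        also have "\<dots> \<le> 2 * ((M0 + m) * s powr (- m - 1) * norm (y - a))"
          using Ha by (intro mult_left_mono mult_right_mono) auto
        also have "\<dots> = 2 * (M0 + m) * norm (y - a) powr (1 - n)"
          using e by (simp add: mult.assoc)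
        also have "\<dots> \<le> M * norm (y - a) powr (1 - n)"
          using parts by (intro mult_right_mono) (auto simp: M_def)
        finally show ?thesis
          using True by (simp add: s_def dist_norm norm_minus_commute abs_square_le_1)
      next
        case False
        then have "Ha \<rho> s = 0" using c(4)[of s] by (simp add: Ha_def cutoff_eq_0)
        then show ?thesis using pg M by (simp add: indicator_def)
      qed
    next
      case True
      then have "pgrad (\<lambda>y. newt \<rho> (y - a)) y = 0" using pg by simp
      then show ?thesis using M by simp
    qed
  qed
  show ?thesis
  proof (rule that[OF M])
    fix \<rho> :: real and a y :: 'a assume \<rho>: "\<rho> > 0"
    have "indicator (cball a 1) y = (if (norm (y - a))\<^sup>2 \<le> 1 then 1 else (0::real))"
      by (auto simp: indicator_def dist_norm norm_minus_commute abs_square_le_1)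
    then show "\<bar>lap (\<lambda>y. newt \<rho> (y - a)) y + moll \<rho> (y - a)\<bar> \<le> M * indicator (cball a 1) y"
      using J[of "(norm (y - a))\<^sup>2" \<rho>] \<rho> by (simp add: lap)
  qed (use grad n_def in auto)
qed


section \<open>Integrals of powers and change of variables\<close>

lemma powr_square_half: "x > 0 \<Longrightarrow> (x\<^sup>2) powr (s / 2) = (x::real) powr s"
  by (simp add: powr_powr flip: powr_numeral)

lemma sets_borel_cball [measurable]: "cball a r \<in> sets borel"
  by (simp add: borel_closed)

text \<open>Stands in for integration in polar coordinates: \<open>w\<close> is dominated by a
  series of multiples of ball indicators whose masses, height \<open>A j\<close> times volume, form
  a geometric series. The balls may shrink, for a singularity at 0, or grow, for a tail at
  infinity.\<close>

lemma nn_integral_dyadic: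
  fixes w :: "'a::euclidean_space \<Rightarrow> real" and A r :: "nat \<Rightarrow> real"
  assumes [measurable]: "w \<in> borel_measurable borel"
    and "\<And>z. w z \<le> 0 \<or> (\<exists>j. norm z \<le> r j \<and> w z \<le> A j)"
    and "\<And>j. A j \<ge> 0" "\<And>j. r j \<ge> 0"
    and "\<And>j. A j * (unit_ball_vol (real DIM('a)) * r j ^ DIM('a)) = K * q ^ j"
    and "0 \<le> q" "q < 1" "K \<ge> 0"
  shows "(\<integral>\<^sup>+z. ennreal (w z) \<partial>lborel) \<le> ennreal (K / (1 - q))"
proof -
  have "(\<integral>\<^sup>+z. ennreal (w z) \<partial>lborel)
      \<le> (\<integral>\<^sup>+(z::'a). (\<Sum>j. ennreal (A j) * indicator (cball 0 (r j)) z) \<partial>lborel)"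
  proof (rule nn_integral_mono)
    fix z
    show "ennreal (w z) \<le> (\<Sum>j. ennreal (A j) * indicator (cball 0 (r j)) z)"
    proof (cases "w z \<le> 0")
      case False
      then obtain j where j: "norm z \<le> r j" "w z \<le> A j" using assms(2) by blast
      have "ennreal (w z) \<le> sum (\<lambda>j. ennreal (A j) * indicator (cball 0 (r j)) z) {j}"
        using j by (simp add: ennreal_leI)
      also have "\<dots> \<le> (\<Sum>j. ennreal (A j) * indicator (cball 0 (r j)) z)"
        by (rule sum_le_suminf) auto
      finally show ?thesis .
    qed (simp add: ennreal_neg)
  qed
  also have "\<dots> = (\<Sum>j. \<integral>\<^sup>+(z::'a). ennreal (A j) * indicator (cball 0 (r j)) z \<partial>lborel)"
    by (rule nn_integral_suminf) measurable
  also have "\<dots> = (\<Sum>j. ennreal (K * q ^ j))"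
  proof (rule suminf_cong)
    fix j
    have "(\<integral>\<^sup>+(z::'a). ennreal (A j) * indicator (cball 0 (r j)) z \<partial>lborel) = ennreal (A j) * emeasure lborel (cball (0::'a) (r j))"
      by (subst nn_integral_cmult_indicator) auto
    also have "\<dots> = ennreal (K * q ^ j)"
      using assms(3,4) by (simp add: emeasure_cball ennreal_mult[symmetric] assms(5))
    finally show "(\<integral>\<^sup>+z. ennreal (A j) * indicator (cball (0::'a) (r j)) z \<partial>lborel) = ennreal (K * q ^ j)" .
  qed
  also have "\<dots> = ennreal (\<Sum>j. K * q ^ j)"
    using assms(6-8) by (intro suminf_ennreal2) (auto intro!: summable_mult summable_geometric)
  also have "(\<Sum>j. K * q ^ j) = K / (1 - q)"
    using assms(6,7) by (subst suminf_mult) (auto simp: suminf_geometric summable_geometric)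
  finally show ?thesis .
qed

text \<open>On the shell between radii \<tau>/2^(j+1) and \<tau>/2^j the height is at most that at
  the inner radius. Consecutive masses have ratio 2^(a-n), which is below 1 because a < n. The
  positive power of \<tau> is what makes small balls contribute little later on.\<close>

lemma nn_integral_powr_cball:
  fixes a :: real
  assumes "0 \<le> a" "a < real DIM('a::euclidean_space)"
  obtains K where "K > 0"
    "\<And>\<tau>. \<tau> > 0 \<Longrightarrow> (\<integral>\<^sup>+z. ennreal (norm (z::'a) powr (- a) * indicator (cball 0 \<tau>) z) \<partial>lborel)
        \<le> ennreal (K * \<tau> powr (real DIM('a) - a))"
proof -
  define n where "n = real DIM('a)"
  define v where "v = unit_ball_vol n"
  define q where "q = 2 powr (a - n)"
  have v: "v > 0" by (simp add: v_def n_def unit_ball_vol_pos)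
  have q: "0 < q" "q < 1" using assms by (auto simp: q_def n_def powr_less_one)
  define K where "K = v * 2 powr a / (1 - q)"
  show ?thesis
  proof (rule that[of K])
    show "K > 0" using v q by (simp add: K_def)
    fix \<tau> :: real assume \<tau>: "\<tau> > 0"
    have "(\<integral>\<^sup>+z. ennreal (norm (z::'a) powr (- a) * indicator (cball 0 \<tau>) z) \<partial>lborel)
       \<le> ennreal ((v * 2 powr a * \<tau> powr (n - a)) / (1 - q))"
    proof (rule nn_integral_dyadic[where r = "\<lambda>j. \<tau> / 2 ^ j" and A = "\<lambda>j. (\<tau> / 2 ^ (j + 1)) powr (- a)"])
      fix z :: 'a
      show "norm z powr (- a) * indicator (cball 0 \<tau>) z \<le> 0 \<or>
         (\<exists>j. norm z \<le> \<tau> / 2 ^ j \<and> norm z powr (- a) * indicator (cball 0 \<tau>) z \<le> (\<tau> / 2 ^ (j + 1)) powr (- a))"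
      \<comment> \<open>Since \<open>0 powr (- a) = 0\<close>, the origin belongs to the trivial
        alternative.\<close>
      proof (cases "z = 0 \<or> norm z > \<tau>")
        case False
        then have z: "0 < norm z" "norm z \<le> \<tau>" by auto
        have "\<exists>j. \<tau> / 2 ^ j < norm z"
        proof -
          obtain j where "(1/2) ^ j < norm z / \<tau>"
            using z \<tau> real_arch_pow_inv[of "norm z / \<tau>" "1/2"] by auto
          then show ?thesis using \<tau> by (intro exI[of _ j]) (simp add: field_simps power_divide)
        qed
        define J where "J = (LEAST j. \<tau> / 2 ^ j < norm z)"
        have J: "\<tau> / 2 ^ J < norm z" unfolding J_def by (rule LeastI_ex) fact
        then have "J \<noteq> 0" using z by (cases J) auto
        then obtain j where j: "J = Suc j" by (cases J) auto
        have "\<not> \<tau> / 2 ^ j < norm z" using not_less_Least[of j "\<lambda>j. \<tau> / 2 ^ j < norm z"] j J_def by auto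
        moreover have "norm z powr (- a) \<le> (\<tau> / 2 ^ (j + 1)) powr (- a)"
          using J j \<tau> assms by (intro powr_mono2') auto
        ultimately show ?thesis using z by (intro disjI2 exI[of _ j]) auto
      qed auto
    next
      fix j
      have "(\<tau> / 2 ^ (j + 1)) powr (- a) = \<tau> powr (- a) * 2 powr a * (2 powr a) ^ j"
        using \<tau> by (simp add: powr_divide powr_minus powr_mult field_simps powr_powr flip: powr_realpow)
      moreover have "(\<tau> / 2 ^ j) ^ DIM('a) = \<tau> powr n * (2 powr (- n)) ^ j"
        using \<tau> by (simp add: n_def power_divide powr_minus powr_realpow field_simps power_inverse)
          (simp add: power_mult[symmetric] mult.commute)
      moreover have "q ^ j = (2 powr a) ^ j * (2 powr (- n)) ^ j"
        by (simp add: q_def power_mult_distrib[symmetric] powr_add[symmetric])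
      moreover have "\<tau> powr (n - a) = \<tau> powr n * \<tau> powr (- a)" by (simp add: powr_add[symmetric])
      ultimately show "(\<tau> / 2 ^ (j + 1)) powr (- a) * (unit_ball_vol (real DIM('a)) * (\<tau> / 2 ^ j) ^ DIM('a))
        = v * 2 powr a * \<tau> powr (n - a) * q ^ j" by (simp add: v_def n_def)
    qed (use q v \<tau> in auto)
    then show "(\<integral>\<^sup>+z. ennreal (norm (z::'a) powr (- a) * indicator (cball 0 \<tau>) z) \<partial>lborel)
        \<le> ennreal (K * \<tau> powr (real DIM('a) - a))" by (simp add: K_def n_def)
  qed
qed

lemma measurable_bubble [measurable]: "bubble \<rho> \<in> borel_measurable borel"
  unfolding bubble_def by measurable

lemma continuous_cutoff: "continuous_on UNIV cutoff"
  using smooth_alg_continuous[OF smooth_alg_cutoff[OF smooth_alg.linear[OF bounded_linear_ident]]] .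

lemma measurable_cutoff [measurable]: "cutoff \<in> borel_measurable borel"
  by (rule borel_measurable_continuous_onI[OF continuous_cutoff])

lemma measurable_moll [measurable]: "moll \<rho> \<in> borel_measurable borel"
  unfolding moll_def by measurable

lemma measurable_newt [measurable]: "newt \<rho> \<in> borel_measurable borel"
  unfolding newt_def by measurable

text \<open>Here the dyadic balls grow: the volume gains a factor 2^n per step and the height loses
  2^(n+2), so the ratio is 1/4.\<close>

lemma integrable_bubble:
  assumes "DIM('a::euclidean_space) \<ge> 3"
  shows "integrable lborel (bubble 1 :: 'a \<Rightarrow> real)"
proof (rule integrableI_nonneg)
  define n where "n = real DIM('a)"
  define v where "v = unit_ball_vol n"
  have n: "n \<ge> 3" using assms by (simp add: n_def)
  have v: "v > 0" by (simp add: v_def n_def unit_ball_vol_pos)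
  show "AE z in lborel. 0 \<le> bubble 1 (z::'a)" using assms by (simp add: bubble_nonneg)
  have "(\<integral>\<^sup>+z. ennreal (bubble 1 (z::'a)) \<partial>lborel) \<le> ennreal ((n * (n - 2) * v * 2 powr n) / (1 - 1/4))"
  proof (rule nn_integral_dyadic[where r = "\<lambda>j. 2 ^ Suc j" and A = "\<lambda>j. n * (n - 2) * (2 ^ j) powr (- (n + 2))"])
    fix z :: 'a
    have "\<exists>j. norm z \<le> 2 ^ Suc j" 
      using real_arch_pow[of 2 "norm z"] by (metis less_eq_real_def numeral_One numeral_less_iff power_Suc power_increasing_iff le_SucI lessI order.trans semiring_norm(76))
    define J where "J = (LEAST j. norm z \<le> 2 ^ Suc j)"
    have J: "norm z \<le> 2 ^ Suc J" unfolding J_def by (rule LeastI_ex) fact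
    have "(2 ^ J)\<^sup>2 \<le> (norm z)\<^sup>2 + 1"
    proof (cases J)
      case (Suc j)
      have "\<not> norm z \<le> 2 ^ Suc j"
        using not_less_Least[of j "\<lambda>j. norm z \<le> 2 ^ Suc j"] Suc J_def by auto
      then have "(2 ^ J)\<^sup>2 \<le> (norm z)\<^sup>2" unfolding Suc by (intro power_mono) auto
      then show ?thesis by linarith
    qed simp
    then have "((norm z)\<^sup>2 + 1) powr (- (n + 2) / 2) \<le> ((2 ^ J)\<^sup>2) powr (- (n + 2) / 2)"
      using n by (intro powr_mono2') auto
    also have "\<dots> = (2 ^ J) powr (- (n + 2))"
      using powr_square_half[of "2 ^ J" "- (n + 2)"] by simp
    finally have "n * (n - 2) * ((norm z)\<^sup>2 + 1) powr (- (n + 2) / 2) \<le> n * (n - 2) * (2 ^ J) powr (- (n + 2))"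
      using n by (intro mult_left_mono) auto
    then show "bubble 1 z \<le> 0 \<or> (\<exists>j. norm z \<le> 2 ^ Suc j \<and> bubble 1 z \<le> n * (n - 2) * (2 ^ j) powr (- (n + 2)))"
      using J by (intro disjI2 exI[of _ J]) (simp add: bubble_def n_def)
  next
    fix j
    have "((2::real) ^ j) powr (- (n + 2)) = (2 powr (- n) * (1/4)) ^ j"
      by (simp add: powr_realpow[symmetric] powr_powr powr_add powr_minus field_simps powr_diff power_mult_distrib)
        (simp only: mult.commute[of "real j" 2] powr_powr[symmetric], simp)
    moreover have "((2::real) ^ Suc j) ^ DIM('a) = 2 powr n * (2 powr n) ^ j"
      by (simp add: n_def powr_realpow power_mult[symmetric] power_add mult.commute power_mult_distrib)
    moreover have "(2 powr (- n) * (1/4)) ^ j * (2 powr n) ^ j = (1/4::real) ^ j"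
      by (simp add: power_mult_distrib[symmetric] powr_minus)
    ultimately show "n * (n - 2) * (2 ^ j) powr (- (n + 2)) * (unit_ball_vol (real DIM('a)) * (2 ^ Suc j) ^ DIM('a))
       = n * (n - 2) * v * 2 powr n * (1/4) ^ j" by (simp add: v_def n_def mult_ac)
  qed (use n v in auto)
  then show "(\<integral>\<^sup>+z. ennreal (bubble 1 (z::'a)) \<partial>lborel) < \<infinity>"
    using order.strict_trans1 by fastforce
qed simp

lemma bubble_mass_pos:
  assumes "DIM('a::euclidean_space) \<ge> 3"
  shows "(LINT z|lborel. bubble 1 (z::'a)) > 0"
proof -
  have pos: "bubble 1 (z::'a) > 0" for z
    using assms unfolding bubble_def
    by (intro mult_pos_pos) (auto simp: add_nonneg_eq_0_iff)
  have "(LINT z|lborel. bubble 1 (z::'a)) \<noteq> 0"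
  proof
    assume "(LINT z|lborel. bubble 1 (z::'a)) = 0"
    then have "AE z in lborel. bubble 1 (z::'a) = 0"
      by (subst (asm) integral_nonneg_eq_0_iff_AE[OF integrable_bubble[OF assms]])
        (use pos less_imp_le in auto)
    then have "AE z in (lborel::'a measure). False" using pos by (auto simp: less_le)
    then show False by (simp add: eventually_False ae_filter_eq_bot_iff)
  qed
  moreover have "(LINT z|lborel. bubble 1 (z::'a)) \<ge> 0"
    using pos by (intro integral_nonneg_AE) (auto simp: less_imp_le)
  ultimately show ?thesis by linarith
qed

section \<open>Translations, reflections and dilations of integrals\<close>

lemma nn_integral_lborel_shift:
  fixes f :: "'a::euclidean_space \<Rightarrow> ennreal"
  assumes [measurable]: "f \<in> borel_measurable borel"
  shows "(\<integral>\<^sup>+y. f (y - a) \<partial>lborel) = (\<integral>\<^sup>+y. f y \<partial>lborel)"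
proof -
  have "(\<integral>\<^sup>+y. f y \<partial>lborel) = (\<integral>\<^sup>+y. f y \<partial>(distr lborel borel ((+) (- a))))"
    by (simp add: lborel_distr_plus)
  also have "\<dots> = (\<integral>\<^sup>+y. f (- a + y) \<partial>lborel)" by (subst nn_integral_distr) auto
  finally show ?thesis by simp
qed

lemma nn_integral_lborel_reflect:
  fixes f :: "'a::euclidean_space \<Rightarrow> ennreal"
  assumes [measurable]: "f \<in> borel_measurable borel"
  shows "(\<integral>\<^sup>+y. f (a - y) \<partial>lborel) = (\<integral>\<^sup>+y. f y \<partial>lborel)"
proof -
  have "(\<integral>\<^sup>+y. f y \<partial>lborel) = (\<integral>\<^sup>+y. f y \<partial>(density (distr lborel borel (\<lambda>x. a + (-1) *\<^sub>R x)) (\<lambda>_. \<bar>-1::real\<bar>^DIM('a))))"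
    by (subst lborel_affine[of "-1" a]) auto
  also have "\<dots> = (\<integral>\<^sup>+y. f (a - y) \<partial>lborel)"
    by (simp add: density_1 nn_integral_distr)
  finally show ?thesis by simp
qed

lemma integral_lborel_affine:
  fixes f :: "'a::euclidean_space \<Rightarrow> real"
  assumes [measurable]: "f \<in> borel_measurable borel" and c: "c \<noteq> 0"
  shows "(LINT x|lborel. f x) = \<bar>c\<bar> ^ DIM('a) * (LINT z|lborel. f (t + c *\<^sub>R z))"
  by (subst lborel_affine[OF c, of t]) (simp add: integral_density integral_distr)

lemma integral_lborel_shift:
  fixes f :: "'a::euclidean_space \<Rightarrow> real"
  assumes "f \<in> borel_measurable borel"
  shows "(LINT x|lborel. f (x + t)) = (LINT x|lborel. f x)"
  using integral_lborel_affine[OF assms, of 1 t] by (simp add: add.commute)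

text \<open>The bubble is a mass-preserving dilation of its profile at \<rho> = 1, which makes it an
  approximate identity with a mass independent of \<rho>.\<close>

lemma bubble_scale:
  assumes "\<rho> > 0"
  shows "\<rho> ^ DIM('a) * bubble \<rho> (\<rho> *\<^sub>R (z::'a::euclidean_space)) = bubble 1 z"
proof -
  define n where "n = real DIM('a)"
  have "(norm (\<rho> *\<^sub>R z))\<^sup>2 + \<rho>\<^sup>2 = \<rho>\<^sup>2 * ((norm z)\<^sup>2 + 1)" by (simp add: power_mult_distrib algebra_simps)
  then have "((norm (\<rho> *\<^sub>R z))\<^sup>2 + \<rho>\<^sup>2) powr (- (n + 2) / 2) = (\<rho>\<^sup>2) powr (- (n + 2) / 2) * ((norm z)\<^sup>2 + 1) powr (- (n + 2) / 2)"
    by (simp add: powr_mult)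
  also have "(\<rho>\<^sup>2) powr (- (n + 2) / 2) = \<rho> powr (- (n + 2))"
    using powr_square_half[OF assms, of "- (n + 2)"] by simp
  finally have e: "((norm (\<rho> *\<^sub>R z))\<^sup>2 + \<rho>\<^sup>2) powr (- (n + 2) / 2) = \<rho> powr (- (n + 2)) * ((norm z)\<^sup>2 + 1) powr (- (n + 2) / 2)" .
  have "\<rho> ^ DIM('a) * \<rho>\<^sup>2 * \<rho> powr (- (n + 2)) = \<rho> powr (n + 2 + (- (n + 2)))"
    unfolding powr_add using assms by (simp add: n_def powr_realpow)
  also have "\<dots> = 1" using assms by simp
  finally have e2: "\<rho> ^ DIM('a) * \<rho>\<^sup>2 * \<rho> powr (- (n + 2)) = 1" .
  have "\<rho> ^ DIM('a) * bubble \<rho> (\<rho> *\<^sub>R z)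
     = n * (n - 2) * (\<rho> ^ DIM('a) * \<rho>\<^sup>2 * \<rho> powr (- (n + 2))) * ((norm z)\<^sup>2 + 1) powr (- (n + 2) / 2)"
    unfolding bubble_def n_def[symmetric] e by (simp add: mult_ac)
  then show ?thesis unfolding e2 by (simp add: bubble_def n_def)
qed


section \<open>An approximate identity\<close>

lemma moll_le_bubble: "DIM('a) \<ge> 2 \<Longrightarrow> moll \<rho> (z::'a::euclidean_space) \<le> bubble \<rho> z"
  unfolding moll_def using cutoff_le_1 bubble_nonneg[of \<rho> z] by (simp add: mult_left_le_one_le cutoff_nonneg)

lemma moll_le_const:
  assumes "DIM('a::euclidean_space) \<ge> 2" "\<rho> > 0"
  shows "moll \<rho> (z::'a) \<le> bubble \<rho> (0::'a)"
proof -
  have "((norm z)\<^sup>2 + \<rho>\<^sup>2) powr (- (real DIM('a) + 2) / 2) \<le> ((norm (0::'a))\<^sup>2 + \<rho>\<^sup>2) powr (- (real DIM('a) + 2) / 2)"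
    using assms by (intro powr_mono2') auto
  then have "bubble \<rho> z \<le> bubble \<rho> (0::'a)"
    unfolding bubble_def using assms(1) by (intro mult_left_mono) auto
  then show ?thesis using moll_le_bubble[OF assms(1), of \<rho> z] by linarith
qed

text \<open>The substitution x = y - \<rho> z moves all dependence on \<rho> into the indicator and
  the cutoff, so that the fixed integrable function \<open>bubble 1\<close> can serve as
  majorant.\<close>

lemma moll_convolution_scale:
  fixes y :: "'a::euclidean_space"
  assumes "\<rho> > 0" and [measurable]: "A \<in> sets borel"
  shows "(LINT x|lborel. indicator A x * moll \<rho> (y - x))
     = (LINT z|lborel. indicator A (y - \<rho> *\<^sub>R z) * cutoff ((norm (\<rho> *\<^sub>R z))\<^sup>2) * bubble 1 z)"
proof -
  have "(LINT x|lborel. indicator A x * moll \<rho> (y - x))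
      = \<bar>- \<rho>\<bar> ^ DIM('a) * (LINT z|lborel. indicator A (y + (- \<rho>) *\<^sub>R z) * moll \<rho> (y - (y + (- \<rho>) *\<^sub>R z)))"
    using assms by (intro integral_lborel_affine) auto
  also have "\<dots> = (LINT z|lborel. \<rho> ^ DIM('a) * (indicator A (y - \<rho> *\<^sub>R z) * moll \<rho> (\<rho> *\<^sub>R z)))"
    using assms by simp
  also have "\<dots> = (LINT z|lborel. indicator A (y - \<rho> *\<^sub>R z) * cutoff ((norm (\<rho> *\<^sub>R z))\<^sup>2) * (\<rho> ^ DIM('a) * bubble \<rho> (\<rho> *\<^sub>R z)))"
    by (simp add: moll_def mult_ac)
  finally show ?thesis by (simp only: bubble_scale[OF assms(1)])
qed

lemma moll_convolution_bounds:
  fixes y :: "'a::euclidean_space"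
  assumes n: "DIM('a) \<ge> 3" and \<rho>: "\<rho> > 0" and A[measurable]: "A \<in> sets borel"
  shows "0 \<le> (LINT x|lborel. indicator A x * moll \<rho> (y - x))"
    "(LINT x|lborel. indicator A x * moll \<rho> (y - x)) \<le> (LINT z|lborel. bubble 1 (z::'a))"
proof -
  have b: "bubble 1 (z::'a) \<ge> 0" for z using n by (intro bubble_nonneg) auto
  have le: "indicator A (y - \<rho> *\<^sub>R z) * cutoff ((norm (\<rho> *\<^sub>R z))\<^sup>2) * bubble 1 z \<le> bubble 1 z" for z
    using b[of z] cutoff_nonneg cutoff_le_1 by (auto simp: indicator_def mult_left_le_one_le)
  show "0 \<le> (LINT x|lborel. indicator A x * moll \<rho> (y - x))"
    using n by (intro integral_nonneg_AE) (auto simp: moll_nonneg)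
  show "(LINT x|lborel. indicator A x * moll \<rho> (y - x)) \<le> (LINT z|lborel. bubble 1 (z::'a))"
    unfolding moll_convolution_scale[OF \<rho> A]
    using integrable_bubble[OF n] le b by (intro integral_mono_AE') auto
qed

text \<open>Off the frontier of the box the indicator is eventually constant along y - \<rho> z. The
  frontier is a null set, so this covers almost every point.\<close>

lemma moll_convolution_box_tendsto:
  fixes y :: "'a::euclidean_space"
  assumes n: "DIM('a) \<ge> 3" and y: "y \<notin> frontier (cbox a b)"
  shows "(\<lambda>k. LINT x|lborel. indicator (cbox a b) x * moll (1 / real (Suc k)) (y - x))
     \<longlonglongrightarrow> (LINT z|lborel. bubble 1 (z::'a)) * indicator (cbox a b) y"
proof -
  have b: "bubble 1 (z::'a) \<ge> 0" for z using n by (intro bubble_nonneg) auto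
  let ?\<rho> = "\<lambda>k. 1 / real (Suc k)"
  have "(\<lambda>k. LINT z|lborel. indicator (cbox a b) (y - ?\<rho> k *\<^sub>R z) * cutoff ((norm (?\<rho> k *\<^sub>R z))\<^sup>2) * bubble 1 z)
     \<longlonglongrightarrow> (LINT (z::'a)|lborel. indicator (cbox a b) y * bubble 1 z)"
  proof (rule integral_dominated_convergence[where w = "bubble 1"])
    show "AE z in lborel. (\<lambda>k. indicator (cbox a b) (y - ?\<rho> k *\<^sub>R z) * cutoff ((norm (?\<rho> k *\<^sub>R z))\<^sup>2) * bubble 1 z)
       \<longlonglongrightarrow> indicator (cbox a b) y * bubble 1 z"
    proof (rule AE_I2)
      fix z :: 'a
      have \<rho>0: "?\<rho> \<longlonglongrightarrow> 0" using LIMSEQ_inverse_real_of_nat by (simp add: inverse_eq_divide)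
      have "(\<lambda>k. y - ?\<rho> k *\<^sub>R z) \<longlonglongrightarrow> y - 0 *\<^sub>R z" by (intro tendsto_intros \<rho>0)
      then have lim: "(\<lambda>k. y - ?\<rho> k *\<^sub>R z) \<longlonglongrightarrow> y" by simp
      have ind: "\<forall>\<^sub>F k in sequentially. indicator (cbox a b) (y - ?\<rho> k *\<^sub>R z) = (indicator (cbox a b) y :: real)"
      proof (cases "y \<in> cbox a b")
        case True
        then have "y \<in> interior (cbox a b)" using y by (auto simp: frontier_def)
        from topological_tendstoD[OF lim open_interior this] show ?thesis
          by (rule eventually_mono) (use True interior_subset[of "cbox a b"] in \<open>auto simp: indicator_def\<close>)
      next
        case False
        have "open (- cbox a b)" by (rule open_Compl) (rule closed_cbox)
        from topological_tendstoD[OF lim this] False have "\<forall>\<^sub>F k in sequentially. y - ?\<rho> k *\<^sub>R z \<in> - cbox a b"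
          by simp
        then show ?thesis by (rule eventually_mono) (use False in \<open>auto simp: indicator_def\<close>)
      qed
      have "(\<lambda>k. (norm (?\<rho> k *\<^sub>R z))\<^sup>2) \<longlonglongrightarrow> (norm (0 *\<^sub>R z))\<^sup>2" by (intro tendsto_intros \<rho>0)
      then have "(\<lambda>k. cutoff ((norm (?\<rho> k *\<^sub>R z))\<^sup>2)) \<longlonglongrightarrow> cutoff ((norm (0 *\<^sub>R z))\<^sup>2)"
        using continuous_cutoff by (intro isCont_tendsto_compose[of _ cutoff]) (auto simp: continuous_on_eq_continuous_at)
      then have c: "(\<lambda>k. cutoff ((norm (?\<rho> k *\<^sub>R z))\<^sup>2)) \<longlonglongrightarrow> 1" by (simp add: cutoff_eq_1)
      have "(\<lambda>k. indicator (cbox a b) (y - ?\<rho> k *\<^sub>R z) * cutoff ((norm (?\<rho> k *\<^sub>R z))\<^sup>2) * bubble 1 z)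
        \<longlonglongrightarrow> indicator (cbox a b) y * 1 * bubble 1 z"
        by (intro tendsto_mult tendsto_const c tendsto_eventually ind)
      then show "(\<lambda>k. indicator (cbox a b) (y - ?\<rho> k *\<^sub>R z) * cutoff ((norm (?\<rho> k *\<^sub>R z))\<^sup>2) * bubble 1 z)
        \<longlonglongrightarrow> indicator (cbox a b) y * bubble 1 z" by simp
    qed
    show "AE z in lborel. norm (indicator (cbox a b) (y - ?\<rho> k *\<^sub>R z) * cutoff ((norm (?\<rho> k *\<^sub>R z))\<^sup>2) * bubble 1 z) \<le> bubble 1 z" for k
      using b cutoff_nonneg cutoff_le_1 by (auto simp: indicator_def abs_mult mult_left_le_one_le)
  qed (use integrable_bubble[OF n] in auto)
  then show ?thesis by (simp add: moll_convolution_scale mult.commute)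
qed

lemma cbox_subset_cball_0: "\<exists>r. cbox a b \<subseteq> cball (0::'a::euclidean_space) r"
  using bounded_cbox[of a b] unfolding bounded_iff subset_iff mem_cball_0 by blast

lemma AE_lborel_not_in_negligible:
  assumes "negligible N"
  shows "AE x in lborel. x \<notin> N"
proof -
  have "AE x in lebesgue. x \<notin> N" using assms by (intro AE_not_in) (simp add: negligible_iff_null_sets)
  then show ?thesis by (rule AE_completion_iff[THEN iffD1])
qed

text \<open>The passage from mollified inequalities to a pointwise one. The inequality is integrated
  over boxes, Fubini moves the mollifier from \<open>u\<close> to the indicator of the box, where
  convergence is elementary, and differentiation of integrals over small cubes recovers the
  pointwise statement. Only local integrability of \<open>u\<close> and \<open>R\<close> is needed
  for this.\<close>

lemma approx_identity_le:
  fixes u R :: "'a::euclidean_space \<Rightarrow> real"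
  assumes n: "DIM('a) \<ge> 3"
    and [measurable]: "u \<in> borel_measurable borel" "R \<in> borel_measurable borel"
    and u: "\<And>r. set_integrable lborel (cball 0 r) u" and R: "\<And>r. set_integrable lborel (cball 0 r) R"
    and \<Omega>: "open \<Omega>"
    and le: "\<And>k. AE x in lborel. x \<in> \<Omega> \<longrightarrow> (LINT y|lborel. u y * moll (1 / real (Suc k)) (y - x)) \<le> R x"
  shows "AE x in lborel. x \<in> \<Omega> \<longrightarrow> (LINT z|lborel. bubble 1 (z::'a)) * u x \<le> R x"
proof -
  define c where "c = (LINT z|lborel. bubble 1 (z::'a))"
  let ?\<rho> = "\<lambda>k. 1 / real (Suc k)"
  have cpos: "c > 0" unfolding c_def by (rule bubble_mass_pos[OF n])
  \<comment> \<open>The inequality survives the limit after integration over any box in \<Omega>;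
    the mollified indicator is bounded by \<open>c\<close>, so \<open>c\<close> times the modulus of
    \<open>u\<close> on a ball is a majorant.\<close>
  have box: "c * (LINT x|lborel. indicator (cbox a b) x * u x) \<le> (LINT x|lborel. indicator (cbox a b) x * R x)"
    if ab: "cbox a b \<subseteq> \<Omega>" for a b
  proof -
    obtain r where r: "cbox a b \<subseteq> cball 0 r" using cbox_subset_cball_0 by blast
    have Rint: "integrable lborel (\<lambda>x. indicator (cbox a b) x * R x)"
      using set_integrable_subset[OF R[of r] _ r] by (simp add: set_integrable_def)
    \<comment> \<open>The mollifier has range 1, so a box inside the ball of radius r sees
      \<open>u\<close> only on the ball of radius r + 1.\<close>
    have uint: "integrable lborel (\<lambda>x. indicator (cball 0 (r + 1)) x * \<bar>u x\<bar>)"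
      using u[of "r+1"] by (auto simp: set_integrable_def abs_mult dest: integrable_abs)
    have G: "integrable (lborel \<Otimes>\<^sub>M lborel) (\<lambda>(x, y). indicator (cbox a b) x * u y * moll (?\<rho> k) (y - x))" for k
    proof (rule integrableI_bounded)
      define B where "B = bubble (?\<rho> k) (0::'a)"
      have B: "0 \<le> moll (?\<rho> k) (z::'a)" "moll (?\<rho> k) (z::'a) \<le> B" for z
        unfolding B_def using n by (auto intro!: moll_le_const moll_nonneg)
      have B0: "B \<ge> 0" using B[of 0] by linarith
      have "(\<integral>\<^sup>+p. ennreal (norm (case p of (x, y) \<Rightarrow> indicator (cbox a b) x * u y * moll (?\<rho> k) (y - x))) \<partial>(lborel \<Otimes>\<^sub>M lborel))
        = (\<integral>\<^sup>+x. \<integral>\<^sup>+y. ennreal (norm (indicator (cbox a b) x * u y * moll (?\<rho> k) (y - x))) \<partial>lborel \<partial>lborel)"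
        by (subst lborel.nn_integral_fst[symmetric]) auto
      also have "\<dots> \<le> (\<integral>\<^sup>+x. \<integral>\<^sup>+y. indicator (cbox a b) x * ennreal (B * (indicator (cball 0 (r + 1)) y * \<bar>u y\<bar>)) \<partial>lborel \<partial>lborel)"
      proof (intro nn_integral_mono)
        fix x y :: 'a
        show "ennreal (norm (indicator (cbox a b) x * u y * moll (?\<rho> k) (y - x)))
          \<le> indicator (cbox a b) x * ennreal (B * (indicator (cball 0 (r + 1)) y * \<bar>u y\<bar>))"
        proof (cases "x \<in> cbox a b \<and> norm (y - x) < 1")
          case True
          then have "norm y \<le> norm x + 1" using norm_triangle_ineq2[of y x] by linarith
          then have "y \<in> cball 0 (r + 1)" using True r by auto
          then show ?thesis using True B[of "y - x"]
            by (simp add: abs_mult ennreal_leI mult.commute[of B] mult_left_mono)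
        next
          case False
          then show ?thesis using moll_eq_0[of "y - x"] by (auto simp: indicator_def not_less)
        qed
      qed
      also have "\<dots> = emeasure lborel (cbox a b) * (\<integral>\<^sup>+y. ennreal (B * (indicator (cball 0 (r + 1)) y * \<bar>u y\<bar>)) \<partial>lborel)"
        by (simp add: nn_integral_cmult nn_integral_multc)
      also have "\<dots> < \<infinity>"
      proof -
        have "integrable lborel (\<lambda>y. B * (indicator (cball 0 (r + 1)) y * \<bar>u y\<bar>))"
          by (rule integrable_mult_right[OF uint])
        then have "(\<integral>\<^sup>+y. ennreal (B * (indicator (cball 0 (r + 1)) y * \<bar>u y\<bar>)) \<partial>lborel) < \<infinity>"
          by (subst nn_integral_eq_integral) (use B0 in auto)
        then show ?thesis using emeasure_bounded_finite[OF bounded_cbox[of a b]]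
          by (simp add: ennreal_mult_less_top)
      qed
      finally show "(\<integral>\<^sup>+p. ennreal (norm (case p of (x, y) \<Rightarrow> indicator (cbox a b) x * u y * moll (?\<rho> k) (y - x))) \<partial>(lborel \<Otimes>\<^sub>M lborel)) < \<infinity>" .
    qed (simp add: split_beta')
    have I: "(LINT y|lborel. u y * (LINT x|lborel. indicator (cbox a b) x * moll (?\<rho> k) (y - x))) \<le> (LINT x|lborel. indicator (cbox a b) x * R x)" for k
    proof -
      have "(LINT y|lborel. u y * (LINT x|lborel. indicator (cbox a b) x * moll (?\<rho> k) (y - x)))
        = (LINT y|lborel. LINT x|lborel. indicator (cbox a b) x * u y * moll (?\<rho> k) (y - x))"
        by (simp add: mult_ac integral_mult_right_zero[symmetric] del: integral_mult_right_zero)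
      also have "\<dots> = (LINT x|lborel. LINT y|lborel. indicator (cbox a b) x * u y * moll (?\<rho> k) (y - x))"
        using lborel_pair.Fubini_integral[OF G] .
      also have "\<dots> \<le> (LINT x|lborel. indicator (cbox a b) x * R x)"
      proof (rule integral_mono_AE)
        show "integrable lborel (\<lambda>x. LINT y|lborel. indicator (cbox a b) x * u y * moll (?\<rho> k) (y - x))"
          using lborel_pair.integrable_fst'[OF G] by simp
        show "AE x in lborel. (LINT y|lborel. indicator (cbox a b) x * u y * moll (?\<rho> k) (y - x)) \<le> indicator (cbox a b) x * R x"
          using le[of k] by eventually_elim (use ab in \<open>auto simp: indicator_def\<close>)
      qed fact
      finally show ?thesis .
    qed
    have "(\<lambda>k. LINT y|lborel. u y * (LINT x|lborel. indicator (cbox a b) x * moll (?\<rho> k) (y - x)))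
       \<longlonglongrightarrow> (LINT y|lborel. u y * (c * indicator (cbox a b) y))"
    proof (rule integral_dominated_convergence[where w = "\<lambda>y. c * (indicator (cball 0 (r + 1)) y * \<bar>u y\<bar>)"])
      have "negligible (frontier (cbox a b))" by (intro negligible_convex_frontier convex_box)
      then have "AE y in lborel. y \<notin> frontier (cbox a b)"
        by (rule AE_lborel_not_in_negligible)
      then show "AE y in lborel. (\<lambda>k. u y * (LINT x|lborel. indicator (cbox a b) x * moll (?\<rho> k) (y - x))) \<longlonglongrightarrow> u y * (c * indicator (cbox a b) y)"
      proof eventually_elim
        case (elim y)
        show ?case unfolding c_def
          by (intro tendsto_mult tendsto_const moll_convolution_box_tendsto[OF n elim])
      qed
      show "AE y in lborel. norm (u y * (LINT x|lborel. indicator (cbox a b) x * moll (?\<rho> k) (y - x))) \<le> c * (indicator (cball 0 (r + 1)) y * \<bar>u y\<bar>)" for k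
      proof (rule AE_I2)
        fix y :: 'a
        show "norm (u y * (LINT x|lborel. indicator (cbox a b) x * moll (?\<rho> k) (y - x))) \<le> c * (indicator (cball 0 (r + 1)) y * \<bar>u y\<bar>)"
        proof (cases "norm y \<le> r + 1")
          case True
          have "norm (u y * (LINT x|lborel. indicator (cbox a b) x * moll (?\<rho> k) (y - x))) \<le> \<bar>u y\<bar> * c"
            unfolding real_norm_def abs_mult
            using moll_convolution_bounds[OF n, of "?\<rho> k" "cbox a b" y]
            by (intro mult_left_mono) (auto simp: c_def)
          then show ?thesis using True by (simp add: mult.commute)
        next
          case False
          have "indicator (cbox a b) x * moll (?\<rho> k) (y - x) = 0" for x
          proof (cases "x \<in> cbox a b")
            case True
            then have "norm x \<le> r" using r by auto
            then have "norm (y - x) \<ge> 1" using False norm_triangle_ineq2[of y x] by linarith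
            then show ?thesis by (simp add: moll_eq_0)
          qed simp
          then have "(LINT x|lborel. indicator (cbox a b) x * moll (?\<rho> k) (y - x)) = 0"
            by (simp only: integral_zero)
          then show ?thesis using False by (simp only:) simp
        qed
      qed
    qed (use uint in \<open>auto intro!: borel_measurable_times lborel.borel_measurable_lebesgue_integral\<close>)
    from LIMSEQ_le_const2[OF this] I have "(LINT y|lborel. u y * (c * indicator (cbox a b) y)) \<le> (LINT x|lborel. indicator (cbox a b) x * R x)"
      by blast
    then show ?thesis by (simp add: mult_ac)
  qed
  define D where "D x = R x - c * u x" for x
  have Dint: "set_integrable lborel (cbox a b) D" for a b
  proof -
    obtain r where r: "cbox a b \<subseteq> cball 0 r" using cbox_subset_cball_0 by blast
    have "set_integrable lborel (cball 0 r) D" unfolding D_def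
      by (intro set_integral_diff R set_integrable_mult_right u)
    then show ?thesis by (rule set_integrable_subset) (use r in auto)
  qed
  have Dbox: "integral (cbox a b) D \<ge> 0" if "cbox a b \<subseteq> \<Omega>" for a b
  proof -
    obtain r where r: "cbox a b \<subseteq> cball 0 r" using cbox_subset_cball_0 by blast
    have i: "integrable lborel (\<lambda>x. indicator (cbox a b) x * R x)" "integrable lborel (\<lambda>x. indicator (cbox a b) x * u x)"
      using set_integrable_subset[OF R[of r] _ r] set_integrable_subset[OF u[of r] _ r] by (simp_all add: set_integrable_def)
    have "(LINT x|lborel. indicator (cbox a b) x * D x)
      = (LINT x|lborel. indicator (cbox a b) x * R x - c * (indicator (cbox a b) x * u x))"
      by (simp add: D_def algebra_simps)
    also have "\<dots> = (LINT x|lborel. indicator (cbox a b) x * R x) - c * (LINT x|lborel. indicator (cbox a b) x * u x)"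
      using i by simp
    finally have "(LINT x : cbox a b|lborel. D x) \<ge> 0" using box[OF that] by (simp add: set_lebesgue_integral_def)
    then show ?thesis using set_borel_integral_eq_integral(2)[OF Dint] by simp
  qed
  have "D integrable_on cbox a b" for a b using set_borel_integral_eq_integral(1)[OF Dint] .
  \<comment> \<open>Lebesgue differentiation along cubes with lower corner x: outside the null set
    \<open>N\<close> their averages of \<open>D\<close> tend to \<open>D x\<close>.\<close>
  then obtain N where N: "negligible N" "\<And>x e. \<lbrakk>x \<notin> N; 0 < e\<rbrakk> \<Longrightarrow>
       \<exists>d>0. \<forall>h. 0 < h \<and> h < d \<longrightarrow> norm (integral (cbox x (x + h *\<^sub>R One)) D /\<^sub>R h ^ DIM('a) - D x) < e"
    using integrable_ccontinuous_explicit[of D] by blast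
  have "AE x in lborel. x \<notin> N"
    by (rule AE_lborel_not_in_negligible[OF N(1)])
  then show ?thesis
  proof eventually_elim
    case (elim x)
    have "D x \<ge> 0" if x: "x \<in> \<Omega>"
    proof (rule ccontr)
      assume "\<not> D x \<ge> 0"
      then have "0 < - D x" by simp
      then obtain d where d: "d > 0" "\<And>h. 0 < h \<Longrightarrow> h < d \<Longrightarrow>
          norm (integral (cbox x (x + h *\<^sub>R One)) D /\<^sub>R h ^ DIM('a) - D x) < - D x"
        using N(2)[OF elim, of "- D x"] by blast
      obtain e where e: "e > 0" "cball x e \<subseteq> \<Omega>" using \<Omega> x open_contains_cball by blast
      \<comment> \<open>The edge is below d, and the diameter, h times the norm of
        \<open>One\<close>, is at most e, which keeps the cube inside \<Omega>.\<close>
      define h where "h = min (d/2) (e / (norm (One::'a)))"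
      have One: "norm (One::'a) > 0" by (simp add: One_non_0)
      have h: "h > 0" "h < d" "h * norm (One::'a) \<le> e" using d e One by (auto simp: h_def min_def field_simps)
      have "cbox x (x + h *\<^sub>R One) \<subseteq> \<Omega>"
      proof
        fix y assume y: "y \<in> cbox x (x + h *\<^sub>R One)"
        have "norm (y - x) \<le> norm (h *\<^sub>R (One::'a))"
          by (rule norm_le_componentwise) (use y h in \<open>auto simp: mem_box inner_diff_left inner_add_left abs_if algebra_simps\<close>)
        then have "y \<in> cball x e" using h by (simp add: dist_norm norm_minus_commute)
        then show "y \<in> \<Omega>" using e by blast
      qed
      from Dbox[OF this] have "integral (cbox x (x + h *\<^sub>R One)) D /\<^sub>R h ^ DIM('a) \<ge> 0" using h by simp
      moreover have "norm (integral (cbox x (x + h *\<^sub>R One)) D /\<^sub>R h ^ DIM('a) - D x) < - D x" using d h by blast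
      ultimately show False by (auto simp: abs_if split: if_splits)
    qed
    then show ?case by (auto simp: D_def c_def)
  qed
qed


section \<open>Test functions and integration by parts\<close>

lemma iter_pd_append: "iter_pd (bs @ cs) \<phi> = iter_pd bs (iter_pd cs \<phi>)"
  by (induction bs) simp_all

lemma smooth_fun_pd: "smooth_fun \<phi> \<Longrightarrow> b \<in> Basis \<Longrightarrow> smooth_fun (iter_pd [b] \<phi>)"
  unfolding smooth_fun_def
proof (intro allI impI)
  fix bs :: "'a list" and x assume *: "\<forall>bs. set bs \<subseteq> Basis \<longrightarrow> (\<forall>x. iter_pd bs \<phi> differentiable at x)"
    "b \<in> Basis" "set bs \<subseteq> Basis"
  have "set (bs @ [b]) \<subseteq> Basis" using * by auto
  then show "iter_pd bs (iter_pd [b] \<phi>) differentiable at x"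
    using *(1) iter_pd_append[of bs "[b]" \<phi>] by metis
qed

lemma smooth_fun_differentiable: "smooth_fun \<phi> \<Longrightarrow> \<phi> differentiable (at x)"
  unfolding smooth_fun_def by (metis empty_set empty_subsetI iter_pd.simps(1))

lemma smooth_fun_continuous: "smooth_fun \<phi> \<Longrightarrow> continuous_on UNIV \<phi>"
  by (simp add: continuous_on_eq_continuous_at smooth_fun_differentiable
      differentiable_imp_continuous_within)

lemma smooth_fun_has_derivative:
  "smooth_fun \<phi> \<Longrightarrow> (\<phi> has_derivative frechet_derivative \<phi> (at x)) (at x)"
  using smooth_fun_differentiable frechet_derivative_works by blast

lemma has_derivative_eq_pgrad:
  assumes "(\<phi> has_derivative D) (at x)"
  shows "D v = pgrad \<phi> x \<bullet> v"
proof -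
  have D: "D = frechet_derivative \<phi> (at x)" by (rule frechet_derivative_at[OF assms])
  have lin: "linear D" using assms has_derivative_linear by blast
  have "D v = D (\<Sum>b\<in>Basis. (v \<bullet> b) *\<^sub>R b)" by (simp add: euclidean_representation)
  also have "\<dots> = (\<Sum>b\<in>Basis. (v \<bullet> b) * D b)"
    using lin by (simp add: linear_sum linear_cmul)
  also have "\<dots> = pgrad \<phi> x \<bullet> v"
    by (simp add: pgrad_def inner_sum_left D inner_commute[of v] mult.commute)
  finally show ?thesis .
qed

lemma pgrad_inner_Basis: "b \<in> Basis \<Longrightarrow> pgrad \<phi> x \<bullet> b = iter_pd [b] \<phi> x"
  by (simp add: pgrad_def inner_sum_left inner_Basis if_distrib sum.delta cong: if_cong)

lemma iter_pd_eq_0: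
  assumes "open A" "x \<in> A" "\<And>y. y \<in> A \<Longrightarrow> \<phi> y = 0"
  shows "iter_pd [b] \<phi> x = 0"
proof -
  have "(\<phi> has_derivative (\<lambda>v. 0)) (at x)"
    by (rule has_derivative_transform_within_open[OF has_derivative_const assms(1,2)])
       (use assms(3) in auto)
  then show ?thesis using frechet_derivative_at by (metis iter_pd.simps)
qed

lemma test_fun_pd:
  assumes "test_fun \<phi>" "b \<in> Basis"
  shows "test_fun (iter_pd [b] \<phi>)"
proof -
  have "{x. iter_pd [b] \<phi> x \<noteq> 0} \<subseteq> closure {x. \<phi> x \<noteq> 0}"
  proof (rule ccontr)
    assume "\<not> ?thesis"
    then obtain x where x: "iter_pd [b] \<phi> x \<noteq> 0" "x \<in> - closure {x. \<phi> x \<noteq> 0}" by blast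
    have "iter_pd [b] \<phi> x = 0"
      by (rule iter_pd_eq_0[of "- closure {x. \<phi> x \<noteq> 0}"]) (use x closure_subset[of "{x. \<phi> x \<noteq> 0}"] in \<open>auto simp del: iter_pd.simps\<close>)
    with x show False by simp
  qed
  then have "closure {x. iter_pd [b] \<phi> x \<noteq> 0} \<subseteq> closure {x. \<phi> x \<noteq> 0}" by (simp add: closure_minimal)
  then have "compact (closure {x. iter_pd [b] \<phi> x \<noteq> 0})"
    using assms(1) closed_Int_compact[OF closed_closure, of "closure {x. \<phi> x \<noteq> 0}" "{x. iter_pd [b] \<phi> x \<noteq> 0}"]
    unfolding test_fun_def by (simp add: Int_absorb2 del: iter_pd.simps)
  then show ?thesis using assms smooth_fun_pd unfolding test_fun_def by blast
qed

lemma test_fun_support: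
  assumes "test_fun \<phi>"
  obtains r where "r > 0" "\<And>x. \<phi> x \<noteq> 0 \<Longrightarrow> norm x < r"
proof -
  have "bounded (closure {x. \<phi> x \<noteq> 0})" using assms compact_imp_bounded unfolding test_fun_def by blast
  then obtain r where r: "\<forall>x\<in>closure {x. \<phi> x \<noteq> 0}. norm x \<le> r" unfolding bounded_iff by blast
  have "norm x < \<bar>r\<bar> + 1" if "\<phi> x \<noteq> 0" for x
  proof -
    have "x \<in> closure {x. \<phi> x \<noteq> 0}" by (rule subsetD[OF closure_subset]) (use that in simp)
    then have "norm x \<le> r" using r by blast
    then show ?thesis by linarith
  qed
  then show ?thesis by (intro that[of "\<bar>r\<bar> + 1"]) auto
qed

lemma compact_support_bounded:
  fixes \<phi> :: "'a::euclidean_space \<Rightarrow> real"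
  assumes "continuous_on UNIV \<phi>" "\<And>x. \<phi> x \<noteq> 0 \<Longrightarrow> norm x < r"
  obtains B where "B > 0" "\<And>x. \<bar>\<phi> x\<bar> \<le> B * indicator (cball 0 r) x"
proof -
  have "compact (\<phi> ` cball 0 r)"
    by (intro compact_continuous_image continuous_on_subset[OF assms(1)]) auto
  then obtain B where B: "B > 0" "\<forall>x\<in>cball 0 r. \<bar>\<phi> x\<bar> \<le> B"
    using compact_imp_bounded[of "\<phi> ` cball 0 r"] by (auto simp: bounded_pos)
  show ?thesis
    by (rule that[OF B(1)]) (use B assms(2) in \<open>force simp: indicator_def\<close>)
qed

lemma compact_support_integrable:
  fixes \<phi> :: "'a::euclidean_space \<Rightarrow> real"
  assumes "continuous_on UNIV \<phi>" "\<And>x. \<phi> x \<noteq> 0 \<Longrightarrow> norm x < r"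
  shows "integrable lborel \<phi>"
proof -
  have "integrable lborel (\<lambda>x. indicator (cball 0 r) x *\<^sub>R \<phi> x)"
    by (intro borel_integrable_compact continuous_on_subset[OF assms(1)]) auto
  also have "(\<lambda>x. indicator (cball 0 r) x *\<^sub>R \<phi> x) = \<phi>"
    using assms(2) by (force simp: indicator_def fun_eq_iff)
  finally show ?thesis .
qed

lemma test_fun_bounded:
  assumes "test_fun \<phi>"
  obtains B r where "B > 0" "r > 0" "\<And>x. \<bar>\<phi> x\<bar> \<le> B * indicator (cball 0 r) x"
  using test_fun_support[OF assms] compact_support_bounded[OF smooth_fun_continuous] assms
  unfolding test_fun_def by metis

lemma test_fun_measurable [measurable_dest]: "test_fun \<phi> \<Longrightarrow> \<phi> \<in> borel_measurable borel"
  unfolding test_fun_def by (intro borel_measurable_continuous_onI smooth_fun_continuous) auto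

text \<open>By translation invariance every difference quotient has integral zero, and dominated
  convergence carries this to the derivative. No integration along coordinate lines is
  involved.\<close>

lemma integral_pd_eq_0:
  fixes \<Phi> :: "'a::euclidean_space \<Rightarrow> real"
  assumes d: "\<And>x. (\<Phi> has_derivative D x) (at x)" and c: "continuous_on UNIV (\<lambda>x. D x b)"
    and supp: "\<And>x. \<Phi> x \<noteq> 0 \<Longrightarrow> norm x < r"
    and suppD: "\<And>x. D x b \<noteq> 0 \<Longrightarrow> norm x < r"
    and b: "norm b = 1"
  shows "(LINT x|lborel. D x b) = 0"
proof -
  have cont: "continuous_on UNIV \<Phi>"
    using d by (auto simp: continuous_on_eq_continuous_at intro: has_derivative_continuous)
  have [measurable]: "\<Phi> \<in> borel_measurable borel" "(\<lambda>x. D x b) \<in> borel_measurable borel"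
    using cont c by (auto intro: borel_measurable_continuous_onI)
  have int: "integrable lborel \<Phi>" using compact_support_integrable[OF cont supp] .
  obtain B where B: "B > 0" "\<And>x. \<bar>D x b\<bar> \<le> B * indicator (cball 0 r) x"
    using compact_support_bounded[OF c suppD] by blast
  have B': "\<bar>D x b\<bar> \<le> B" for x
    using B(1) B(2)[of x] by (cases "x \<in> cball 0 r") auto
  define q where "q k x = (\<Phi> (x + (1 / real (Suc k)) *\<^sub>R b) - \<Phi> x) * real (Suc k)" for k x
  have line: "((\<lambda>t. \<Phi> (x + t *\<^sub>R b)) has_real_derivative D (x + t *\<^sub>R b) b) (at t)" for x t
  proof -
    have "((\<lambda>t. x + t *\<^sub>R b) has_derivative (\<lambda>h. h *\<^sub>R b)) (at t)" by (auto intro!: derivative_eq_intros)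
    from has_derivative_compose[OF this d] have "((\<lambda>t. \<Phi> (x + t *\<^sub>R b)) has_derivative (\<lambda>h. D (x + t *\<^sub>R b) (h *\<^sub>R b))) (at t)" .
    moreover have "linear (D (x + t *\<^sub>R b))" using d has_derivative_linear by blast
    ultimately show ?thesis
      by (simp add: has_field_derivative_def linear_cmul mult_commute_abs)
  qed
  have zero: "(LINT x|lborel. q k x) = 0" for k
  proof -
    have "integrable lborel (\<lambda>x. \<Phi> (x + (1 / real (Suc k)) *\<^sub>R b))"
    proof (rule compact_support_integrable)
      show "continuous_on UNIV (\<lambda>x. \<Phi> (x + (1 / real (Suc k)) *\<^sub>R b))"
        by (rule continuous_on_compose2[OF cont]) (auto intro!: continuous_intros)
      fix x assume "\<Phi> (x + (1 / real (Suc k)) *\<^sub>R b) \<noteq> 0"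
      then have "norm (x + (1 / real (Suc k)) *\<^sub>R b) < r" by (rule supp)
      then show "norm x < r + norm ((1 / real (Suc k)) *\<^sub>R b)"
        using norm_triangle_ineq4[of "x + (1 / real (Suc k)) *\<^sub>R b" "(1 / real (Suc k)) *\<^sub>R b"] by simp
    qed
    then show ?thesis unfolding q_def
      using int by (simp add: integral_lborel_shift)
  qed
  have "(\<lambda>k. LINT x|lborel. q k x) \<longlonglongrightarrow> (LINT x|lborel. D x b)"
  \<comment> \<open>Radius r + 1 suffices for all quotients, because the increments are at most 1
    and b has norm 1.\<close>
  proof (rule integral_dominated_convergence[where w = "\<lambda>x. B * indicator (cball 0 (r + 1)) x"])
    show "integrable lborel (\<lambda>x. B * indicator (cball (0::'a) (r + 1)) x)"
      using emeasure_lborel_cball_finite[of "0::'a" "r+1"] by (intro integrable_mult_right integrable_real_indicator) auto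
    show "AE x in lborel. (\<lambda>k. q k x) \<longlonglongrightarrow> D x b"
    proof (rule AE_I2)
      fix x
      have "((\<lambda>h. (\<Phi> (x + (0 + h) *\<^sub>R b) - \<Phi> (x + 0 *\<^sub>R b)) / h) \<longlongrightarrow> D (x + 0 *\<^sub>R b) b) (at 0)"
        using line[of x 0] unfolding DERIV_def .
      moreover have "filterlim (\<lambda>k. 1 / real (Suc k)) (at 0) sequentially"
        unfolding filterlim_at using LIMSEQ_inverse_real_of_nat by (auto simp: inverse_eq_divide)
      ultimately have "(\<lambda>k. (\<Phi> (x + (0 + 1 / real (Suc k)) *\<^sub>R b) - \<Phi> (x + 0 *\<^sub>R b)) / (1 / real (Suc k))) \<longlonglongrightarrow> D (x + 0 *\<^sub>R b) b"
        by (rule filterlim_compose)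
      then show "(\<lambda>k. q k x) \<longlonglongrightarrow> D x b" by (simp add: q_def)
    qed
    show "AE x in lborel. norm (q k x) \<le> B * indicator (cball 0 (r + 1)) x" for k
    proof (rule AE_I2)
      fix x
      define h where "h = 1 / real (Suc k)"
      have h: "h > 0" "h \<le> 1" "real (Suc k) = 1 / h" by (auto simp: h_def)
      show "norm (q k x) \<le> B * indicator (cball 0 (r + 1)) x"
      proof (cases "norm x \<le> r + 1")
        case True
        obtain t where "\<Phi> (x + h *\<^sub>R b) - \<Phi> (x + 0 *\<^sub>R b) = (h - 0) * D (x + t *\<^sub>R b) b"
          using MVT2[of 0 h "\<lambda>t. \<Phi> (x + t *\<^sub>R b)" "\<lambda>t. D (x + t *\<^sub>R b) b"] line h by blast
        then have "q k x = D (x + t *\<^sub>R b) b" using h by (simp add: q_def h_def[symmetric])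
        then show ?thesis using B' True by simp
      next
        case False
        have "norm x \<le> norm (x + h *\<^sub>R b) + h"
          using norm_triangle_ineq4[of "x + h *\<^sub>R b" "h *\<^sub>R b"] b h by simp
        then have "\<not> norm (x + h *\<^sub>R b) < r" "\<not> norm x < r" using False h by linarith+
        then have "\<Phi> (x + h *\<^sub>R b) = 0" "\<Phi> x = 0" using supp by blast+
        then show ?thesis using B(1) by (simp add: q_def h_def)
      qed
    qed
  qed (auto simp: q_def)
  then have "(\<lambda>k::nat. 0::real) \<longlonglongrightarrow> (LINT x|lborel. D x b)" by (simp add: zero)
  then show ?thesis using LIMSEQ_unique tendsto_const by blast
qed

lemma integration_by_parts:
  assumes v: "smooth_fun v" and \<phi>: "test_fun \<phi>" and b: "b \<in> Basis"
  shows "(LINT x|lborel. v x * iter_pd [b] \<phi> x) = - (LINT x|lborel. iter_pd [b] v x * \<phi> x)"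
proof -
  have s\<phi>: "smooth_fun \<phi>" using \<phi> test_fun_def by blast
  obtain r where r: "\<And>x. \<phi> x \<noteq> 0 \<Longrightarrow> norm x < r" using test_fun_support[OF \<phi>] by blast
  obtain r' where r': "\<And>x. iter_pd [b] \<phi> x \<noteq> 0 \<Longrightarrow> norm x < r'"
    using test_fun_support[OF test_fun_pd[OF \<phi> b]] by blast
  have cv: "continuous_on UNIV v" "continuous_on UNIV (iter_pd [b] v)"
     "continuous_on UNIV \<phi>" "continuous_on UNIV (iter_pd [b] \<phi>)"
    using v s\<phi> b smooth_fun_pd smooth_fun_continuous by blast+
  have "(LINT x|lborel. v x * frechet_derivative \<phi> (at x) b + frechet_derivative v (at x) b * \<phi> x) = 0"
  proof (rule integral_pd_eq_0[where r = "max r r'"])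
    show "((\<lambda>x. v x * \<phi> x) has_derivative (\<lambda>h. v x * frechet_derivative \<phi> (at x) h + frechet_derivative v (at x) h * \<phi> x)) (at x)" for x
      by (rule has_derivative_mult[OF smooth_fun_has_derivative[OF v] smooth_fun_has_derivative[OF s\<phi>]])
    show "continuous_on UNIV (\<lambda>x. v x * frechet_derivative \<phi> (at x) b + frechet_derivative v (at x) b * \<phi> x)"
      using cv by (auto intro!: continuous_intros)
    show "norm x < max r r'" if "v x * \<phi> x \<noteq> 0" for x using that r[of x] by auto
    show "norm x < max r r'" if "v x * frechet_derivative \<phi> (at x) b + frechet_derivative v (at x) b * \<phi> x \<noteq> 0" for x
    proof -
      have "\<phi> x \<noteq> 0 \<or> iter_pd [b] \<phi> x \<noteq> 0" using that by auto
      then show ?thesis using r[of x] r'[of x] by linarith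
    qed
  qed (use b in auto)
  then have "(LINT x|lborel. v x * iter_pd [b] \<phi> x + iter_pd [b] v x * \<phi> x) = 0" by simp
  moreover have "integrable lborel (\<lambda>x. v x * iter_pd [b] \<phi> x)"
    by (rule compact_support_integrable[of _ r']) (use cv r' in \<open>auto intro!: continuous_on_mult\<close>)
  moreover have "integrable lborel (\<lambda>x. iter_pd [b] v x * \<phi> x)"
    by (rule compact_support_integrable[of _ r]) (use cv r in \<open>auto intro!: continuous_on_mult\<close>)
  ultimately show ?thesis by (simp del: iter_pd.simps)
qed

text \<open>The definitions integrate against \<open>lebesgue\<close>, while product measures and
  changes of variables are handled on \<open>lborel\<close>. This is the bridge, once Borel
  representatives have been chosen.\<close>

lemma integral_lebesgue_eq_lborel:
  fixes f :: "'a::euclidean_space \<Rightarrow> real"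
  assumes "f \<in> borel_measurable borel"
  shows "(LINT x|lebesgue. f x) = (LINT x|lborel. f x)" "integrable lebesgue f \<longleftrightarrow> integrable lborel f"
  using assms by (simp_all add: integral_completion integrable_completion)

lemma continuous_pgrad:
  assumes "smooth_fun v"
  shows "continuous_on UNIV (pgrad v)"
  unfolding pgrad_def
  by (intro continuous_intros smooth_fun_continuous smooth_fun_pd assms)

lemma L2grad_test_fun:
  fixes v :: "'a::euclidean_space \<Rightarrow> real"
  assumes v: "test_fun v"
  shows "L2grad v (pgrad v)"
proof -
  have sv: "smooth_fun v" using v test_fun_def by blast
  have [measurable]: "pgrad v \<in> borel_measurable borel"
    by (rule borel_measurable_continuous_onI[OF continuous_pgrad[OF sv]])
  have [measurable]: "v \<in> borel_measurable borel" using v by measurable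
  obtain r where r: "\<And>x. v x \<noteq> 0 \<Longrightarrow> norm x < r" using test_fun_support[OF v] by blast
  have r': "norm x < r + 1" if "pgrad v x \<noteq> 0" for x
  proof (rule ccontr)
    assume x: "\<not> norm x < r + 1"
    have "iter_pd [b] v x = 0" for b
      by (rule iter_pd_eq_0[of "- cball 0 r"]) (use r x in \<open>force+\<close>)
    then show False using that by (simp add: pgrad_def del: iter_pd.simps)
  qed
  have "integrable lborel (\<lambda>x. (norm (pgrad v x))\<^sup>2)"
    by (rule compact_support_integrable[where r = "r + 1"])
       (use r' continuous_pgrad[OF sv] in \<open>auto intro!: continuous_intros\<close>)
  then have 1: "integrable lebesgue (\<lambda>x. (norm (pgrad v x))\<^sup>2)"
    by (subst integral_lebesgue_eq_lborel) auto
  have 2: "integrable lebesgue (\<lambda>x. v x * iter_pd [b] \<phi> x) \<and>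
        integrable lebesgue (\<lambda>x. (pgrad v x \<bullet> b) * \<phi> x) \<and>
        (LINT x|lebesgue. v x * iter_pd [b] \<phi> x) = - (LINT x|lebesgue. (pgrad v x \<bullet> b) * \<phi> x)"
    if \<phi>: "test_fun \<phi>" and b: "b \<in> Basis" for \<phi> b
  proof -
    have s\<phi>: "smooth_fun \<phi>" using \<phi> test_fun_def by blast
    have c: "continuous_on UNIV v" "continuous_on UNIV (iter_pd [b] v)"
     "continuous_on UNIV \<phi>" "continuous_on UNIV (iter_pd [b] \<phi>)"
      using sv s\<phi> b smooth_fun_pd smooth_fun_continuous by blast+
    have [measurable]: "\<phi> \<in> borel_measurable borel" "iter_pd [b] \<phi> \<in> borel_measurable borel"
      "iter_pd [b] v \<in> borel_measurable borel"
      using c borel_measurable_continuous_onI by blast+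
    obtain R where R: "\<And>x. \<phi> x \<noteq> 0 \<Longrightarrow> norm x < R" using test_fun_support[OF \<phi>] by blast
    have 1: "integrable lborel (\<lambda>x. v x * iter_pd [b] \<phi> x)"
      by (rule compact_support_integrable[of _ r]) (use c r in \<open>auto intro!: continuous_on_mult\<close>)
    have 2: "integrable lborel (\<lambda>x. iter_pd [b] v x * \<phi> x)"
      by (rule compact_support_integrable[of _ R]) (use c R in \<open>auto intro!: continuous_on_mult\<close>)
    have m: "(\<lambda>x. v x * iter_pd [b] \<phi> x) \<in> borel_measurable borel"
      "(\<lambda>x. iter_pd [b] v x * \<phi> x) \<in> borel_measurable borel" by measurable
    show ?thesis
      unfolding pgrad_inner_Basis[OF b] integral_lebesgue_eq_lborel[OF m(1)] integral_lebesgue_eq_lborel[OF m(2)]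
      using 1 2 integration_by_parts[OF sv \<phi> b] by blast
  qed
  show ?thesis unfolding L2grad_def weak_grad_def using 1 2 by (auto intro: measurable_completion)
qed

section \<open>Uniqueness of weak gradients\<close>

lemma loc_integrable_of_square:
  fixes u :: "'a::euclidean_space \<Rightarrow> real"
  assumes [measurable]: "u \<in> borel_measurable borel" and "integrable lborel (\<lambda>x. (u x)\<^sup>2)"
  shows "set_integrable lborel (cball 0 r) u"
  unfolding set_integrable_def
proof (rule Bochner_Integration.integrable_bound[where f = "\<lambda>x. indicator (cball 0 r) x + (u x)\<^sup>2"])
  show "integrable lborel (\<lambda>x. indicator (cball 0 r) x + (u x)\<^sup>2)"
    using assms(2) emeasure_lborel_cball_finite[of "0::'a" r]
    by (intro Bochner_Integration.integrable_add integrable_real_indicator) auto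
  have "\<bar>t\<bar> \<le> 1 + t\<^sup>2" for t :: real
  proof -
    have "0 \<le> (\<bar>t\<bar> - 1)\<^sup>2" by simp
    then have "2 * \<bar>t\<bar> \<le> 1 + t\<^sup>2" unfolding power2_diff by simp
    then show ?thesis by linarith
  qed
  then show "AE x in lborel. norm (indicator (cball 0 r) x *\<^sub>R u x) \<le> norm (indicator (cball 0 r) x + (u x)\<^sup>2)"
    by (auto simp: indicator_def)
qed auto

text \<open>Translated mollifiers are test functions, so all mollifications of \<open>d\<close>
  vanish; the one-sided limit lemma is applied to \<open>d\<close> and to
  \<open>- d\<close>.\<close>

lemma ae_zero_of_test_fun:
  fixes d :: "'a::euclidean_space \<Rightarrow> real"
  assumes n: "DIM('a) \<ge> 3"
    and [measurable]: "d \<in> borel_measurable borel" and d: "\<And>r. set_integrable lborel (cball 0 r) d"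
    and 0: "\<And>\<phi>. test_fun \<phi> \<Longrightarrow> (LINT x|lborel. d x * \<phi> x) = 0"
  shows "AE x in lborel. d x = 0"
proof -
  let ?c = "LINT z|lborel. bubble 1 (z::'a)"
  have c: "?c > 0" by (rule bubble_mass_pos[OF n])
  have "AE x in lborel. x \<in> UNIV \<longrightarrow> ?c * d x \<le> 0"
    by (rule approx_identity_le[OF n _ _ d]) (simp_all add: 0 test_fun_moll set_integrable_def)
  moreover have "AE x in lborel. x \<in> UNIV \<longrightarrow> ?c * (- d x) \<le> 0"
  proof (rule approx_identity_le[OF n])
    show "set_integrable lborel (cball 0 r) (\<lambda>x. - d x)" for r
      using d[of r] by (simp add: set_integrable_def)
  qed (simp_all add: 0 test_fun_moll set_integrable_def)
  ultimately show ?thesis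
    by eventually_elim (use c in \<open>auto simp: mult_le_0_iff zero_le_mult_iff\<close>)
qed

text \<open>\<open>wgrad\<close> picks an unknown gradient. Uniqueness is what allows it to be
  replaced inside the energy by an explicit one. Each component of the difference is treated through
  a Borel representative.\<close>

lemma weak_grad_unique:
  fixes u :: "'a::euclidean_space \<Rightarrow> real"
  assumes n: "DIM('a) \<ge> 3" and g: "L2grad u g" and h: "L2grad u h"
  shows "AE x in lebesgue. g x = h x"
proof -
  have "AE x in lebesgue. (g x - h x) \<bullet> b = 0" if b: "b \<in> Basis" for b
  proof -
    have [measurable]: "g \<in> borel_measurable lebesgue" "h \<in> borel_measurable lebesgue"
      using g h by (auto simp: L2grad_def)
    have "(\<lambda>x. (g x - h x) \<bullet> b) \<in> borel_measurable lebesgue" by measurable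
    then obtain d where d: "d \<in> borel_measurable lborel" "AE x in lborel. (g x - h x) \<bullet> b = d x"
      using completion_ex_borel_measurable_real by blast
    then have [measurable]: "d \<in> borel_measurable borel" by simp
    have dl: "AE x in lebesgue. (g x - h x) \<bullet> b = d x" using d(2) by (rule AE_completion)
    have "integrable lebesgue (\<lambda>x. (d x)\<^sup>2)"
    proof (rule Bochner_Integration.integrable_bound[where f = "\<lambda>x. 2 * (norm (g x))\<^sup>2 + 2 * (norm (h x))\<^sup>2"])
      show "integrable lebesgue (\<lambda>x. 2 * (norm (g x))\<^sup>2 + 2 * (norm (h x))\<^sup>2)"
        using g h by (auto simp: L2grad_def)
      show "AE x in lebesgue. norm ((d x)\<^sup>2) \<le> norm (2 * (norm (g x))\<^sup>2 + 2 * (norm (h x))\<^sup>2)"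
        using dl
      proof eventually_elim
        case (elim x)
        have "\<bar>d x\<bar> \<le> norm (g x - h x)" using elim Basis_le_norm[OF b, of "g x - h x"] by simp
        also have "\<dots> \<le> norm (g x) + norm (h x)" by (rule norm_triangle_ineq4)
        finally have "(d x)\<^sup>2 \<le> (norm (g x) + norm (h x))\<^sup>2" using power_mono[of "\<bar>d x\<bar>" _ 2] by simp
        also have "\<dots> \<le> 2 * (norm (g x))\<^sup>2 + 2 * (norm (h x))\<^sup>2"
          using sum_squares_bound[of "norm (g x)" "norm (h x)"] by (simp add: power2_sum)
        finally show ?case by simp
      qed
    qed (auto intro!: measurable_completion)
    then have "integrable lborel (\<lambda>x. (d x)\<^sup>2)" by (subst (asm) integral_lebesgue_eq_lborel) auto
    then have li: "set_integrable lborel (cball 0 r) d" for r by (intro loc_integrable_of_square) auto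
    have "AE x in lborel. d x = 0"
    proof (rule ae_zero_of_test_fun[OF n _ li])
      fix \<phi> :: "'a \<Rightarrow> real" assume \<phi>: "test_fun \<phi>"
      then have [measurable]: "\<phi> \<in> borel_measurable borel" by measurable
      have i: "integrable lebesgue (\<lambda>x. (g x \<bullet> b) * \<phi> x)" "integrable lebesgue (\<lambda>x. (h x \<bullet> b) * \<phi> x)"
        "(LINT x|lebesgue. (g x \<bullet> b) * \<phi> x) = (LINT x|lebesgue. (h x \<bullet> b) * \<phi> x)"
        using g h \<phi> b by (auto simp: L2grad_def weak_grad_def)
      have "(LINT x|lborel. d x * \<phi> x) = (LINT x|lebesgue. d x * \<phi> x)"
        by (subst integral_lebesgue_eq_lborel) auto
      also have "\<dots> = (LINT x|lebesgue. (g x \<bullet> b) * \<phi> x - (h x \<bullet> b) * \<phi> x)"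
        by (rule integral_cong_AE) (use dl i in \<open>auto simp: inner_diff_left algebra_simps intro!: measurable_completion elim!: eventually_mono\<close>)
      also have "\<dots> = 0" using i by simp
      finally show "(LINT x|lborel. d x * \<phi> x) = 0" .
    qed simp
    then have "AE x in lebesgue. d x = 0" by (rule AE_completion)
    with dl show ?thesis by eventually_elim auto
  qed
  then have "AE x in lebesgue. \<forall>b\<in>Basis. (g x - h x) \<bullet> b = 0"
    by (simp add: AE_finite_all)
  then show ?thesis
  proof eventually_elim
    case (elim x)
    have "g x \<bullet> b = h x \<bullet> b" if "b \<in> Basis" for b
      using elim[rule_format, OF that] by (simp only: inner_diff_left)
    then show ?case by (rule euclidean_eqI)
  qed
qed


section \<open>Truncated Riesz potentials\<close>

text \<open>Cutting off at radius 1 leaves only the singularity to control, and because an indicator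
  is idempotent the family is closed under products and powers. At the origin the value is
  0.\<close>

definition rkern :: "real \<Rightarrow> 'a::euclidean_space \<Rightarrow> real" where
  "rkern a z = norm z powr (- a) * indicator (cball 0 1) z"

lemma rkern_nonneg: "rkern a z \<ge> 0"
  by (simp add: rkern_def)

lemma measurable_rkern [measurable]: "rkern a \<in> borel_measurable borel"
  unfolding rkern_def by measurable

lemma rkern_powr: "rkern a z powr s = rkern (a * s) z"
  by (auto simp: rkern_def indicator_def powr_powr)

lemma rkern_mult: "rkern a z * rkern b z = rkern (a + b) z"
  by (auto simp: rkern_def indicator_def powr_add[symmetric] intro!: arg_cong[where f = "\<lambda>t. norm z powr t"])

lemma nn_integral_rkern:
  assumes "0 \<le> a" "a < real DIM('a::euclidean_space)"
  obtains K where "K > 0" "(\<integral>\<^sup>+z. ennreal (rkern a (z::'a)) \<partial>lborel) \<le> ennreal K"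
proof -
  obtain K where K: "K > 0" "\<And>\<tau>. \<tau> > 0 \<Longrightarrow> (\<integral>\<^sup>+z. ennreal (norm (z::'a) powr (- a) * indicator (cball 0 \<tau>) z) \<partial>lborel)
        \<le> ennreal (K * \<tau> powr (real DIM('a) - a))"
    using nn_integral_powr_cball[OF assms] by blast
  show ?thesis using K(2)[of 1] by (intro that[OF K(1)]) (simp add: rkern_def)
qed

text \<open>Values in \<open>ennreal\<close> make the potential meaningful before it is known to be
  finite and allow integrals to be interchanged freely.\<close>

definition riesz :: "real \<Rightarrow> ('a::euclidean_space \<Rightarrow> real) \<Rightarrow> 'a \<Rightarrow> ennreal" where
  "riesz a h x = (\<integral>\<^sup>+y. ennreal (h y * rkern a (y - x)) \<partial>lborel)"

lemma measurable_riesz [measurable (raw)]: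
  assumes [measurable]: "h \<in> borel_measurable borel"
  shows "riesz a h \<in> borel_measurable borel"
  unfolding riesz_def[abs_def] by measurable

lemma riesz_loc_integrable:
  fixes h :: "'a::euclidean_space \<Rightarrow> real"
  assumes a: "0 \<le> a" "a < real DIM('a)" and [measurable]: "h \<in> borel_measurable borel"
    and h0: "\<And>y. h y \<ge> 0" and h: "\<And>r. set_integrable lborel (cball 0 r) h"
  shows "(\<integral>\<^sup>+x. indicator (cball 0 r) x * riesz a h x \<partial>lborel) < \<infinity>"
proof -
  obtain K where K: "K > 0" "(\<integral>\<^sup>+z. ennreal (rkern a (z::'a)) \<partial>lborel) \<le> ennreal K"
    using nn_integral_rkern[OF a] by blast
  have "(\<integral>\<^sup>+x. indicator (cball 0 r) x * riesz a h x \<partial>lborel)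
     = (\<integral>\<^sup>+x. \<integral>\<^sup>+y. indicator (cball 0 r) x * ennreal (h y * rkern a (y - x)) \<partial>lborel \<partial>lborel)"
    unfolding riesz_def by (simp add: nn_integral_cmult)
  also have "\<dots> \<le> (\<integral>\<^sup>+x. \<integral>\<^sup>+y. ennreal (h y * indicator (cball 0 (r + 1)) y) * ennreal (rkern a (y - x)) \<partial>lborel \<partial>lborel)"
  proof (intro nn_integral_mono)
    fix x y :: 'a
    show "indicator (cball 0 r) x * ennreal (h y * rkern a (y - x)) \<le> ennreal (h y * indicator (cball 0 (r + 1)) y) * ennreal (rkern a (y - x))"
    proof (cases "norm x \<le> r \<and> norm (y - x) \<le> 1")
      case True
      then have "norm y \<le> r + 1" using norm_triangle_ineq2[of y x] by linarith
      then show ?thesis using True by (simp add: ennreal_mult[OF h0 rkern_nonneg])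
    next
      case False
      then show ?thesis by (auto simp: rkern_def indicator_def)
    qed
  qed
  also have "\<dots> = (\<integral>\<^sup>+y. \<integral>\<^sup>+x. ennreal (h y * indicator (cball 0 (r + 1)) y) * ennreal (rkern a (y - x)) \<partial>lborel \<partial>lborel)"
    by (rule lborel_pair.Fubini'[symmetric]) measurable
  also have "\<dots> = (\<integral>\<^sup>+y. ennreal (h y * indicator (cball 0 (r + 1)) y) * (\<integral>\<^sup>+x. ennreal (rkern a (x::'a)) \<partial>lborel) \<partial>lborel)"
    using nn_integral_lborel_reflect[of "\<lambda>x. ennreal (rkern a (x::'a))"] by (simp add: nn_integral_cmult)
  also have "\<dots> = (\<integral>\<^sup>+y. ennreal (h y * indicator (cball 0 (r + 1)) y) \<partial>lborel) * (\<integral>\<^sup>+x. ennreal (rkern a (x::'a)) \<partial>lborel)"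
    by (rule nn_integral_multc) measurable
  also have "\<dots> < \<infinity>"
  proof -
    have "integrable lborel (\<lambda>y. h y * indicator (cball 0 (r + 1)) y)"
      using h[of "r+1"] by (simp add: set_integrable_def mult.commute)
    then have "(\<integral>\<^sup>+y. ennreal (h y * indicator (cball 0 (r + 1)) y) \<partial>lborel) < \<infinity>"
      by (subst nn_integral_eq_integral) (use h0 in auto)
    moreover have "(\<integral>\<^sup>+x. ennreal (rkern a (x::'a)) \<partial>lborel) < \<infinity>"
      using K(2) by (rule order.strict_trans1) simp
    ultimately show ?thesis by (simp add: ennreal_mult_less_top)
  qed
  finally show ?thesis .
qed

text \<open>The potential of a locally integrable density is locally integrable, hence finite almost
  everywhere, so its real version is an admissible right-hand side for
  \<open>approx_identity_le\<close>.\<close>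

lemma riesz_bound:
  fixes u h :: "'a::euclidean_space \<Rightarrow> real"
  assumes n: "DIM('a) \<ge> 3" and a: "0 \<le> a" "a < real DIM('a)"
    and [measurable]: "u \<in> borel_measurable borel" "h \<in> borel_measurable borel"
    and u: "\<And>r. set_integrable lborel (cball 0 r) u" and h: "\<And>r. set_integrable lborel (cball 0 r) h"
    and h0: "\<And>y. h y \<ge> 0"
    and le: "\<And>\<rho> x. \<rho> > 0 \<Longrightarrow> ennreal (LINT y|lborel. u y * moll \<rho> (y - x)) \<le> riesz a h x"
  shows "AE x in lborel. ennreal ((LINT z|lborel. bubble 1 (z::'a)) * u x) \<le> riesz a h x"
proof -
  \<comment> \<open>\<open>enn2real\<close> sends \<infinity> to 0, so \<open>?R\<close> is a
    genuine majorant only where the potential is finite; \<open>fin'\<close> provides this almost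
    everywhere.\<close>
  let ?R = "\<lambda>x. enn2real (riesz a h x)"
  have fin: "AE x in lborel. x \<in> cball 0 r \<longrightarrow> riesz a h x < \<infinity>" for r
  proof -
    have "AE x in lborel. indicator (cball 0 r) x * riesz a h x \<noteq> \<infinity>"
      using riesz_loc_integrable[OF a _ h0 h, of r] by (intro nn_integral_PInf_AE) auto
    then show ?thesis by eventually_elim (auto simp: less_top)
  qed
  have "AE x in lborel. \<forall>r::nat. x \<in> cball 0 (real r) \<longrightarrow> riesz a h x < \<infinity>"
    unfolding AE_all_countable using fin by blast
  then have fin': "AE x in lborel. riesz a h x < \<infinity>"
  proof eventually_elim
    case (elim x)
    obtain r :: nat where "norm x \<le> real r" using real_arch_simple by blast
    then show ?case using elim by auto
  qed
  have "AE x in lborel. x \<in> UNIV \<longrightarrow> (LINT z|lborel. bubble 1 (z::'a)) * u x \<le> ?R x"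
  proof (rule approx_identity_le[OF n])
    show "set_integrable lborel (cball 0 r) ?R" for r
      unfolding set_integrable_def
    proof (rule integrableI_bounded)
      have "(\<integral>\<^sup>+x. ennreal (norm (indicator (cball 0 r) x *\<^sub>R ?R x)) \<partial>lborel) \<le> (\<integral>\<^sup>+x. indicator (cball 0 r) x * riesz a h x \<partial>lborel)"
      proof (rule nn_integral_mono)
        fix x
        have "ennreal (?R x) \<le> riesz a h x" by (cases "riesz a h x") auto
        then show "ennreal (norm (indicator (cball 0 r) x *\<^sub>R ?R x)) \<le> indicator (cball 0 r) x * riesz a h x"
          by (auto simp: indicator_def)
      qed
      also have "\<dots> < \<infinity>" by (rule riesz_loc_integrable[OF a _ h0 h]) simp
      finally show "(\<integral>\<^sup>+x. ennreal (norm (indicator (cball 0 r) x *\<^sub>R ?R x)) \<partial>lborel) < \<infinity>" .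
    qed measurable
    show "AE x in lborel. x \<in> UNIV \<longrightarrow> (LINT y|lborel. u y * moll (1 / real (Suc k)) (y - x)) \<le> ?R x" for k
      using fin'
    proof eventually_elim
      case (elim x)
      have "ennreal (LINT y|lborel. u y * moll (1 / real (Suc k)) (y - x)) \<le> ennreal (?R x)"
        using le[of "1 / real (Suc k)" x] elim by simp
      then show ?case by (simp add: ennreal_le_iff)
    qed
  qed (use u in auto)
  then show ?thesis using fin'
  proof eventually_elim
    case (elim x)
    then have "ennreal ((LINT z|lborel. bubble 1 (z::'a)) * u x) \<le> ennreal (?R x)" by (intro ennreal_leI) auto
    then show ?case using elim(2) ennreal_enn2real[of "riesz a h x"] by (simp only: infinity_ennreal_def)
  qed
qed

section \<open>Subcritical Sobolev embedding\<close>

text \<open>Jensen's inequality for the finite measure w dM. It is not normalised, which accounts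
  for the power of the total mass. Young's inequality at the mean m = A / W supplies the tangent
  line to t^s; a vanishing mass or mean is treated apart to keep m positive.\<close>

lemma jensen_powr:
  fixes \<kappa> w :: "'a \<Rightarrow> real"
  assumes s: "s > 1" and w: "integrable M w" "\<And>x. w x \<ge> 0" and \<kappa>0: "\<And>x. \<kappa> x \<ge> 0"
    and i: "integrable M (\<lambda>x. w x * \<kappa> x)" "integrable M (\<lambda>x. w x * \<kappa> x powr s)"
  shows "(LINT x|M. w x * \<kappa> x) powr s \<le> (LINT x|M. w x) powr (s - 1) * (LINT x|M. w x * \<kappa> x powr s)"
proof -
  define W where "W = (LINT x|M. w x)"
  define A where "A = (LINT x|M. w x * \<kappa> x)"
  define B where "B = (LINT x|M. w x * \<kappa> x powr s)"
  have W0: "W \<ge> 0" unfolding W_def by (intro integral_nonneg_AE) (use w in auto)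
  have A0: "A \<ge> 0" unfolding A_def by (intro integral_nonneg_AE) (use w \<kappa>0 in auto)
  have B0: "B \<ge> 0" unfolding B_def by (intro integral_nonneg_AE) (use w \<kappa>0 in auto)
  show ?thesis
  proof (cases "W = 0 \<or> A = 0")
    case True
    have "A = 0"
    proof (cases "W = 0")
      case True
      then have "AE x in M. w x = 0" using integral_nonneg_eq_0_iff_AE[OF w(1)] w(2) by (simp add: W_def)
      then have "A = (LINT x|M. 0)" unfolding A_def
        using i by (intro integral_cong_AE) (auto elim!: eventually_mono)
      then show ?thesis by simp
    qed (use True in auto)
    then show ?thesis using W0 B0 by (simp add: A_def[symmetric] B_def[symmetric])
  next
    case False
    then have W: "W > 0" and A: "A > 0" using W0 A0 by auto
    define m where "m = A / W"
    have m: "m > 0" using W A by (simp add: m_def)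
    have young: "m powr (s - 1) * t \<le> (1 - 1/s) * m powr s + t powr s / s" if "t \<ge> 0" for t
    proof -
      have "t * m powr (s - 1) \<le> t powr s / s + (m powr (s - 1)) powr (s / (s - 1)) / (s / (s - 1))"
        using s that by (intro Youngs_inequality) (auto simp: field_simps)
      moreover have "(m powr (s - 1)) powr (s / (s - 1)) = m powr s" using s by (simp add: powr_powr)
      moreover have "m powr s / (s / (s - 1)) = (1 - 1/s) * m powr s" using s by (simp add: field_simps)
      ultimately show ?thesis by (simp add: mult.commute)
    qed
    have "m powr (s - 1) * A = (LINT x|M. w x * (m powr (s - 1) * \<kappa> x))"
      unfolding A_def by (simp add: mult_ac flip: integral_mult_right_zero)
    also have "\<dots> \<le> (LINT x|M. (1 - 1/s) * m powr s * w x + (w x * \<kappa> x powr s) / s)"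
    proof (rule integral_mono)
      show "integrable M (\<lambda>x. w x * (m powr (s - 1) * \<kappa> x))"
        using integrable_mult_right[OF i(1), of "m powr (s-1)"] by (simp add: mult_ac)
      show "integrable M (\<lambda>x. (1 - 1/s) * m powr s * w x + (w x * \<kappa> x powr s) / s)" using w i by auto
      fix x
      have "w x * (m powr (s - 1) * \<kappa> x) \<le> w x * ((1 - 1/s) * m powr s + \<kappa> x powr s / s)"
        using w young[OF \<kappa>0] by (intro mult_left_mono) auto
      then show "w x * (m powr (s - 1) * \<kappa> x) \<le> (1 - 1/s) * m powr s * w x + (w x * \<kappa> x powr s) / s"
        by (simp add: algebra_simps)
    qed
    also have "\<dots> = (1 - 1/s) * m powr s * W + B / s" unfolding W_def B_def using w i by simp
    finally have *: "m powr (s - 1) * A \<le> (1 - 1/s) * m powr s * W + B / s" .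
    have "m powr (s - 1) * A = m powr s * W"
    proof -
      have "m powr s = m powr (s - 1) * m" using m by (simp add: powr_diff)
      then show ?thesis using W by (simp add: m_def)
    qed
    with * have "m powr s * W \<le> (1 - 1/s) * (m powr s * W) + B / s" by (simp add: mult.assoc)
    then have "m powr s * W / s \<le> B / s" by (simp add: left_diff_distrib)
    then have "m powr s * W \<le> B" using s by (simp add: divide_le_cancel)
    moreover have "A powr s = m powr s * W * W powr (s - 1)"
    proof -
      have "A = m * W" using W by (simp add: m_def)
      then have "A powr s = m powr s * W powr s" using m W by (simp add: powr_mult)
      moreover have "W powr s = W * W powr (s - 1)" using W by (simp add: powr_diff)
      ultimately show ?thesis by simp
    qed
    ultimately have "A powr s \<le> B * W powr (s - 1)" by (simp add: mult_right_mono)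
    then show ?thesis by (simp add: A_def B_def W_def mult.commute)
  qed
qed

text \<open>Young's convolution inequality: Cauchy-Schwarz against the kernel, then Jensen with respect to
  the measure with density the square of the function.\<close>

lemma riesz_Lq:
  fixes h u :: "'a::euclidean_space \<Rightarrow> real"
  assumes n: "DIM('a) \<ge> 3"
    and [measurable]: "h \<in> borel_measurable borel" "u \<in> borel_measurable borel"
    and h0: "\<And>y. h y \<ge> 0" and h2: "integrable lborel (\<lambda>y. (h y)\<^sup>2)"
    and q: "2 < q" "q < 2 * real DIM('a) / (real DIM('a) - 2)"
    and c: "c > 0" and u: "AE x in lborel. 0 \<le> u x \<and> ennreal (c * u x) \<le> riesz (real DIM('a) - 1) h x"
  shows "integrable lborel (\<lambda>x. u x powr q)"
proof -
  define n where "n = real DIM('a)"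
  have n3: "n \<ge> 3" using n by (simp add: n_def)
  \<comment> \<open>The exponent of Young's convolution inequality, 1/r = 1/2 + 1/q. The condition
    (n - 1) r < n for local integrability of the kernel to the power r is exactly q < 2 n / (n -
    2).\<close>
  define r where "r = 2 * q / (q + 2)"
  define s where "s = q / 2"
  have s: "s > 1" using q by (simp add: s_def)
  have r: "1 < r" "r < 2" using q by (auto simp: r_def field_simps)
  have rs: "(2 - r) * s = r" using q by (simp add: r_def s_def field_simps)
  have rn: "(n - 1) * r < n"
  proof -
    have "q * (n - 2) < 2 * n" using q(2) n3 by (simp add: n_def field_simps)
    then show ?thesis using q(1) by (simp add: r_def field_simps)
  qed
  define H where "H = (LINT y|lborel. (h y)\<^sup>2)"
  obtain K where K: "K > 0" "(\<integral>\<^sup>+z. ennreal (rkern ((n - 1) * r) (z::'a)) \<partial>lborel) \<le> ennreal K"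
    using nn_integral_rkern[of "(n - 1) * r"] rn n3 r unfolding n_def by (auto simp: n_def)
  define B where "B x = (\<integral>\<^sup>+y. ennreal ((h y)\<^sup>2 * rkern ((n - 1) * r) (y - x)) \<partial>lborel)" for x :: 'a
  have [measurable]: "B \<in> borel_measurable borel" unfolding B_def[abs_def] by measurable
  have Bint: "(\<integral>\<^sup>+x. B x \<partial>lborel) < \<infinity>"
  proof -
    have "(\<integral>\<^sup>+x. B x \<partial>lborel) = (\<integral>\<^sup>+x. \<integral>\<^sup>+y. ennreal ((h y)\<^sup>2) * ennreal (rkern ((n - 1) * r) (y - x)) \<partial>lborel \<partial>lborel)"
      unfolding B_def by (simp add: ennreal_mult rkern_nonneg)
    also have "\<dots> = (\<integral>\<^sup>+y. \<integral>\<^sup>+x. ennreal ((h y)\<^sup>2) * ennreal (rkern ((n - 1) * r) (y - x)) \<partial>lborel \<partial>lborel)"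
      by (rule lborel_pair.Fubini'[symmetric]) measurable
    also have "\<dots> = (\<integral>\<^sup>+y. ennreal ((h y)\<^sup>2) * (\<integral>\<^sup>+x. ennreal (rkern ((n - 1) * r) (x::'a)) \<partial>lborel) \<partial>lborel)"
      using nn_integral_lborel_reflect[of "\<lambda>x. ennreal (rkern ((n - 1) * r) (x::'a))"] by (simp add: nn_integral_cmult)
    also have "\<dots> = (\<integral>\<^sup>+y. ennreal ((h y)\<^sup>2) \<partial>lborel) * (\<integral>\<^sup>+x. ennreal (rkern ((n - 1) * r) (x::'a)) \<partial>lborel)"
      by (rule nn_integral_multc) measurable
    also have "\<dots> < \<infinity>"
    proof -
      have "(\<integral>\<^sup>+y. ennreal ((h y)\<^sup>2) \<partial>lborel) < \<infinity>"
        by (subst nn_integral_eq_integral[OF h2]) auto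
      moreover have "(\<integral>\<^sup>+x. ennreal (rkern ((n - 1) * r) (x::'a)) \<partial>lborel) < \<infinity>"
        using K(2) by (rule order.strict_trans1) simp
      ultimately show ?thesis by (simp add: ennreal_mult_less_top)
    qed
    finally show ?thesis .
  qed
  have Bfin: "AE x in lborel. B x \<noteq> \<infinity>" using Bint by (intro nn_integral_PInf_AE) auto
  have key: "ennreal (u x powr q) \<le> ennreal ((K / c\<^sup>2) powr s * H powr (s - 1)) * B x"
    if ux: "0 \<le> u x" "ennreal (c * u x) \<le> riesz (n - 1) h x" and Bx: "B x \<noteq> \<infinity>" for x
  proof -
    let ?\<kappa> = "\<lambda>y. rkern ((n - 1) * (2 - r)) (y - x)"
    have \<kappa>s: "?\<kappa> y powr s = rkern ((n - 1) * r) (y - x)" for y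
      using rs by (simp add: rkern_powr mult.assoc)
    have i2: "integrable lborel (\<lambda>y. (h y)\<^sup>2 * rkern ((n - 1) * r) (y - x))"
      using Bx by (intro integrableI_nonneg) (auto simp: B_def rkern_nonneg less_top)
    have i1: "integrable lborel (\<lambda>y. (h y)\<^sup>2 * ?\<kappa> y)"
    proof (rule Bochner_Integration.integrable_bound[OF Bochner_Integration.integrable_add[OF h2 i2]])
      show "AE y in lborel. norm ((h y)\<^sup>2 * ?\<kappa> y) \<le> norm ((h y)\<^sup>2 + (h y)\<^sup>2 * rkern ((n - 1) * r) (y - x))"
      proof (rule AE_I2)
        fix y
        have "?\<kappa> y \<le> 1 + ?\<kappa> y powr s"
        proof (cases "?\<kappa> y \<le> 1")
          case False
          then have "?\<kappa> y powr 1 \<le> ?\<kappa> y powr s" using s by (intro powr_mono) auto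
          then show ?thesis using False by simp
        qed (simp add: add_increasing2)
        then have "(h y)\<^sup>2 * ?\<kappa> y \<le> (h y)\<^sup>2 * (1 + ?\<kappa> y powr s)" by (intro mult_left_mono) auto
        then show "norm ((h y)\<^sup>2 * ?\<kappa> y) \<le> norm ((h y)\<^sup>2 + (h y)\<^sup>2 * rkern ((n - 1) * r) (y - x))"
          unfolding \<kappa>s by (simp add: rkern_nonneg abs_mult algebra_simps)
      qed
    qed measurable
    have cs: "(riesz (n - 1) h x)\<^sup>2 \<le> ennreal K * ennreal (LINT y|lborel. (h y)\<^sup>2 * ?\<kappa> y)"
    proof -
      \<comment> \<open>The kernel is split so that the square of the first factor integrates to at
        most K, while the square of the second has exponent (n - 1)(2 - r); by \<open>rs\<close> its
        power s is again the integrable kernel.\<close>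
      have e: "h y * rkern (n - 1) (y - x) = rkern ((n - 1) * r / 2) (y - x) * (h y * rkern ((n - 1) * (1 - r / 2)) (y - x))" for y
      proof -
        have "(n - 1) * r / 2 + (n - 1) * (1 - r / 2) = n - 1" by (simp add: algebra_simps)
        then have "rkern ((n - 1) * r / 2) (y - x) * rkern ((n - 1) * (1 - r / 2)) (y - x) = rkern (n - 1) (y - x)"
          by (simp only: rkern_mult)
        then show ?thesis by (metis mult.left_commute)
      qed
      have "(riesz (n - 1) h x)\<^sup>2 = (\<integral>\<^sup>+y. ennreal (rkern ((n - 1) * r / 2) (y - x)) * ennreal (h y * rkern ((n - 1) * (1 - r / 2)) (y - x)) \<partial>lborel)\<^sup>2"
        unfolding riesz_def e by (simp add: ennreal_mult[OF rkern_nonneg mult_nonneg_nonneg[OF h0 rkern_nonneg]])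
      also have "\<dots> \<le> (\<integral>\<^sup>+y. (ennreal (rkern ((n - 1) * r / 2) (y - x)))\<^sup>2 \<partial>lborel) * (\<integral>\<^sup>+y. (ennreal (h y * rkern ((n - 1) * (1 - r / 2)) (y - x)))\<^sup>2 \<partial>lborel)"
        by (rule Cauchy_Schwarz_nn_integral) measurable
      also have "(\<integral>\<^sup>+y. (ennreal (rkern ((n - 1) * r / 2) (y - x)))\<^sup>2 \<partial>lborel) = (\<integral>\<^sup>+z. ennreal (rkern ((n - 1) * r) (z::'a)) \<partial>lborel)"
      proof -
        have "(ennreal (rkern ((n - 1) * r / 2) z))\<^sup>2 = ennreal (rkern ((n - 1) * r) z)" for z :: 'a
          by (simp only: power2_eq_square ennreal_mult[OF rkern_nonneg rkern_nonneg, symmetric] rkern_mult) (simp add: mult.commute)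
        then show ?thesis using nn_integral_lborel_shift[of "\<lambda>z. ennreal (rkern ((n - 1) * r) z)" x] by simp
      qed
      also have "(\<integral>\<^sup>+y. (ennreal (h y * rkern ((n - 1) * (1 - r / 2)) (y - x)))\<^sup>2 \<partial>lborel) = (\<integral>\<^sup>+y. ennreal ((h y)\<^sup>2 * ?\<kappa> y) \<partial>lborel)"
      proof -
        have "(n - 1) * (1 - r / 2) + (n - 1) * (1 - r / 2) = (n - 1) * (2 - r)" by (simp add: algebra_simps)
        then have "rkern ((n - 1) * (1 - r / 2)) z * rkern ((n - 1) * (1 - r / 2)) z = rkern ((n - 1) * (2 - r)) z" for z :: 'a
          by (simp only: rkern_mult)
        then have "(h y * rkern ((n - 1) * (1 - r / 2)) (y - x))\<^sup>2 = (h y)\<^sup>2 * ?\<kappa> y" for y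
          by (simp only: power_mult_distrib power2_eq_square[of "rkern _ _"])
        then show ?thesis
          by (simp only: ennreal_power[OF mult_nonneg_nonneg[OF h0 rkern_nonneg]])
      qed
      also have "\<dots> = ennreal (LINT y|lborel. (h y)\<^sup>2 * ?\<kappa> y)"
        by (rule nn_integral_eq_integral[OF i1]) (simp add: rkern_nonneg)
      finally show ?thesis using K(2) by (meson mult_right_mono order_trans zero_le)
    qed
    define A where "A = (LINT y|lborel. (h y)\<^sup>2 * ?\<kappa> y)"
    have A0: "A \<ge> 0" unfolding A_def by (intro integral_nonneg_AE) (simp add: rkern_nonneg)
    have "(ennreal (c * u x))\<^sup>2 \<le> (riesz (n - 1) h x)\<^sup>2" by (intro power_mono ux) simp
    also have "\<dots> \<le> ennreal K * ennreal A" using cs by (simp only: A_def)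
    also have "\<dots> = ennreal (K * A)" using K A0 by (simp add: ennreal_mult)
    finally have "(ennreal (c * u x))\<^sup>2 \<le> ennreal (K * A)" .
    then have "(c * u x)\<^sup>2 \<le> K * A" using ux c K A0 by (simp add: ennreal_power ennreal_le_iff)
    then have u2: "(u x)\<^sup>2 \<le> K / c\<^sup>2 * A" using c by (simp add: field_simps power_mult_distrib)
    have "u x powr q = ((u x)\<^sup>2) powr s"
    proof (cases "u x = 0")
      case False
      then show ?thesis using ux powr_square_half[of "u x" q] by (simp add: s_def)
    qed (use q in auto)
    also have "\<dots> \<le> (K / c\<^sup>2 * A) powr s" using u2 s by (intro powr_mono2) auto
    also have "\<dots> = (K / c\<^sup>2) powr s * A powr s" using K A0 by (intro powr_mult)
    also have "\<dots> \<le> (K / c\<^sup>2) powr s * (H powr (s - 1) * (LINT y|lborel. (h y)\<^sup>2 * rkern ((n - 1) * r) (y - x)))"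
      using jensen_powr[OF s h2 _ _ i1] i2 unfolding A_def H_def \<kappa>s
      by (intro mult_left_mono) (auto simp: rkern_nonneg)
    finally have "ennreal (u x powr q) \<le> ennreal ((K / c\<^sup>2) powr s * (H powr (s - 1) * (LINT y|lborel. (h y)\<^sup>2 * rkern ((n - 1) * r) (y - x))))"
      by (rule ennreal_leI)
    also have "\<dots> = ennreal ((K / c\<^sup>2) powr s * H powr (s - 1)) * ennreal (LINT y|lborel. (h y)\<^sup>2 * rkern ((n - 1) * r) (y - x))"
      by (simp add: ennreal_mult' mult.assoc flip: ennreal_mult')
    also have "ennreal (LINT y|lborel. (h y)\<^sup>2 * rkern ((n - 1) * r) (y - x)) = B x"
      unfolding B_def by (rule nn_integral_eq_integral[OF i2, symmetric]) (simp add: rkern_nonneg)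
    finally show ?thesis .
  qed
  show ?thesis
  proof (rule integrableI_bounded)
    have "(\<integral>\<^sup>+x. ennreal (norm (u x powr q)) \<partial>lborel) \<le> (\<integral>\<^sup>+x. ennreal ((K / c\<^sup>2) powr s * H powr (s - 1)) * B x \<partial>lborel)"
    proof (rule nn_integral_mono_AE)
      show "AE x in lborel. ennreal (norm (u x powr q)) \<le> ennreal ((K / c\<^sup>2) powr s * H powr (s - 1)) * B x"
        using u Bfin by eventually_elim (use key in \<open>auto simp: n_def\<close>)
    qed
    also have "\<dots> = ennreal ((K / c\<^sup>2) powr s * H powr (s - 1)) * (\<integral>\<^sup>+x. B x \<partial>lborel)"
      by (rule nn_integral_cmult) measurable
    also have "\<dots> < \<infinity>" using Bint by (simp add: ennreal_mult_less_top)
    finally show "(\<integral>\<^sup>+x. ennreal (norm (u x powr q)) \<partial>lborel) < \<infinity>" .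
  qed measurable
qed


section \<open>Borel representatives\<close>

lemma weak_grad_cong_AE:
  fixes u u' :: "'a::euclidean_space \<Rightarrow> real"
  assumes u: "u \<in> borel_measurable lebesgue" and u': "u' \<in> borel_measurable lebesgue" "AE x in lebesgue. u x = u' x"
    and g: "g \<in> borel_measurable lebesgue" "g' \<in> borel_measurable lebesgue" "AE x in lebesgue. g x = g' x"
    and w: "weak_grad u g"
  shows "weak_grad u' g'"
  unfolding weak_grad_def
proof (intro allI impI ballI)
  fix \<phi> :: "'a \<Rightarrow> real" and b :: 'a assume \<phi>: "test_fun \<phi>" and b: "b \<in> Basis"
  have "\<phi> \<in> borel_measurable borel" "iter_pd [b] \<phi> \<in> borel_measurable borel"
    using test_fun_measurable \<phi> test_fun_pd[OF \<phi> b] by blast+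
  then have [measurable]: "\<phi> \<in> borel_measurable lebesgue" "iter_pd [b] \<phi> \<in> borel_measurable lebesgue"
    by (auto intro!: measurable_completion simp del: iter_pd.simps)
  note [measurable] = u u'(1) g(1,2)
  have e1: "AE x in lebesgue. u x * iter_pd [b] \<phi> x = u' x * iter_pd [b] \<phi> x"
    using u'(2) by eventually_elim simp
  have e2: "AE x in lebesgue. (g x \<bullet> b) * \<phi> x = (g' x \<bullet> b) * \<phi> x"
    using g(3) by eventually_elim simp
  have w': "integrable lebesgue (\<lambda>x. u x * iter_pd [b] \<phi> x)" "integrable lebesgue (\<lambda>x. (g x \<bullet> b) * \<phi> x)"
    "(LINT x|lebesgue. u x * iter_pd [b] \<phi> x) = - (LINT x|lebesgue. (g x \<bullet> b) * \<phi> x)"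
    using w \<phi> b unfolding weak_grad_def by blast+
  have "integrable lebesgue (\<lambda>x. u' x * iter_pd [b] \<phi> x)"
    by (rule integrable_cong_AE_imp[OF w'(1)]) (use e1 in \<open>auto simp del: iter_pd.simps elim: eventually_mono\<close>)
  moreover have "integrable lebesgue (\<lambda>x. (g' x \<bullet> b) * \<phi> x)"
    by (rule integrable_cong_AE_imp[OF w'(2)]) (use e2 in \<open>auto elim: eventually_mono\<close>)
  moreover have "(LINT x|lebesgue. u' x * iter_pd [b] \<phi> x) = (LINT x|lebesgue. u x * iter_pd [b] \<phi> x)"
    by (rule integral_cong_AE) (use e1 in \<open>auto simp del: iter_pd.simps elim: eventually_mono\<close>)
  moreover have "(LINT x|lebesgue. (g' x \<bullet> b) * \<phi> x) = (LINT x|lebesgue. (g x \<bullet> b) * \<phi> x)"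
    by (rule integral_cong_AE) (use e2 in \<open>auto elim: eventually_mono\<close>)
  ultimately show "integrable lebesgue (\<lambda>x. u' x * iter_pd [b] \<phi> x) \<and> integrable lebesgue (\<lambda>x. (g' x \<bullet> b) * \<phi> x) \<and>
     (LINT x|lebesgue. u' x * iter_pd [b] \<phi> x) = - (LINT x|lebesgue. (g' x \<bullet> b) * \<phi> x)"
    using w'(3) by simp
qed

lemma L2grad_cong_AE:
  fixes u u' :: "'a::euclidean_space \<Rightarrow> real"
  assumes u: "u \<in> borel_measurable lebesgue" and u': "u' \<in> borel_measurable lebesgue" "AE x in lebesgue. u x = u' x"
    and g: "g' \<in> borel_measurable lebesgue" "AE x in lebesgue. g x = g' x"
    and w: "L2grad u g"
  shows "L2grad u' g'"
proof -
  note [measurable] = g(1)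
  have gm: "g \<in> borel_measurable lebesgue" and gi: "integrable lebesgue (\<lambda>x. (norm (g x))\<^sup>2)" using w by (auto simp: L2grad_def)
  have "integrable lebesgue (\<lambda>x. (norm (g' x))\<^sup>2)"
    by (rule integrable_cong_AE_imp[OF gi]) (use g(2) in \<open>auto elim: eventually_mono\<close>)
  then show ?thesis
    using weak_grad_cong_AE[OF u u' gm g] w g(1) by (simp add: L2grad_def)
qed

lemma L2grad_iff_AE:
  fixes u u' :: "'a::euclidean_space \<Rightarrow> real"
  assumes "u \<in> borel_measurable lebesgue" "u' \<in> borel_measurable lebesgue" "AE x in lebesgue. u x = u' x"
  shows "L2grad u g \<longleftrightarrow> L2grad u' g"
proof -
  have e: "AE x in lebesgue. u' x = u x" using assms(3) by eventually_elim simp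
  show ?thesis
    using L2grad_cong_AE[OF assms, of g g] L2grad_cong_AE[OF assms(2,1) e, of g g] by (auto simp: L2grad_def)
qed

lemma borel_representative_real:
  fixes u :: "'a::euclidean_space \<Rightarrow> real"
  assumes "u \<in> borel_measurable lebesgue"
  obtains u' where "u' \<in> borel_measurable borel" "AE x in lebesgue. u x = u' x"
proof -
  obtain u' where u': "u' \<in> borel_measurable lborel" "AE x in lborel. u x = u' x"
    using completion_ex_borel_measurable_real[OF assms] by blast
  have "AE x in lebesgue. u x = u' x" using u'(2) by (rule AE_completion)
  then show ?thesis using u'(1) by (intro that[of u']) simp_all
qed

lemma borel_representative_vector:
  fixes g :: "'a::euclidean_space \<Rightarrow> 'b::euclidean_space"
  assumes [measurable]: "g \<in> borel_measurable lebesgue"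
  obtains g' where "g' \<in> borel_measurable borel" "AE x in lebesgue. g x = g' x"
proof -
  have "\<forall>b. \<exists>d. d \<in> borel_measurable borel \<and> (AE x in lebesgue. g x \<bullet> b = d x)"
  proof
    fix b
    have "(\<lambda>x. g x \<bullet> b) \<in> borel_measurable lebesgue" by measurable
    then show "\<exists>d. d \<in> borel_measurable borel \<and> (AE x in lebesgue. g x \<bullet> b = d x)"
      using borel_representative_real by blast
  qed
  then obtain d where d: "\<And>b. d b \<in> borel_measurable borel" "\<And>b. AE x in lebesgue. g x \<bullet> b = d b x"
    by metis
  note [measurable] = d(1)
  have "AE x in lebesgue. \<forall>b\<in>Basis. g x \<bullet> b = d b x" using d(2) by (simp add: AE_finite_all)
  then have "AE x in lebesgue. g x = (\<Sum>b\<in>Basis. d b x *\<^sub>R b)"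
  proof eventually_elim
    case (elim x)
    have "(\<Sum>b\<in>Basis. d b x *\<^sub>R b) = (\<Sum>b\<in>Basis. (g x \<bullet> b) *\<^sub>R b)"
      by (rule sum.cong) (use elim in auto)
    then show ?case by (simp add: euclidean_representation)
  qed
  then show ?thesis by (intro that[of "\<lambda>x. \<Sum>b\<in>Basis. d b x *\<^sub>R b"]) measurable
qed

section \<open>The Sobolev embedding of the weak gradient\<close>

lemma lborel_loc_times_bounded:
  fixes w \<phi> :: "'a::euclidean_space \<Rightarrow> real"
  assumes [measurable]: "w \<in> borel_measurable borel" "\<phi> \<in> borel_measurable borel"
    and w: "\<And>r. set_integrable lborel (cball 0 r) w" and B: "B \<ge> 0" "\<And>x. \<bar>\<phi> x\<bar> \<le> B * indicator (cball 0 r) x"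
  shows "integrable lborel (\<lambda>x. w x * \<phi> x)"
proof -
  have "integrable lborel (\<lambda>x. B * (indicator (cball 0 r) x *\<^sub>R w x))"
    using w[of r] unfolding set_integrable_def by (rule integrable_mult_right)
  then show ?thesis
  proof (rule Bochner_Integration.integrable_bound)
    show "AE x in lborel. norm (w x * \<phi> x) \<le> norm (B * (indicator (cball 0 r) x *\<^sub>R w x))"
    proof (rule AE_I2)
      fix x
      have "\<bar>w x\<bar> * \<bar>\<phi> x\<bar> \<le> \<bar>w x\<bar> * (B * indicator (cball 0 r) x)" using B(2) by (intro mult_left_mono) auto
      then show "norm (w x * \<phi> x) \<le> norm (B * (indicator (cball 0 r) x *\<^sub>R w x))"
        using B(1) by (simp add: abs_mult mult_ac)
    qed
  qed measurable
qed

lemma lborel_loc_times_test: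
  fixes w \<phi> :: "'a::euclidean_space \<Rightarrow> real"
  assumes "w \<in> borel_measurable borel" "\<And>r. set_integrable lborel (cball 0 r) w" and \<phi>: "test_fun \<phi>"
  shows "integrable lborel (\<lambda>x. w x * \<phi> x)"
proof -
  obtain B r where B: "B > 0" "\<And>x. \<bar>\<phi> x\<bar> \<le> B * indicator (cball 0 r) x" using test_fun_bounded[OF \<phi>] by blast
  show ?thesis
    by (rule lborel_loc_times_bounded[OF assms(1) test_fun_measurable[OF \<phi>] assms(2) less_imp_le[OF B(1)] B(2)])
qed

lemma weak_grad_lborel:
  fixes u :: "'a::euclidean_space \<Rightarrow> real"
  assumes [measurable]: "u \<in> borel_measurable borel" "g \<in> borel_measurable borel" and w: "weak_grad u g"
    and \<phi>: "test_fun \<phi>" and b: "b \<in> Basis"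
  shows "integrable lborel (\<lambda>x. u x * iter_pd [b] \<phi> x)" "integrable lborel (\<lambda>x. (g x \<bullet> b) * \<phi> x)"
    "(LINT x|lborel. u x * iter_pd [b] \<phi> x) = - (LINT x|lborel. (g x \<bullet> b) * \<phi> x)"
proof -
  have [measurable]: "\<phi> \<in> borel_measurable borel" "iter_pd [b] \<phi> \<in> borel_measurable borel"
    using test_fun_measurable \<phi> test_fun_pd[OF \<phi> b] by blast+
  have m: "(\<lambda>x. u x * iter_pd [b] \<phi> x) \<in> borel_measurable borel" "(\<lambda>x. (g x \<bullet> b) * \<phi> x) \<in> borel_measurable borel"
    by measurable
  have w': "integrable lebesgue (\<lambda>x. u x * iter_pd [b] \<phi> x)" "integrable lebesgue (\<lambda>x. (g x \<bullet> b) * \<phi> x)"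
    "(LINT x|lebesgue. u x * iter_pd [b] \<phi> x) = - (LINT x|lebesgue. (g x \<bullet> b) * \<phi> x)"
    using w \<phi> b unfolding weak_grad_def by blast+
  show "integrable lborel (\<lambda>x. u x * iter_pd [b] \<phi> x)" "integrable lborel (\<lambda>x. (g x \<bullet> b) * \<phi> x)"
    "(LINT x|lborel. u x * iter_pd [b] \<phi> x) = - (LINT x|lborel. (g x \<bullet> b) * \<phi> x)"
    using w' unfolding integral_lebesgue_eq_lborel[OF m(1)] integral_lebesgue_eq_lborel[OF m(2)] by blast+
qed

text \<open>The weak gradient is tested with the partial derivatives of \<phi>, which are again test
  functions, and the identities are summed over the coordinates.\<close>

lemma lap_pairing:
  fixes u :: "'a::euclidean_space \<Rightarrow> real"
  assumes u: "u \<in> borel_measurable borel" "g \<in> borel_measurable borel" and w: "weak_grad u g" and \<phi>: "test_fun \<phi>"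
  shows "integrable lborel (\<lambda>x. u x * lap \<phi> x)" "integrable lborel (\<lambda>x. g x \<bullet> pgrad \<phi> x)"
    "(LINT x|lborel. u x * lap \<phi> x) = - (LINT x|lborel. g x \<bullet> pgrad \<phi> x)"
proof -
  note W = weak_grad_lborel[OF u w test_fun_pd[OF \<phi>]]
  have l: "u x * lap \<phi> x = (\<Sum>b\<in>Basis. u x * iter_pd [b] (iter_pd [b] \<phi>) x)" for x
    by (simp add: lap_def sum_distrib_left)
  have p: "g x \<bullet> pgrad \<phi> x = (\<Sum>b\<in>Basis. (g x \<bullet> b) * iter_pd [b] \<phi> x)" for x
    by (simp add: pgrad_def inner_sum_right mult.commute)
  show "integrable lborel (\<lambda>x. u x * lap \<phi> x)"
    unfolding l by (intro Bochner_Integration.integrable_sum W)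
  show "integrable lborel (\<lambda>x. g x \<bullet> pgrad \<phi> x)"
    unfolding p by (intro Bochner_Integration.integrable_sum W)
  have "(LINT x|lborel. u x * lap \<phi> x) = (\<Sum>b\<in>Basis. LINT x|lborel. u x * iter_pd [b] (iter_pd [b] \<phi>) x)"
    unfolding l by (intro Bochner_Integration.integral_sum W)
  also have "\<dots> = (\<Sum>b\<in>Basis. - (LINT x|lborel. (g x \<bullet> b) * iter_pd [b] \<phi> x))"
    by (intro sum.cong refl W)
  also have "\<dots> = - (LINT x|lborel. g x \<bullet> pgrad \<phi> x)"
    unfolding p sum_negf by (subst Bochner_Integration.integral_sum) (auto simp del: iter_pd.simps intro!: W)
  finally show "(LINT x|lborel. u x * lap \<phi> x) = - (LINT x|lborel. g x \<bullet> pgrad \<phi> x)" .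
qed

lemma AE_lborel_neq: "AE y in lborel. y \<noteq> (x::'a::euclidean_space)"
  using AE_lborel_not_in_negligible[of "{x}"] by simp

text \<open>Lets a bounded error supported in the unit ball be absorbed into the potential. The
  origin is excluded because \<open>rkern\<close> vanishes there.\<close>

lemma rkern_ge_indicator:
  assumes "a \<ge> 0" "z \<noteq> 0"
  shows "indicator (cball 0 1) z \<le> rkern a z"
proof (cases "norm z \<le> 1")
  case True
  have "norm z powr 0 \<le> norm z powr (- a)" using True assms by (intro powr_mono') auto
  then show ?thesis using True assms by (simp add: rkern_def)
qed (simp add: rkern_nonneg)

text \<open>The pointwise bound may fail at x, which is a null set, and integrability of
  \<open>w\<close> is not asked for: otherwise its integral is 0 by convention.\<close>

lemma integral_le_riesz:
  fixes h w :: "'a::euclidean_space \<Rightarrow> real"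
  assumes "\<And>y. y \<noteq> x \<Longrightarrow> w y \<le> h y * rkern a (y - x)"
  shows "ennreal (LINT y|lborel. w y) \<le> riesz a h x"
proof (cases "integrable lborel w")
  case True
  have "(LINT y|lborel. w y) \<le> (LINT y|lborel. max 0 (w y))"
    using True by (intro integral_mono) auto
  then have "ennreal (LINT y|lborel. w y) \<le> ennreal (LINT y|lborel. max 0 (w y))" by (rule ennreal_leI)
  also have "\<dots> = (\<integral>\<^sup>+y. ennreal (max 0 (w y)) \<partial>lborel)"
    using True by (intro nn_integral_eq_integral[symmetric]) auto
  also have "\<dots> \<le> riesz a h x" unfolding riesz_def
    by (rule nn_integral_mono_AE, rule eventually_mono[OF AE_lborel_neq[of x]])
       (metis assms ennreal_leI ennreal_max_0)
  finally show ?thesis .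
qed (simp add: not_integrable_integral_eq)

text \<open>Testing the weak gradient with \<open>newt\<close> rewrites the mollified u as the
  integral of u times a bounded error plus g times the gradient of the kernel. Both are dominated by
  |z|^(1-n), so u is bounded by a potential of h = M (u + |g|), which lies in L^2, and the
  convolution inequality applies.\<close>

theorem L2grad_embedding:
  fixes u :: "'a::euclidean_space \<Rightarrow> real"
  assumes n: "DIM('a) \<ge> 3" and um[measurable]: "u \<in> borel_measurable borel" and gm[measurable]: "g \<in> borel_measurable borel"
    and u2: "integrable lborel (\<lambda>x. (u x)\<^sup>2)" and g: "L2grad u g" and u0: "\<And>x. u x \<ge> 0"
    and q: "2 < q" "q < 2 * real DIM('a) / (real DIM('a) - 2)"
  shows "integrable lborel (\<lambda>x. u x powr q)"
proof -
  have g2: "integrable lborel (\<lambda>x. (norm (g x))\<^sup>2)" and w: "weak_grad u g"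
    using g integral_lebesgue_eq_lborel(2)[of "\<lambda>x. (norm (g x))\<^sup>2"] by (auto simp: L2grad_def)
  obtain M where M: "M > 0"
    "\<And>\<rho> a (y::'a). \<rho> > 0 \<Longrightarrow> \<bar>lap (\<lambda>y. newt \<rho> (y - a)) y + moll \<rho> (y - a)\<bar> \<le> M * indicator (cball a 1) y"
    "\<And>\<rho> a (y::'a). \<rho> > 0 \<Longrightarrow> norm (pgrad (\<lambda>y. newt \<rho> (y - a)) y) \<le> M * norm (y - a) powr (1 - real DIM('a)) * indicator (cball a 1) y"
    using newt_kernel_bounds[OF n] by blast
  define h where "h y = M * (u y + norm (g y))" for y
  have [measurable]: "h \<in> borel_measurable borel" unfolding h_def[abs_def] by measurable
  have h0: "h y \<ge> 0" for y using M u0 by (simp add: h_def)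
  have h2: "integrable lborel (\<lambda>y. (h y)\<^sup>2)"
  proof (rule Bochner_Integration.integrable_bound[where f = "\<lambda>y. 2 * M\<^sup>2 * ((u y)\<^sup>2 + (norm (g y))\<^sup>2)"])
    show "integrable lborel (\<lambda>y. 2 * M\<^sup>2 * ((u y)\<^sup>2 + (norm (g y))\<^sup>2))" using u2 g2 by auto
    have "(h y)\<^sup>2 \<le> 2 * M\<^sup>2 * ((u y)\<^sup>2 + (norm (g y))\<^sup>2)" for y
    proof -
      have "(u y + norm (g y))\<^sup>2 \<le> 2 * ((u y)\<^sup>2 + (norm (g y))\<^sup>2)"
        using sum_squares_bound[of "u y" "norm (g y)"] by (simp add: power2_sum)
      then have "M\<^sup>2 * (u y + norm (g y))\<^sup>2 \<le> M\<^sup>2 * (2 * ((u y)\<^sup>2 + (norm (g y))\<^sup>2))" by (intro mult_left_mono) auto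
      then show ?thesis by (simp only: h_def power_mult_distrib mult_ac)
    qed
    then show "AE y in lborel. norm ((h y)\<^sup>2) \<le> norm (2 * M\<^sup>2 * ((u y)\<^sup>2 + (norm (g y))\<^sup>2))"
      using order_trans by fastforce
  qed measurable
  have ul: "set_integrable lborel (cball 0 r) u" for r using loc_integrable_of_square[OF um u2] .
  have hl: "set_integrable lborel (cball 0 r) h" for r using loc_integrable_of_square[OF _ h2] by simp
  have "AE x in lborel. ennreal ((LINT z|lborel. bubble 1 (z::'a)) * u x) \<le> riesz (real DIM('a) - 1) h x"
  proof (rule riesz_bound[OF n _ _ um _ ul hl h0])
    fix \<rho> :: real and x :: 'a assume \<rho>: "\<rho> > 0"
    define k where "k = (\<lambda>y. newt \<rho> (y - x))"
    have tk: "test_fun k" unfolding k_def by (rule test_fun_newt[OF \<rho>])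
    note P = lap_pairing[OF um gm w tk]
    have i: "integrable lborel (\<lambda>y. u y * moll \<rho> (y - x))"
      by (rule lborel_loc_times_test[OF um ul test_fun_moll[OF \<rho>]])
    have "(LINT y|lborel. u y * moll \<rho> (y - x)) = (LINT y|lborel. u y * (lap k y + moll \<rho> (y - x)) + g y \<bullet> pgrad k y)"
      using P i by (simp add: distrib_left)
    moreover have "ennreal (LINT y|lborel. u y * (lap k y + moll \<rho> (y - x)) + g y \<bullet> pgrad k y) \<le> riesz (real DIM('a) - 1) h x"
    proof (rule integral_le_riesz)
      fix y :: 'a assume y: "y \<noteq> x"
      have c: "indicator (cball x 1) y = (indicator (cball 0 1) (y - x) :: real)"
        by (simp add: indicator_def dist_norm norm_minus_commute)
      have A: "lap k y + moll \<rho> (y - x) \<le> M * rkern (real DIM('a) - 1) (y - x)"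
      proof -
        have "lap k y + moll \<rho> (y - x) \<le> M * indicator (cball 0 1) (y - x)"
          using M(2)[OF \<rho>, of x y] unfolding k_def c by linarith
        also have "\<dots> \<le> M * rkern (real DIM('a) - 1) (y - x)"
          using M(1) n y by (intro mult_left_mono rkern_ge_indicator) auto
        finally show ?thesis .
      qed
      have B: "norm (pgrad k y) \<le> M * rkern (real DIM('a) - 1) (y - x)"
        using M(3)[OF \<rho>, of x y] unfolding k_def c by (simp add: rkern_def mult.assoc)
      have "g y \<bullet> pgrad k y \<le> norm (g y) * norm (pgrad k y)" by (rule norm_cauchy_schwarz)
      also have "\<dots> \<le> norm (g y) * (M * rkern (real DIM('a) - 1) (y - x))" by (rule mult_left_mono[OF B]) simp
      finally have "u y * (lap k y + moll \<rho> (y - x)) + g y \<bullet> pgrad k y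
        \<le> u y * (M * rkern (real DIM('a) - 1) (y - x)) + norm (g y) * (M * rkern (real DIM('a) - 1) (y - x))"
        using mult_left_mono[OF A u0[of y]] by linarith
      then show "u y * (lap k y + moll \<rho> (y - x)) + g y \<bullet> pgrad k y \<le> h y * rkern (real DIM('a) - 1) (y - x)"
        by (simp add: h_def algebra_simps)
    qed
    ultimately show "ennreal (LINT y|lborel. u y * moll \<rho> (y - x)) \<le> riesz (real DIM('a) - 1) h x" by simp
  qed (use n in auto)
  then have "AE x in lborel. 0 \<le> u x \<and> ennreal ((LINT z|lborel. bubble 1 (z::'a)) * u x) \<le> riesz (real DIM('a) - 1) h x"
    by eventually_elim (simp add: u0)
  from riesz_Lq[OF n _ um h0 h2 q bubble_mass_pos[OF n] this] show ?thesis by simp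
qed


section \<open>Differentiation under the integral sign\<close>

lemma has_real_derivative_integral_at_0:
  fixes F F' :: "'x \<Rightarrow> real \<Rightarrow> real"
  assumes d: "\<And>x t. \<bar>t\<bar> < 1 \<Longrightarrow> (F x has_real_derivative F' x t) (at t)"
    and bd: "\<And>x t. \<bar>t\<bar> < 1 \<Longrightarrow> \<bar>F' x t\<bar> \<le> w x" and w: "integrable M w"
    and m[measurable]: "\<And>t. (\<lambda>x. F x t) \<in> borel_measurable M" "(\<lambda>x. F' x 0) \<in> borel_measurable M"
    and i: "integrable M (\<lambda>x. F x 0)"
  shows "((\<lambda>t. LINT x|M. F x t) has_real_derivative (LINT x|M. F' x 0)) (at 0)"
proof -
  have lip: "\<bar>F x t - F x 0\<bar> \<le> w x * \<bar>t\<bar>" if "\<bar>t\<bar> < 1" for x t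
  proof -
    have "norm (F x t - F x 0) \<le> w x * norm (t - 0)"
      by (rule field_differentiable_bound[of "ball 0 1" "F x" "F' x"])
         (use that d bd in \<open>auto simp: has_field_derivative_at_within\<close>)
    then show ?thesis by simp
  qed
  have it: "integrable M (\<lambda>x. F x t)" if "\<bar>t\<bar> < 1" for t
  proof (rule Bochner_Integration.integrable_bound[OF Bochner_Integration.integrable_add[OF integrable_abs[OF i] integrable_abs[OF w]]])
    show "AE x in M. norm (F x t) \<le> norm (\<bar>F x 0\<bar> + \<bar>w x\<bar>)"
    proof (rule AE_I2)
      fix x
      have "\<bar>w x\<bar> * \<bar>t\<bar> \<le> \<bar>w x\<bar> * 1" using that by (intro mult_left_mono) auto
      moreover have "w x * \<bar>t\<bar> \<le> \<bar>w x\<bar> * \<bar>t\<bar>" by (intro mult_right_mono) auto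
      ultimately have "\<bar>F x t\<bar> \<le> \<bar>F x 0\<bar> + \<bar>w x\<bar>" using lip[OF that, of x] by linarith
      then show "norm (F x t) \<le> norm (\<bar>F x 0\<bar> + \<bar>w x\<bar>)" by simp
    qed
  qed measurable
  have "((\<lambda>h. ((LINT x|M. F x (0 + h)) - (LINT x|M. F x 0)) / h) \<longlongrightarrow> (LINT x|M. F' x 0)) (at 0)"
    unfolding tendsto_at_iff_sequentially comp_def
  proof (intro allI impI)
    fix X :: "nat \<Rightarrow> real" assume X: "\<forall>i. X i \<in> UNIV - {0}" "X \<longlonglongrightarrow> 0"
    have ev: "\<forall>\<^sub>F i in sequentially. \<bar>X i\<bar> < 1"
      using X(2) by (auto simp: tendsto_iff dist_norm elim!: allE[of _ 1])
    \<comment> \<open>Setting the quotient to 0 while |X i| \<ge> 1 makes the majorant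
      \<open>w\<close> valid for every index and changes only finitely many terms.\<close>
    define s where "s i x = (if \<bar>X i\<bar> < 1 then (F x (X i) - F x 0) / X i else 0)" for i x
    have "(\<lambda>i. LINT x|M. s i x) \<longlonglongrightarrow> (LINT x|M. F' x 0)"
    proof (rule integral_dominated_convergence[where w = w])
      show "AE x in M. (\<lambda>i. s i x) \<longlonglongrightarrow> F' x 0"
      proof (rule AE_I2)
        fix x
        have "((\<lambda>h. (F x (0 + h) - F x 0) / h) \<longlongrightarrow> F' x 0) (at 0)" using d[of 0 x] by (simp add: DERIV_def)
        then have "(\<lambda>i. (F x (0 + X i) - F x 0) / X i) \<longlonglongrightarrow> F' x 0"
          unfolding tendsto_at_iff_sequentially comp_def using X by blast
        then show "(\<lambda>i. s i x) \<longlonglongrightarrow> F' x 0"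
          by (rule Lim_transform_eventually) (use ev in eventually_elim, auto simp: s_def)
      qed
      show "AE x in M. norm (s i x) \<le> w x" for i
      proof (rule AE_I2)
        fix x
        show "norm (s i x) \<le> w x"
        proof (cases "\<bar>X i\<bar> < 1")
          case True
          have "X i \<noteq> 0" using X(1) by blast
          then show ?thesis using True lip[OF True, of x] by (simp add: s_def abs_divide pos_divide_le_eq)
        next
          case False
          then show ?thesis using bd[of 0 x] by (simp add: s_def)
        qed
      qed
    qed (use w in \<open>auto simp: s_def\<close>)
    then show "(\<lambda>i. ((LINT x|M. F x (0 + X i)) - (LINT x|M. F x 0)) / X i) \<longlonglongrightarrow> (LINT x|M. F' x 0)"
    proof (rule Lim_transform_eventually)
      show "\<forall>\<^sub>F i in sequentially. (LINT x|M. s i x) = ((LINT x|M. F x (0 + X i)) - (LINT x|M. F x 0)) / X i"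
        using ev by eventually_elim (simp add: s_def it i)
    qed
  qed
  then show ?thesis by (simp add: DERIV_def)
qed

section \<open>The nonlinearity\<close>

lemma primF_has_derivative:
  assumes "continuous_on UNIV f"
  shows "(primF f has_real_derivative f t) (at t)"
proof -
  have "((\<lambda>u. LBINT y=ereal 0..ereal u. f y) has_vector_derivative f t) (at t within {-\<bar>t\<bar>-1..\<bar>t\<bar>+1})"
    by (rule interval_integral_FTC2) (auto intro: continuous_on_subset[OF assms])
  then have "((\<lambda>u. LBINT y=ereal 0..ereal u. f y) has_vector_derivative f t) (at t)"
    by (subst (asm) at_within_interior) (auto simp: interior_atLeastAtMost_real)
  then show ?thesis
    by (simp add: primF_def[abs_def] has_real_derivative_iff_has_vector_derivative zero_ereal_def)
qed

lemma primF_bound: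
  fixes f :: "real \<Rightarrow> real"
  assumes f: "continuous_on UNIV f" and fb: "\<And>t. \<bar>f t\<bar> \<le> C * (\<bar>t\<bar> + \<bar>t\<bar> powr (p - 1))" and p: "p > 2" and C: "C \<ge> 0"
  shows "\<bar>primF f t\<bar> \<le> C * (t\<^sup>2 + \<bar>t\<bar> powr p)"
proof -
  have 0: "primF f 0 = 0" unfolding primF_def zero_ereal_def by simp
  have "norm (primF f t - primF f 0) \<le> C * (\<bar>t\<bar> + \<bar>t\<bar> powr (p - 1)) * norm (t - 0)"
  proof (rule field_differentiable_bound[of "cball 0 \<bar>t\<bar>" "primF f" f])
    fix s :: real assume "s \<in> cball 0 \<bar>t\<bar>"
    then have s: "\<bar>s\<bar> \<le> \<bar>t\<bar>" by simp
    have "\<bar>f s\<bar> \<le> C * (\<bar>s\<bar> + \<bar>s\<bar> powr (p - 1))" by (rule fb)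
    also have "\<dots> \<le> C * (\<bar>t\<bar> + \<bar>t\<bar> powr (p - 1))"
      using s C p by (intro mult_left_mono add_mono powr_mono2) auto
    finally show "norm (f s) \<le> C * (\<bar>t\<bar> + \<bar>t\<bar> powr (p - 1))" by simp
  qed (auto intro: has_field_derivative_at_within primF_has_derivative[OF f])
  also have "\<dots> = C * (t\<^sup>2 + \<bar>t\<bar> powr p)"
  proof -
    have "\<bar>t\<bar> powr p = \<bar>t\<bar> powr (p - 1) * \<bar>t\<bar>" by (cases "t = 0") (simp_all add: powr_diff)
    then show ?thesis by (simp add: algebra_simps power2_eq_square)
  qed
  finally show ?thesis by (simp add: 0)
qed

text \<open>The constant 1 in the growth condition is useless on a space of infinite measure. Below
  \<delta> it is replaced using f(t) = o(t), and above \<delta> it is absorbed because 1 \<le> |t| /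
  \<delta>. Continuity and the limit of f(t) / t force f(0) = 0.\<close>

lemma nonlinearity_bound:
  fixes f :: "real \<Rightarrow> real"
  assumes f: "continuous_on UNIV f" and b: "\<And>t. \<bar>f t\<bar> \<le> C0 * (1 + \<bar>t\<bar> powr (p - 1))"
    and F2: "((\<lambda>t. f t / t) \<longlongrightarrow> 0) (at 0)"
  obtains C where "C > 0" "\<And>t. \<bar>f t\<bar> \<le> C * (\<bar>t\<bar> + \<bar>t\<bar> powr (p - 1))"
proof -
  have f0: "f 0 = 0"
  proof -
    have "((\<lambda>t. t * (f t / t)) \<longlongrightarrow> 0) (at 0)" using tendsto_mult[OF tendsto_ident_at F2] by simp
    moreover have "\<forall>\<^sub>F t in at (0::real). t * (f t / t) = f t"
      unfolding eventually_at_filter by (rule always_eventually) simp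
    ultimately have "(f \<longlongrightarrow> 0) (at 0)" by (rule Lim_transform_eventually)
    moreover have "(f \<longlongrightarrow> f 0) (at 0)" using f by (simp add: continuous_on_eq_continuous_at isCont_def)
    ultimately show ?thesis using tendsto_unique[OF at_neq_bot] by blast
  qed
  have "\<forall>\<^sub>F t in at 0. \<bar>f t / t\<bar> < 1" using F2 by (auto simp: tendsto_iff dist_norm elim!: allE[of _ 1])
  then obtain \<delta> where \<delta>: "\<delta> > 0" "\<And>t. t \<noteq> 0 \<Longrightarrow> \<bar>t\<bar> < \<delta> \<Longrightarrow> \<bar>f t / t\<bar> < 1"
    unfolding eventually_at by (auto simp: dist_norm)
  define C where "C = 1 + \<bar>C0\<bar> + \<bar>C0\<bar> / \<delta>"
  have C: "C \<ge> 1" "C \<ge> \<bar>C0\<bar>" "C \<ge> \<bar>C0\<bar> / \<delta>" using \<delta>(1) by (auto simp: C_def)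
  show ?thesis
  proof (rule that[of C])
    fix t
    consider "t = 0" | "t \<noteq> 0" "\<bar>t\<bar> < \<delta>" | "\<bar>t\<bar> \<ge> \<delta>" by linarith
    then show "\<bar>f t\<bar> \<le> C * (\<bar>t\<bar> + \<bar>t\<bar> powr (p - 1))"
    proof cases
      case 1 then show ?thesis using f0 by simp
    next
      case 2
      then have "\<bar>f t\<bar> \<le> 1 * \<bar>t\<bar>" using \<delta>(2)[of t] by (simp add: abs_divide field_simps)
      also have "\<dots> \<le> C * (\<bar>t\<bar> + \<bar>t\<bar> powr (p - 1))" using C by (intro mult_mono) auto
      finally show ?thesis .
    next
      case 3
      have "\<bar>f t\<bar> \<le> C0 * (1 + \<bar>t\<bar> powr (p - 1))" by (rule b)
      also have "\<dots> \<le> \<bar>C0\<bar> * (1 + \<bar>t\<bar> powr (p - 1))" by (intro mult_right_mono) auto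
      also have "\<dots> = \<bar>C0\<bar> * 1 + \<bar>C0\<bar> * \<bar>t\<bar> powr (p - 1)" by (simp add: algebra_simps)
      also have "\<dots> \<le> \<bar>C0\<bar> / \<delta> * \<bar>t\<bar> + C * \<bar>t\<bar> powr (p - 1)"
      proof (intro add_mono mult_right_mono C)
        show "\<bar>C0\<bar> * 1 \<le> \<bar>C0\<bar> / \<delta> * \<bar>t\<bar>" using mult_left_mono[OF 3, of "\<bar>C0\<bar>"] \<delta>(1) by (simp add: field_simps)
      qed simp
      also have "\<dots> \<le> C * \<bar>t\<bar> + C * \<bar>t\<bar> powr (p - 1)" using C by (intro add_mono mult_right_mono) auto
      finally show ?thesis by (simp add: algebra_simps)
    qed
  qed (use C in auto)
qed

section \<open>Elementary inequalities for powers\<close>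

lemma powr_le_one_plus: "0 \<le> t \<Longrightarrow> 0 \<le> a \<Longrightarrow> a \<le> b \<Longrightarrow> (t::real) powr a \<le> 1 + t powr b"
proof (cases "t \<le> 1")
  case True
  assume "0 \<le> t" "0 \<le> a"
  then have "t powr a \<le> 1" using True by (simp add: powr_le1)
  then show ?thesis by (simp add: add_increasing2)
next
  case False
  assume "a \<le> b"
  then have "t powr a \<le> t powr b" using False by (intro powr_mono) auto
  then show ?thesis by simp
qed

lemma powr_add_le: "0 \<le> a \<Longrightarrow> 0 \<le> b \<Longrightarrow> 0 \<le> p \<Longrightarrow> (a + b) powr p \<le> 2 powr p * (a powr p + b powr (p::real))"
proof -
  assume ab: "0 \<le> a" "0 \<le> b" "0 \<le> p"
  have "(a + b) powr p \<le> (2 * max a b) powr p" using ab by (intro powr_mono2) auto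
  also have "\<dots> = 2 powr p * max a b powr p" using ab by (simp add: powr_mult)
  also have "\<dots> \<le> 2 powr p * (a powr p + b powr p)" by (intro mult_left_mono) (auto simp: max_def)
  finally show ?thesis .
qed

section \<open>The Euler-Lagrange equation away from the singular set\<close>

lemma weak_grad_add_scaled:
  fixes u v :: "'a::euclidean_space \<Rightarrow> real"
  assumes u: "weak_grad u g" and v: "weak_grad v h"
  shows "weak_grad (\<lambda>x. u x + t * v x) (\<lambda>x. g x + t *\<^sub>R h x)"
  unfolding weak_grad_def
proof (intro allI impI ballI)
  fix \<phi> :: "'a \<Rightarrow> real" and b :: 'a assume \<phi>: "test_fun \<phi>" "b \<in> Basis"
  have 1: "integrable lebesgue (\<lambda>x. u x * iter_pd [b] \<phi> x)" "integrable lebesgue (\<lambda>x. (g x \<bullet> b) * \<phi> x)"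
    "(LINT x|lebesgue. u x * iter_pd [b] \<phi> x) = - (LINT x|lebesgue. (g x \<bullet> b) * \<phi> x)"
    using u \<phi> unfolding weak_grad_def by blast+
  have 2: "integrable lebesgue (\<lambda>x. v x * iter_pd [b] \<phi> x)" "integrable lebesgue (\<lambda>x. (h x \<bullet> b) * \<phi> x)"
    "(LINT x|lebesgue. v x * iter_pd [b] \<phi> x) = - (LINT x|lebesgue. (h x \<bullet> b) * \<phi> x)"
    using v \<phi> unfolding weak_grad_def by blast+
  have e: "(u x + t * v x) * iter_pd [b] \<phi> x = u x * iter_pd [b] \<phi> x + t * (v x * iter_pd [b] \<phi> x)"
    "((g x + t *\<^sub>R h x) \<bullet> b) * \<phi> x = (g x \<bullet> b) * \<phi> x + t * ((h x \<bullet> b) * \<phi> x)" for x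
    by (simp_all add: algebra_simps inner_add_left del: iter_pd.simps)
  show "integrable lebesgue (\<lambda>x. (u x + t * v x) * iter_pd [b] \<phi> x) \<and>
    integrable lebesgue (\<lambda>x. ((g x + t *\<^sub>R h x) \<bullet> b) * \<phi> x) \<and>
    (LINT x|lebesgue. (u x + t * v x) * iter_pd [b] \<phi> x) = - (LINT x|lebesgue. ((g x + t *\<^sub>R h x) \<bullet> b) * \<phi> x)"
    unfolding e using 1 2 by (simp del: iter_pd.simps)
qed

lemma norm_add_sq_le: "(norm (a + b))\<^sup>2 \<le> 2 * (norm a)\<^sup>2 + 2 * (norm (b::'a::real_normed_vector))\<^sup>2"
proof -
  have "(norm (a + b))\<^sup>2 \<le> (norm a + norm b)\<^sup>2" by (intro power_mono norm_triangle_ineq) simp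
  then show ?thesis using sum_squares_bound[of "norm a" "norm b"] by (simp add: power2_sum)
qed

lemma L2grad_add_scaled:
  assumes u: "L2grad u g" and v: "L2grad v h"
  shows "L2grad (\<lambda>x. u x + t * v x) (\<lambda>x. g x + t *\<^sub>R h x)"
proof -
  have [measurable]: "g \<in> borel_measurable lebesgue" "h \<in> borel_measurable lebesgue" using u v by (auto simp: L2grad_def)
  have "integrable lebesgue (\<lambda>x. (norm (g x + t *\<^sub>R h x))\<^sup>2)"
  proof (rule Bochner_Integration.integrable_bound[where f = "\<lambda>x. 2 * (norm (g x))\<^sup>2 + 2 * (t\<^sup>2 * (norm (h x))\<^sup>2)"])
    show "integrable lebesgue (\<lambda>x. 2 * (norm (g x))\<^sup>2 + 2 * (t\<^sup>2 * (norm (h x))\<^sup>2))"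
      using u v by (auto simp: L2grad_def)
    show "AE x in lebesgue. norm ((norm (g x + t *\<^sub>R h x))\<^sup>2) \<le> norm (2 * (norm (g x))\<^sup>2 + 2 * (t\<^sup>2 * (norm (h x))\<^sup>2))"
      using norm_add_sq_le[of "g _" "t *\<^sub>R h _"] by (auto simp: power_mult_distrib)
  qed measurable
  then show ?thesis using weak_grad_add_scaled u v by (auto simp: L2grad_def)
qed


lemma measurable_borel_fst [measurable]: "fst \<in> borel_measurable (borel :: ('k::euclidean_space \<times> 'm::euclidean_space) measure)"
  by (intro borel_measurable_continuous_onI continuous_intros)

text \<open>Here \<open>u\<close> and \<open>g\<close> are Borel representatives of the solution and its weak gradient, and the
  growth bound on \<open>f\<close> combines (F1) and (F2).\<close>

locale regular_solution =
  fixes V :: "('k::euclidean_space \<times> 'm::euclidean_space) \<Rightarrow> real" and f :: "real \<Rightarrow> real"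
    and u :: "'k \<times> 'm \<Rightarrow> real" and g :: "'k \<times> 'm \<Rightarrow> 'k \<times> 'm" and c0 C p :: real
  assumes K2: "DIM('k) \<ge> 2"
    and V_cont: "continuous_on UNIV V" and c0: "c0 > 0" and V_ge: "\<And>x. c0 \<le> V x"
    and f_cont: "continuous_on UNIV f" and C: "C > 0"
    and f_bound: "\<And>t. \<bar>f t\<bar> \<le> C * (\<bar>t\<bar> + \<bar>t\<bar> powr (p - 1))"
    and p: "2 < p" "p < 2 * real DIM('k \<times> 'm) / (real DIM('k \<times> 'm) - 2)"
    and u_meas[measurable]: "u \<in> borel_measurable borel" and u_nonneg: "\<And>x. u x \<ge> 0"
    and g_meas[measurable]: "g \<in> borel_measurable borel" and u_grad: "L2grad u g"
    and sol: "weak_solution V f u"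
begin

lemma DIM3: "DIM('k \<times> 'm) \<ge> 3"
  using K2 DIM_positive[where 'a = 'm] unfolding DIM_prod by linarith

lemma f_meas [measurable]: "f \<in> borel_measurable borel"
  using f_cont by (rule borel_measurable_continuous_onI)

lemma V_meas [measurable]: "V \<in> borel_measurable borel"
  using V_cont by (rule borel_measurable_continuous_onI)

lemma primF_meas [measurable]: "primF f \<in> borel_measurable borel"
  by (intro borel_measurable_continuous_onI)
     (auto simp: continuous_on_eq_continuous_at intro: DERIV_isCont primF_has_derivative[OF f_cont])

lemma u_sq: "integrable lborel (\<lambda>x. (u x)\<^sup>2)"
  using sol integral_lebesgue_eq_lborel(2)[of "\<lambda>x. (u x)\<^sup>2"] by (auto simp: weak_solution_def X1_def H1_def)

lemma g_sq: "integrable lborel (\<lambda>x. (norm (g x))\<^sup>2)"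
  using u_grad integral_lebesgue_eq_lborel(2)[of "\<lambda>x. (norm (g x))\<^sup>2"] by (auto simp: L2grad_def)

lemma u_weak_grad: "weak_grad u g"
  using u_grad by (simp add: L2grad_def)

lemma u_Lq: "2 < q \<Longrightarrow> q < 2 * real DIM('k \<times> 'm) / (real DIM('k \<times> 'm) - 2) \<Longrightarrow> integrable lborel (\<lambda>x. u x powr q)"
  by (rule L2grad_embedding[OF DIM3 u_meas g_meas u_sq u_grad u_nonneg])

lemma u_Lp: "integrable lborel (\<lambda>x. u x powr p)"
  using u_Lq p by blast

lemma u_loc: "set_integrable lborel (cball 0 r) u"
  using loc_integrable_of_square[OF u_meas u_sq] .

text \<open>The shift \<open>b\<close> will be a bound for a test function v, since
  \<open>u + t v\<close> is dominated by \<open>u + b\<close> for |t| < 1. All exponents up to p are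
  covered by the integrability of u^p.\<close>

lemma loc_powr: 
  assumes "0 \<le> a" "a \<le> p" "b \<ge> 0"
  shows "set_integrable lborel (cball 0 r) (\<lambda>x. (u x + b) powr a)"
  unfolding set_integrable_def
proof (rule Bochner_Integration.integrable_bound[where f = "\<lambda>x. (1 + 2 powr p * b powr p) * indicator (cball 0 r) x + 2 powr p * u x powr p"])
  show "integrable lborel (\<lambda>x. (1 + 2 powr p * b powr p) * indicator (cball 0 r) x + 2 powr p * u x powr p)"
    using u_Lp emeasure_lborel_cball_finite[of 0 r]
    by (intro Bochner_Integration.integrable_add integrable_mult_right integrable_real_indicator) auto
  show "AE x in lborel. norm (indicator (cball 0 r) x *\<^sub>R (u x + b) powr a)
     \<le> norm ((1 + 2 powr p * b powr p) * indicator (cball 0 r) x + 2 powr p * u x powr p)"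
  proof (rule AE_I2)
    fix x
    have "(u x + b) powr a \<le> 1 + (u x + b) powr p" using u_nonneg[of x] assms by (intro powr_le_one_plus) auto
    also have "\<dots> \<le> 1 + 2 powr p * (u x powr p + b powr p)"
      using u_nonneg[of x] assms p by (intro add_left_mono powr_add_le) auto
    finally show "norm (indicator (cball 0 r) x *\<^sub>R (u x + b) powr a)
     \<le> norm ((1 + 2 powr p * b powr p) * indicator (cball 0 r) x + 2 powr p * u x powr p)"
      by (auto simp: indicator_def algebra_simps)
  qed
qed measurable

lemma fu_loc: "set_integrable lborel (cball 0 r) (\<lambda>x. \<bar>f (u x)\<bar>)"
proof -
  have "integrable lborel (\<lambda>x. C * (indicator (cball 0 r) x *\<^sub>R u x + indicator (cball 0 r) x *\<^sub>R (u x + 0) powr (p - 1)))"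
    using u_loc[of r] loc_powr[of "p - 1" 0 r] p unfolding set_integrable_def
    by (intro integrable_mult_right Bochner_Integration.integrable_add) auto
  then show ?thesis unfolding set_integrable_def
  proof (rule Bochner_Integration.integrable_bound)
    show "AE x in lborel. norm (indicator (cball 0 r) x *\<^sub>R \<bar>f (u x)\<bar>)
       \<le> norm (C * (indicator (cball 0 r) x *\<^sub>R u x + indicator (cball 0 r) x *\<^sub>R (u x + 0) powr (p - 1)))"
      using f_bound[of "u _"] u_nonneg C by (auto simp: indicator_def)
  qed measurable
qed

text \<open>The distance from \<open>fst x = 0\<close> bounds the Hardy weight on the support. For
  \<open>DIM('k) = 2\<close> a test function that is nonzero at a singular point has infinite Hardy
  integral, so such a restriction cannot simply be dropped here.\<close>

lemma X1_test_fun: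
  assumes v: "test_fun v" and \<delta>: "\<delta> > 0" "\<And>x. v x \<noteq> 0 \<Longrightarrow> norm (fst x) \<ge> \<delta>"
  shows "X1 V v"
proof -
  have [measurable]: "v \<in> borel_measurable borel" using v by measurable
  have vc: "continuous_on UNIV v" using v smooth_fun_continuous by (auto simp: test_fun_def)
  obtain r where r: "\<And>x. v x \<noteq> 0 \<Longrightarrow> norm x < r" using test_fun_support[OF v] by blast
  have v2: "integrable lborel (\<lambda>x. (v x)\<^sup>2)"
    by (rule compact_support_integrable[of _ r]) (use vc r in \<open>auto intro!: continuous_intros\<close>)
  have Vv2: "integrable lborel (\<lambda>x. V x * (v x)\<^sup>2)"
    by (rule compact_support_integrable[of _ r]) (use vc r V_cont in \<open>auto intro!: continuous_intros\<close>)
  have "integrable lborel (\<lambda>x. (v x)\<^sup>2 / (norm (fst x))\<^sup>2)"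
  proof (rule Bochner_Integration.integrable_bound[where f = "\<lambda>x. (v x)\<^sup>2 / \<delta>\<^sup>2"])
    show "integrable lborel (\<lambda>x. (v x)\<^sup>2 / \<delta>\<^sup>2)" using v2 by simp
    show "AE x in lborel. norm ((v x)\<^sup>2 / (norm (fst x))\<^sup>2) \<le> norm ((v x)\<^sup>2 / \<delta>\<^sup>2)"
    proof (rule AE_I2)
      fix x
      show "norm ((v x)\<^sup>2 / (norm (fst x))\<^sup>2) \<le> norm ((v x)\<^sup>2 / \<delta>\<^sup>2)"
      proof (cases "v x = 0")
        case False
        have d: "\<delta> \<le> norm (fst x)" by (rule \<delta>(2)[OF False])
        then have "\<delta>\<^sup>2 \<le> (norm (fst x))\<^sup>2" using \<delta>(1) by (intro power_mono) auto
        moreover have "0 < (norm (fst x))\<^sup>2 * \<delta>\<^sup>2" using d \<delta>(1) by (intro mult_pos_pos zero_less_power) auto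
        ultimately have "(v x)\<^sup>2 / (norm (fst x))\<^sup>2 \<le> (v x)\<^sup>2 / \<delta>\<^sup>2" by (intro divide_left_mono) auto
        then show ?thesis by simp
      qed simp
    qed
  qed measurable
  then have "integrable lborel (\<lambda>x. (v x)\<^sup>2 / (norm (fst x))\<^sup>2 + V x * (v x)\<^sup>2)" using Vv2 by simp
  then have "integrable lebesgue (\<lambda>x. (v x)\<^sup>2 / (norm (fst x))\<^sup>2 + V x * (v x)\<^sup>2)"
    by (subst integral_lebesgue_eq_lborel) auto
  moreover have "integrable lebesgue (\<lambda>x. (v x)\<^sup>2)" using v2 by (subst integral_lebesgue_eq_lborel) auto
  ultimately show ?thesis using L2grad_test_fun[OF v]
    by (auto simp: X1_def H1_def intro!: measurable_completion)
qed

text \<open>Along u + t v the energy is a quadratic polynomial in t minus the integral of F, and the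
  linear coefficient is the weak form. Its derivative at 0 is computed directly and compared with
  the value 0 given by criticality.\<close>

theorem euler_lagrange:
  assumes v: "test_fun v" and \<delta>: "\<delta> > 0" "\<And>x. v x \<noteq> 0 \<Longrightarrow> norm (fst x) \<ge> \<delta>"
  shows "integrable lborel (\<lambda>x. g x \<bullet> pgrad v x + u x * v x / (norm (fst x))\<^sup>2 + V x * (u x * v x))"
    "integrable lborel (\<lambda>x. f (u x) * v x)"
    "(LINT x|lborel. g x \<bullet> pgrad v x + u x * v x / (norm (fst x))\<^sup>2 + V x * (u x * v x)) = (LINT x|lborel. f (u x) * v x)"
proof -
  have [measurable]: "v \<in> borel_measurable borel" using v by measurable
  have sv: "smooth_fun v" using v by (simp add: test_fun_def)
  have [measurable]: "pgrad v \<in> borel_measurable borel"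
    by (rule borel_measurable_continuous_onI[OF continuous_pgrad[OF sv]])
  have vc: "continuous_on UNIV v" using sv smooth_fun_continuous by blast
  obtain r where r: "r > 0" "\<And>x. v x \<noteq> 0 \<Longrightarrow> norm x < r" using test_fun_support[OF v] by blast
  obtain B where B: "B > 0" "\<And>x. \<bar>v x\<bar> \<le> B * indicator (cball 0 r) x"
    using compact_support_bounded[OF vc r(2)] by blast
  have B': "\<bar>v x\<bar> \<le> B" for x using B(1) B(2)[of x] by (cases "x \<in> cball 0 r") auto
  have Xv: "X1 V v" by (rule X1_test_fun[OF v \<delta>])
  have gv: "L2grad v (pgrad v)" by (rule L2grad_test_fun[OF v])
  have iuv: "integrable lborel (\<lambda>x. u x * v x)" by (rule lborel_loc_times_test[OF u_meas u_loc v])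
  have i1: "integrable lborel (\<lambda>x. g x \<bullet> pgrad v x)" by (rule lap_pairing[OF u_meas g_meas u_weak_grad v])
  have i2: "integrable lborel (\<lambda>x. u x * v x / (norm (fst x))\<^sup>2)"
  proof (rule Bochner_Integration.integrable_bound[where f = "\<lambda>x. u x * v x / \<delta>\<^sup>2"])
    show "integrable lborel (\<lambda>x. u x * v x / \<delta>\<^sup>2)" using iuv by simp
    show "AE x in lborel. norm (u x * v x / (norm (fst x))\<^sup>2) \<le> norm (u x * v x / \<delta>\<^sup>2)"
    proof (rule AE_I2)
      fix x
      show "norm (u x * v x / (norm (fst x))\<^sup>2) \<le> norm (u x * v x / \<delta>\<^sup>2)"
      proof (cases "v x = 0")
        case False
        have d: "\<delta> \<le> norm (fst x)" by (rule \<delta>(2)[OF False])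
        then have "\<delta>\<^sup>2 \<le> (norm (fst x))\<^sup>2" using \<delta>(1) by (intro power_mono) auto
        moreover have "0 < (norm (fst x))\<^sup>2 * \<delta>\<^sup>2" using d \<delta>(1) by (intro mult_pos_pos zero_less_power) auto
        ultimately have "\<bar>u x * v x\<bar> / (norm (fst x))\<^sup>2 \<le> \<bar>u x * v x\<bar> / \<delta>\<^sup>2" by (intro divide_left_mono) auto
        then show ?thesis by simp
      qed simp
    qed
  qed measurable
  have i3: "integrable lborel (\<lambda>x. V x * (u x * v x))"
  proof -
    have "continuous_on UNIV (\<lambda>x. V x * v x)" using V_cont vc by (intro continuous_intros)
    then obtain B1 where "B1 > 0" "\<And>x. \<bar>V x * v x\<bar> \<le> B1 * indicator (cball 0 r) x"
      using compact_support_bounded[of "\<lambda>x. V x * v x" r] r(2) by auto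
    then have "integrable lborel (\<lambda>x. u x * (V x * v x))"
      by (intro lborel_loc_times_bounded[OF _ _ u_loc, where B = B1 and r = r]) auto
    then show ?thesis by (simp add: mult_ac)
  qed
  let ?A1 = "\<lambda>x. g x \<bullet> pgrad v x + u x * v x / (norm (fst x))\<^sup>2 + V x * (u x * v x)"
  let ?A0 = "\<lambda>x. (norm (g x))\<^sup>2 + ((u x)\<^sup>2 / (norm (fst x))\<^sup>2 + V x * (u x)\<^sup>2)"
  let ?A2 = "\<lambda>x. (norm (pgrad v x))\<^sup>2 + ((v x)\<^sup>2 / (norm (fst x))\<^sup>2 + V x * (v x)\<^sup>2)"
  show A1: "integrable lborel ?A1" using i1 i2 i3 by simp
  have xi: "integrable lborel (\<lambda>x. (w x)\<^sup>2 / (norm (fst x))\<^sup>2 + V x * (w x)\<^sup>2)"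
    if "X1 V w" and [measurable]: "w \<in> borel_measurable borel" for w :: "'k \<times> 'm \<Rightarrow> real"
  proof -
    have "integrable lebesgue (\<lambda>x. (w x)\<^sup>2 / (norm (fst x))\<^sup>2 + V x * (w x)\<^sup>2)" using that by (simp add: X1_def)
    then show ?thesis by (subst (asm) integral_lebesgue_eq_lborel) auto
  qed
  have A0: "integrable lborel ?A0"
    by (rule Bochner_Integration.integrable_add[OF g_sq xi[OF _ u_meas]]) (use sol in \<open>auto simp: weak_solution_def\<close>)
  have A2: "integrable lborel ?A2"
  proof -
    have "integrable lebesgue (\<lambda>x. (norm (pgrad v x))\<^sup>2)" using gv by (simp add: L2grad_def)
    then have "integrable lborel (\<lambda>x. (norm (pgrad v x))\<^sup>2)" by (subst (asm) integral_lebesgue_eq_lborel) auto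
    from Bochner_Integration.integrable_add[OF this xi[OF Xv]] show ?thesis by simp
  qed
  let ?a0 = "LINT x|lborel. ?A0 x" and ?a1 = "LINT x|lborel. ?A1 x" and ?a2 = "LINT x|lborel. ?A2 x"
  \<comment> \<open>For each t the chosen gradient agrees almost everywhere with
    \<open>g x + t *\<^sub>R pgrad v x\<close> by uniqueness, after which the square
    expands.\<close>
  have quad: "(LINT x|lebesgue. (norm (wgrad (\<lambda>x. u x + t * v x) x))\<^sup>2 + (u x + t * v x)\<^sup>2 / (norm (fst x))\<^sup>2 + V x * (u x + t * v x)\<^sup>2)
      = ?a0 + 2 * t * ?a1 + t\<^sup>2 * ?a2" for t
  proof -
    have L: "L2grad (\<lambda>x. u x + t * v x) (\<lambda>x. g x + t *\<^sub>R pgrad v x)" by (rule L2grad_add_scaled[OF u_grad gv])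
    then have W: "L2grad (\<lambda>x. u x + t * v x) (wgrad (\<lambda>x. u x + t * v x))"
      unfolding wgrad_def by (rule someI[of "L2grad _"])
    have [measurable]: "wgrad (\<lambda>x. u x + t * v x) \<in> borel_measurable lebesgue" using W by (simp add: L2grad_def)
    have ae: "AE x in lebesgue. wgrad (\<lambda>x. u x + t * v x) x = g x + t *\<^sub>R pgrad v x"
      by (rule weak_grad_unique[OF DIM3 W L])
    have m: "(\<lambda>x. (norm (g x + t *\<^sub>R pgrad v x))\<^sup>2 + (u x + t * v x)\<^sup>2 / (norm (fst x))\<^sup>2 + V x * (u x + t * v x)\<^sup>2) \<in> borel_measurable borel"
      by measurable
    have m': "(\<lambda>x. (u x + t * v x)\<^sup>2 / (norm (fst x))\<^sup>2 + V x * (u x + t * v x)\<^sup>2) \<in> borel_measurable lebesgue"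
      by (rule measurable_completion) measurable
    have "(LINT x|lebesgue. (norm (wgrad (\<lambda>x. u x + t * v x) x))\<^sup>2 + (u x + t * v x)\<^sup>2 / (norm (fst x))\<^sup>2 + V x * (u x + t * v x)\<^sup>2)
      = (LINT x|lebesgue. (norm (g x + t *\<^sub>R pgrad v x))\<^sup>2 + (u x + t * v x)\<^sup>2 / (norm (fst x))\<^sup>2 + V x * (u x + t * v x)\<^sup>2)"
    proof (rule integral_cong_AE)
      show "(\<lambda>x. (norm (wgrad (\<lambda>x. u x + t * v x) x))\<^sup>2 + (u x + t * v x)\<^sup>2 / (norm (fst x))\<^sup>2 + V x * (u x + t * v x)\<^sup>2) \<in> borel_measurable lebesgue"
        using borel_measurable_add[OF _ m', of "\<lambda>x. (norm (wgrad (\<lambda>x. u x + t * v x) x))\<^sup>2"] by (simp add: add.assoc)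
      show "(\<lambda>x. (norm (g x + t *\<^sub>R pgrad v x))\<^sup>2 + (u x + t * v x)\<^sup>2 / (norm (fst x))\<^sup>2 + V x * (u x + t * v x)\<^sup>2) \<in> borel_measurable lebesgue"
        using m by (intro measurable_completion) simp
    qed (use ae in \<open>auto elim: eventually_mono\<close>)
    also have "\<dots> = (LINT x|lborel. (norm (g x + t *\<^sub>R pgrad v x))\<^sup>2 + (u x + t * v x)\<^sup>2 / (norm (fst x))\<^sup>2 + V x * (u x + t * v x)\<^sup>2)"
      by (rule integral_lebesgue_eq_lborel(1)[OF m])
    also have "\<dots> = (LINT x|lborel. ?A0 x + 2 * t * ?A1 x + t\<^sup>2 * ?A2 x)"
    proof (rule arg_cong[where f = "integral\<^sup>L lborel"], rule ext)
      fix x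
      have "(norm (g x + t *\<^sub>R pgrad v x))\<^sup>2 = (norm (g x))\<^sup>2 + 2 * t * (g x \<bullet> pgrad v x) + t\<^sup>2 * (norm (pgrad v x))\<^sup>2"
        by (simp only: power2_norm_eq_inner inner_add_left inner_add_right inner_scaleR_left inner_scaleR_right inner_commute[of "pgrad v x" "g x"])
           (simp add: power2_eq_square algebra_simps)
      then show "(norm (g x + t *\<^sub>R pgrad v x))\<^sup>2 + (u x + t * v x)\<^sup>2 / (norm (fst x))\<^sup>2 + V x * (u x + t * v x)\<^sup>2
        = ?A0 x + 2 * t * ?A1 x + t\<^sup>2 * ?A2 x"
        by (simp add: power2_sum power_mult_distrib add_divide_distrib algebra_simps)
    qed
    also have "\<dots> = ?a0 + 2 * t * ?a1 + t\<^sup>2 * ?a2"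
      using A0 A1 A2 by (simp only: Bochner_Integration.integral_add Bochner_Integration.integrable_add integrable_mult_right integral_mult_right_zero)
    finally show ?thesis .
  qed
  define b where "b t = (LINT x|lborel. primF f (u x + t * v x))" for t
  have en: "energy V f (\<lambda>x. u x + t * v x) = (1/2) * (?a0 + 2 * t * ?a1 + t\<^sup>2 * ?a2) - b t" for t
    unfolding energy_def quad b_def by (subst integral_lebesgue_eq_lborel(1)) auto
  have loc: "set_integrable lborel (cball 0 r) (\<lambda>x. C * ((u x + B) powr 1 + (u x + B) powr (p - 1)) * B)"
    using loc_powr[of 1 B r] loc_powr[of "p - 1" B r] B p by (intro set_integrable_mult_left set_integrable_mult_right set_integral_add) auto
  have db: "(b has_real_derivative (LINT x|lborel. f (u x + 0 * v x) * v x)) (at 0)"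
    unfolding b_def
  proof (rule has_real_derivative_integral_at_0[where w = "\<lambda>x. indicator (cball 0 r) x *\<^sub>R (C * ((u x + B) powr 1 + (u x + B) powr (p - 1)) * B)"])
    show "((\<lambda>t. primF f (u x + t * v x)) has_real_derivative f (u x + t * v x) * v x) (at t)" for x t
      by (rule DERIV_chain2[OF primF_has_derivative[OF f_cont]]) (auto intro!: derivative_eq_intros)
    show "\<bar>f (u x + t * v x) * v x\<bar> \<le> indicator (cball 0 r) x *\<^sub>R (C * ((u x + B) powr 1 + (u x + B) powr (p - 1)) * B)"
      if t: "\<bar>t\<bar> < 1" for x t
    proof (cases "x \<in> cball 0 r")
      case True
      have "\<bar>t * v x\<bar> \<le> 1 * B" unfolding abs_mult using t B' by (intro mult_mono) auto
      then have le: "\<bar>u x + t * v x\<bar> \<le> u x + B" using u_nonneg[of x] by linarith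
      have "\<bar>f (u x + t * v x)\<bar> \<le> C * (\<bar>u x + t * v x\<bar> + \<bar>u x + t * v x\<bar> powr (p - 1))" by (rule f_bound)
      also have "\<dots> \<le> C * ((u x + B) powr 1 + (u x + B) powr (p - 1))"
        using le C p u_nonneg[of x] B(1) by (intro mult_left_mono add_mono powr_mono2) auto
      finally have "\<bar>f (u x + t * v x)\<bar> * \<bar>v x\<bar> \<le> (C * ((u x + B) powr 1 + (u x + B) powr (p - 1))) * B"
        using B' C by (intro mult_mono) auto
      then show ?thesis using True by (simp add: abs_mult)
    next
      case False
      then have "v x = 0" using r(2)[of x] by auto
      then show ?thesis using False by simp
    qed
    show "integrable lborel (\<lambda>x. indicator (cball 0 r) x *\<^sub>R (C * ((u x + B) powr 1 + (u x + B) powr (p - 1)) * B))"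
      using loc unfolding set_integrable_def .
    \<comment> \<open>This is where u in L^2 and L^p over the whole space enters: the integral of
      F(u) is a genuine one.\<close>
    show "integrable lborel (\<lambda>x. primF f (u x + 0 * v x))"
    proof (rule Bochner_Integration.integrable_bound[where f = "\<lambda>x. C * ((u x)\<^sup>2 + u x powr p)"])
      show "integrable lborel (\<lambda>x. C * ((u x)\<^sup>2 + u x powr p))" using u_sq u_Lp by simp
      show "AE x in lborel. norm (primF f (u x + 0 * v x)) \<le> norm (C * ((u x)\<^sup>2 + u x powr p))"
        using primF_bound[OF f_cont f_bound p(1), of "u _"] C u_nonneg by auto
    qed measurable
  qed measurable
  show "integrable lborel (\<lambda>x. f (u x) * v x)"
  proof -
    have "set_integrable lborel (cball 0 r) (\<lambda>x. f (u x))" for r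
      using fu_loc[of r] unfolding set_integrable_def
      by (rule Bochner_Integration.integrable_bound) (auto simp: abs_mult)
    then show ?thesis by (intro lborel_loc_times_test[OF _ _ v]) auto
  qed
  have "((\<lambda>t. (1/2) * (?a0 + 2 * t * ?a1 + t\<^sup>2 * ?a2) - b t) has_real_derivative (?a1 - (LINT x|lborel. f (u x) * v x))) (at 0)"
    using db by (auto intro!: derivative_eq_intros)
  moreover have "((\<lambda>t. (1/2) * (?a0 + 2 * t * ?a1 + t\<^sup>2 * ?a2) - b t) has_real_derivative 0) (at 0)"
    using sol Xv unfolding weak_solution_def en[symmetric] by blast
  ultimately have "?a1 - (LINT x|lborel. f (u x) * v x) = 0" by (rule DERIV_unique)
  then show "?a1 = (LINT x|lborel. f (u x) * v x)" by simp
qed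

end


section \<open>Subsolution property and Riesz bound\<close>

lemma AE_fst_nonzero: "AE x in (lborel :: ('k::euclidean_space \<times> 'm::euclidean_space) measure). fst x \<noteq> 0"
proof -
  obtain b :: 'k where b: "b \<in> Basis" using nonempty_Basis by blast
  have "negligible {x :: 'k \<times> 'm. (b, 0) \<bullet> x = 0}"
    by (rule negligible_hyperplane) (use b in \<open>auto simp: nonzero_Basis zero_prod_def\<close>)
  then have "negligible {x :: 'k \<times> 'm. fst x = 0}"
    by (rule negligible_subset) (auto simp: inner_Pair_0)
  from AE_lborel_not_in_negligible[OF this] show ?thesis by simp
qed

context regular_solution
begin

text \<open>The cutoff factor removing the singular set \<open>fst x = 0\<close> costs an error
  \<open>k \<integral>\<^bsub>|fst x| \<le> 1/k\<^esub> |g|\<close>, which vanishes in the limit because that region has measure of order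
  \<open>k\<^sup>-\<^sup>2\<close> and \<open>g\<close> is square integrable.\<close>

lemma subsolution:
  assumes \<phi>a: "smooth_alg \<phi>" and \<phi>: "test_fun \<phi>" and \<phi>0: "\<And>x. \<phi> x \<ge> 0"
  shows "c0 * (LINT x|lborel. u x * \<phi> x) - (LINT x|lborel. u x * lap \<phi> x) \<le> (LINT x|lborel. \<bar>f (u x)\<bar> * \<phi> x)"
proof -
  obtain c1 c2 M where cd: "\<And>s. (cutoff has_real_derivative c1 s) (at s)"
    "\<And>s. s > 1 \<Longrightarrow> c1 s = 0" "\<And>s. \<bar>c1 s\<bar> \<le> M" "M > 0"
    using cutoff_derivatives by metis
  have [measurable]: "\<phi> \<in> borel_measurable borel" using \<phi> by measurable
  have s\<phi>: "smooth_fun \<phi>" using \<phi> by (simp add: test_fun_def)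
  have [measurable]: "pgrad \<phi> \<in> borel_measurable borel"
    by (rule borel_measurable_continuous_onI[OF continuous_pgrad[OF s\<phi>]])
  obtain B r where B: "B > 0" "r > 0" "\<And>x. \<bar>\<phi> x\<bar> \<le> B * indicator (cball 0 r) x"
    using test_fun_bounded[OF \<phi>] by metis
  \<comment> \<open>Scaling the singular component makes \<zeta> equal to 1 for |fst x| \<le>
    1/(2(k+1)) and 0 for |fst x| \<ge> 1/(k+1).\<close>
  define L where "L k x = (real (Suc k)) *\<^sub>R fst x" for k and x :: "'k \<times> 'm"
  have bl: "bounded_linear (L k)" for k unfolding L_def
    by (intro bounded_linear_compose[OF bounded_linear_scaleR_right bounded_linear_fst])
  have normL: "norm (L k x) = (1 + real k) * norm (fst x)" for k x
    unfolding L_def norm_scaleR by simp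
  define \<zeta> where "\<zeta> k x = cutoff ((norm (L k x))\<^sup>2)" for k x
  have \<zeta>a: "smooth_alg (\<zeta> k)" for k
    using smooth_alg_cutoff[OF smooth_alg_norm_sq[OF bl, of k 0]] by (simp add: \<zeta>_def[abs_def])
  have \<zeta>01: "0 \<le> \<zeta> k x" "\<zeta> k x \<le> 1" for k x by (auto simp: \<zeta>_def cutoff_nonneg cutoff_le_1)
  have [measurable]: "\<zeta> k \<in> borel_measurable borel" for k
    by (rule borel_measurable_continuous_onI[OF smooth_alg_continuous[OF \<zeta>a]])
  have s\<zeta>: "smooth_fun (\<zeta> k)" for k by (rule smooth_alg_imp_smooth_fun[OF \<zeta>a])
  have [measurable]: "pgrad (\<zeta> k) \<in> borel_measurable borel" for k
    by (rule borel_measurable_continuous_onI[OF continuous_pgrad[OF s\<zeta>]])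
  define P where "P k = cball (0::'k) (1 / real (Suc k)) \<times> cball (0::'m) r" for k
  have [measurable]: "P k \<in> sets borel" for k unfolding P_def by (intro borel_closed closed_Times) auto
  have g\<zeta>: "norm (pgrad (\<zeta> k) x) \<le> 2 * M * real (Suc k)" "norm (L k x) > 1 \<Longrightarrow> pgrad (\<zeta> k) x = 0" for k x
  proof -
    let ?s = "(norm (L k x))\<^sup>2"
    have "(L k has_derivative L k) (at x)" by (rule bounded_linear_imp_has_derivative[OF bl])
    moreover have "((\<lambda>y. (norm (y - 0))\<^sup>2) has_derivative (\<lambda>v. 2 * ((L k x - 0) \<bullet> v))) (at (L k x))"
      by (rule has_derivative_norm_sq_shift)
    ultimately have "((\<lambda>x. (norm (L k x))\<^sup>2) has_derivative (\<lambda>v. 2 * (L k x \<bullet> L k v))) (at x)"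
      using has_derivative_compose[of "L k" "L k" x UNIV "\<lambda>y. (norm (y - 0))\<^sup>2"] by simp
    moreover have "(cutoff has_derivative (\<lambda>v. c1 ?s * v)) (at ?s)"
      using cd(1) by (simp add: has_field_derivative_def)
    ultimately have D: "(\<zeta> k has_derivative (\<lambda>v. c1 ?s * (2 * (L k x \<bullet> L k v)))) (at x)"
      unfolding \<zeta>_def[abs_def] by (rule has_derivative_compose)
    have e: "pgrad (\<zeta> k) x \<bullet> v = c1 ?s * (2 * (L k x \<bullet> L k v))" for v
      using has_derivative_eq_pgrad[OF D] by simp
    have z: "c1 ?s = 0" if "norm (L k x) > 1" using that cd(2)[of ?s] by (simp add: one_less_power)
    show "pgrad (\<zeta> k) x = 0" if "norm (L k x) > 1"
      using e[of "pgrad (\<zeta> k) x"] z[OF that] by simp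
    show "norm (pgrad (\<zeta> k) x) \<le> 2 * M * real (Suc k)"
    proof (cases "norm (L k x) > 1")
      case True
      then show ?thesis using e[of "pgrad (\<zeta> k) x"] z cd(4) by simp
    next
      case False
      \<comment> \<open>Evaluating the derivative at the gradient itself bounds its squared norm by
        a constant times its norm.\<close>
      let ?p = "pgrad (\<zeta> k) x"
      have "norm (L k ?p) \<le> real (Suc k) * norm ?p"
        unfolding L_def using norm_fst_le[of "fst ?p" "snd ?p"] by (simp add: mult_left_mono)
      then have "\<bar>L k x \<bullet> L k ?p\<bar> \<le> 1 * (real (Suc k) * norm ?p)"
        using False by (intro order_trans[OF Cauchy_Schwarz_ineq2] mult_mono) auto
      then have "\<bar>c1 ?s\<bar> * (2 * \<bar>L k x \<bullet> L k ?p\<bar>) \<le> M * (2 * (real (Suc k) * norm ?p))"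
        using cd(3,4) by (intro mult_mono) auto
      moreover have "norm ?p * norm ?p = c1 ?s * (2 * (L k x \<bullet> L k ?p))"
        using e[of ?p] by (simp flip: power2_norm_eq_inner power2_eq_square)
      moreover have "c1 ?s * (2 * (L k x \<bullet> L k ?p)) \<le> \<bar>c1 ?s\<bar> * (2 * \<bar>L k x \<bullet> L k ?p\<bar>)"
        by (metis abs_ge_self abs_mult abs_numeral)
      moreover have "M * (2 * (real (Suc k) * norm ?p)) = (2 * M * real (Suc k)) * norm ?p" by simp
      ultimately have "norm ?p * norm ?p \<le> (2 * M * real (Suc k)) * norm ?p" by linarith
      then show ?thesis using cd(4) by (cases "norm ?p = 0") (auto simp: mult_le_cancel_right)
    qed
  qed
  define v where "v k x = \<phi> x * (1 - \<zeta> k x)" for k x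
  have va: "smooth_alg (v k)" for k
    unfolding v_def[abs_def] by (intro smooth_alg.mult \<phi>a smooth_alg_diff smooth_alg.const \<zeta>a)
  have vt: "test_fun (v k)" for k
  proof (rule test_funI[OF va, of _ 0 r])
    fix x assume "v k x \<noteq> 0"
    then have "\<phi> x \<noteq> 0" by (simp add: v_def)
    then show "x \<in> cball 0 r" using B(3)[of x] by (cases "x \<in> cball 0 r") auto
  qed
  have v0: "v k x \<ge> 0" "v k x \<le> \<phi> x" for k x
    using \<phi>0[of x] \<zeta>01[of k x] by (auto simp: v_def mult_left_le)
  have vd: "norm (fst x) \<ge> 1 / (2 * real (Suc k))" if "v k x \<noteq> 0" for k x
  proof (rule ccontr)
    assume "\<not> ?thesis"
    then have "norm (L k x) < 1/2" by (simp add: normL field_simps)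
    then have "(norm (L k x))\<^sup>2 \<le> (1/2)\<^sup>2" by (intro power_mono) auto
    then have "\<zeta> k x = 1" by (simp add: \<zeta>_def cutoff_eq_1 power2_eq_square)
    then show False using that by (simp add: v_def)
  qed
  have pv: "pgrad (v k) x = (1 - \<zeta> k x) *\<^sub>R pgrad \<phi> x - \<phi> x *\<^sub>R pgrad (\<zeta> k) x" for k x
  proof -
    have D: "(v k has_derivative (\<lambda>h. \<phi> x * (0 - frechet_derivative (\<zeta> k) (at x) h) + frechet_derivative \<phi> (at x) h * (1 - \<zeta> k x))) (at x)"
      unfolding v_def[abs_def]
      by (intro has_derivative_mult has_derivative_diff has_derivative_const smooth_fun_has_derivative s\<phi> s\<zeta>)
    have a: "frechet_derivative (\<zeta> k) (at x) h = pgrad (\<zeta> k) x \<bullet> h" "frechet_derivative \<phi> (at x) h = pgrad \<phi> x \<bullet> h" for h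
      by (intro has_derivative_eq_pgrad smooth_fun_has_derivative s\<phi> s\<zeta>)+
    have "pgrad (v k) x \<bullet> h = ((1 - \<zeta> k x) *\<^sub>R pgrad \<phi> x - \<phi> x *\<^sub>R pgrad (\<zeta> k) x) \<bullet> h" for h
      using has_derivative_eq_pgrad[OF D, of h] by (simp add: a inner_diff_left algebra_simps)
    then show ?thesis by (meson vector_eq_rdot)
  qed
  \<comment> \<open>The limit integrand, with V already lowered to c0. It is multiplied by 1 -
    \<zeta> until the cutoff is removed.\<close>
  define Q where "Q x = g x \<bullet> pgrad \<phi> x + c0 * (u x * \<phi> x)" for x
  have iu\<phi>: "integrable lborel (\<lambda>x. u x * \<phi> x)" by (rule lborel_loc_times_test[OF u_meas u_loc \<phi>])
  note LP = lap_pairing[OF u_meas g_meas u_weak_grad \<phi>]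
  have Qi: "integrable lborel Q" unfolding Q_def using LP iu\<phi> by simp
  have [measurable]: "Q \<in> borel_measurable borel" using Qi by (simp add: integrable_iff_bounded)
  have Qk: "integrable lborel (\<lambda>x. (1 - \<zeta> k x) * Q x)" for k
    by (rule Bochner_Integration.integrable_bound[OF Qi])
       (use \<zeta>01 in \<open>auto simp: abs_mult intro!: mult_left_le_one_le\<close>)
  have if\<phi>: "integrable lborel (\<lambda>x. \<bar>f (u x)\<bar> * \<phi> x)" by (rule lborel_loc_times_test[OF _ fu_loc \<phi>]) measurable
  \<comment> \<open>The inequality 2 a b \<le> a^2/\<eta> + \<eta> b^2 separates |g|, whose square
    has vanishing integral over \<open>P k\<close>, from the cutoff gradient, whose square stays
    bounded in integral.\<close>
  have err_bound: "\<bar>\<phi> x * (g x \<bullet> pgrad (\<zeta> k) x)\<bar> \<le> B * M * ((1/\<eta>) * (indicator (P k) x * (norm (g x))\<^sup>2) + \<eta> * ((real (Suc k))\<^sup>2 * indicator (P k) x))"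
    if \<eta>: "\<eta> > 0" for \<eta> k x
  proof (cases "x \<in> P k")
    case True
    have \<phi>B: "\<bar>\<phi> x\<bar> \<le> B" using B(1) B(3)[of x] by (cases "x \<in> cball 0 r") auto
    have "\<bar>g x \<bullet> pgrad (\<zeta> k) x\<bar> \<le> norm (g x) * norm (pgrad (\<zeta> k) x)" by (rule Cauchy_Schwarz_ineq2)
    also have "\<dots> \<le> norm (g x) * (2 * M * real (Suc k))" by (intro mult_left_mono g\<zeta>) auto
    also have "\<dots> = M * (2 * norm (g x) * real (Suc k))" by simp
    also have "2 * norm (g x) * real (Suc k) \<le> (1/\<eta>) * (norm (g x))\<^sup>2 + \<eta> * (real (Suc k))\<^sup>2"
    proof -
      have "0 \<le> (norm (g x) - \<eta> * real (Suc k))\<^sup>2 / \<eta>" using \<eta> by simp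
      also have "\<dots> = (1/\<eta>) * (norm (g x))\<^sup>2 + \<eta> * (real (Suc k))\<^sup>2 - 2 * norm (g x) * real (Suc k)"
        using \<eta> by (simp only: power2_diff) (simp add: field_simps power2_eq_square)
      finally show ?thesis by simp
    qed
    finally have "\<bar>g x \<bullet> pgrad (\<zeta> k) x\<bar> \<le> M * ((1/\<eta>) * (norm (g x))\<^sup>2 + \<eta> * (real (Suc k))\<^sup>2)"
      using cd(4) by simp
    then have "\<bar>\<phi> x\<bar> * \<bar>g x \<bullet> pgrad (\<zeta> k) x\<bar> \<le> B * (M * ((1/\<eta>) * (norm (g x))\<^sup>2 + \<eta> * (real (Suc k))\<^sup>2))"
      using \<phi>B B(1) by (intro mult_mono) auto
    then show ?thesis using True by (simp add: abs_mult mult.assoc)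
  next
    case False
    have "\<phi> x = 0 \<or> pgrad (\<zeta> k) x = 0"
    proof (rule ccontr)
      assume n: "\<not> ?thesis"
      then have "norm (L k x) \<le> 1" using g\<zeta>(2)[of k x] by linarith
      then have "norm (fst x) \<le> 1 / real (Suc k)" by (simp add: normL field_simps)
      moreover have "x \<in> cball 0 r" using n B(3)[of x] by (cases "x \<in> cball 0 r") auto
      then have "norm (snd x) \<le> r" using norm_snd_le[of "snd x" "fst x"] by simp
      ultimately show False using False by (simp add: P_def mem_Times_iff)
    qed
    then show ?thesis using False by auto
  qed
  \<comment> \<open>The Euler-Lagrange equation for \<open>v k\<close>. The Hardy term and (V - c0)
    u v are nonnegative and are dropped, while f is replaced by its modulus.\<close>
  have step: "(LINT x|lborel. (1 - \<zeta> k x) * Q x) - (LINT x|lborel. \<bar>\<phi> x * (g x \<bullet> pgrad (\<zeta> k) x)\<bar>) \<le> (LINT x|lborel. \<bar>f (u x)\<bar> * \<phi> x)"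
    and erri: "integrable lborel (\<lambda>x. \<phi> x * (g x \<bullet> pgrad (\<zeta> k) x))" for k
  proof -
    have \<delta>: "1 / (2 * real (Suc k)) > 0" by simp
    note EL = euler_lagrange[OF vt \<delta> vd]
    show e: "integrable lborel (\<lambda>x. \<phi> x * (g x \<bullet> pgrad (\<zeta> k) x))"
    proof -
      have "integrable lborel (\<lambda>x. (1 - \<zeta> k x) * (g x \<bullet> pgrad \<phi> x))"
        by (rule Bochner_Integration.integrable_bound[OF LP(2)])
           (use \<zeta>01 in \<open>auto simp: abs_mult intro!: mult_left_le_one_le\<close>)
      from Bochner_Integration.integrable_diff[OF this lap_pairing(2)[OF u_meas g_meas u_weak_grad vt, of k]]
      show ?thesis by (simp add: pv inner_diff_right)
    qed
    have "(LINT x|lborel. (1 - \<zeta> k x) * Q x) - (LINT x|lborel. \<bar>\<phi> x * (g x \<bullet> pgrad (\<zeta> k) x)\<bar>)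
      = (LINT x|lborel. (1 - \<zeta> k x) * Q x - \<bar>\<phi> x * (g x \<bullet> pgrad (\<zeta> k) x)\<bar>)"
      using Qk e by simp
    also have "\<dots> \<le> (LINT x|lborel. g x \<bullet> pgrad (v k) x + u x * v k x / (norm (fst x))\<^sup>2 + V x * (u x * v k x))"
    proof (rule integral_mono)
      show "integrable lborel (\<lambda>x. (1 - \<zeta> k x) * Q x - \<bar>\<phi> x * (g x \<bullet> pgrad (\<zeta> k) x)\<bar>)" using Qk e by simp
      fix x
      have "(1 - \<zeta> k x) * Q x = (g x \<bullet> pgrad (v k) x + \<phi> x * (g x \<bullet> pgrad (\<zeta> k) x)) + c0 * (u x * v k x)"
        by (simp add: Q_def pv v_def inner_diff_right algebra_simps)
      moreover have "c0 * (u x * v k x) \<le> V x * (u x * v k x)"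
        using V_ge[of x] u_nonneg[of x] v0[of k x] by (intro mult_right_mono) auto
      moreover have "0 \<le> u x * v k x / (norm (fst x))\<^sup>2" using u_nonneg[of x] v0[of k x] by simp
      ultimately show "(1 - \<zeta> k x) * Q x - \<bar>\<phi> x * (g x \<bullet> pgrad (\<zeta> k) x)\<bar>
          \<le> g x \<bullet> pgrad (v k) x + u x * v k x / (norm (fst x))\<^sup>2 + V x * (u x * v k x)" by linarith
    qed (rule EL(1))
    also have "\<dots> = (LINT x|lborel. f (u x) * v k x)" by (rule EL(3))
    also have "\<dots> \<le> (LINT x|lborel. \<bar>f (u x)\<bar> * \<phi> x)"
    proof (rule integral_mono[OF EL(2) if\<phi>])
      fix x
      have "f (u x) * v k x \<le> \<bar>f (u x)\<bar> * v k x" using v0[of k x] by (intro mult_right_mono) auto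
      also have "\<dots> \<le> \<bar>f (u x)\<bar> * \<phi> x" using v0[of k x] by (intro mult_left_mono) auto
      finally show "f (u x) * v k x \<le> \<bar>f (u x)\<bar> * \<phi> x" .
    qed
    finally show "(LINT x|lborel. (1 - \<zeta> k x) * Q x) - (LINT x|lborel. \<bar>\<phi> x * (g x \<bullet> pgrad (\<zeta> k) x)\<bar>) \<le> (LINT x|lborel. \<bar>f (u x)\<bar> * \<phi> x)" .
  qed
  define C0 where "C0 = unit_ball_vol (real DIM('k)) * (unit_ball_vol (real DIM('m)) * r ^ DIM('m))"
  have C0: "C0 \<ge> 0" using B(2) by (simp add: C0_def)
  have emP: "emeasure lborel (P k) = ennreal (C0 * (1 / real (Suc k)) ^ DIM('k))" for k
  proof -
    have "emeasure lborel (P k) = emeasure (lborel \<Otimes>\<^sub>M lborel) (cball (0::'k) (1 / real (Suc k)) \<times> cball (0::'m) r)"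
      by (simp add: P_def lborel_prod)
    also have "\<dots> = emeasure lborel (cball (0::'k) (1 / real (Suc k))) * emeasure lborel (cball (0::'m) r)"
      by (rule lborel.emeasure_pair_measure_Times) auto
    also have "\<dots> = ennreal (C0 * (1 / real (Suc k)) ^ DIM('k))"
      using B(2) by (simp add: emeasure_cball C0_def mult_ac flip: ennreal_mult)
    finally show ?thesis .
  qed
  have iP: "integrable lborel (indicat_real (P k))" for k
    by (rule integrable_real_indicator) (simp_all add: emP)
  \<comment> \<open>Codimension at least two enters here: the volume of \<open>P k\<close> is at
    most of order (k + 1)^(-2), which balances the squared gradient of the cutoff.\<close>
  have mP: "(real (Suc k))\<^sup>2 * measure lborel (P k) \<le> C0" for k
  proof -
    have "(1 / real (Suc k)) ^ DIM('k) \<le> (1 / real (Suc k)) ^ 2" using K2 by (intro power_decreasing) auto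
    then have "C0 * (1 / real (Suc k)) ^ DIM('k) \<le> C0 * (1 / real (Suc k))\<^sup>2" using C0 by (intro mult_left_mono) auto
    moreover have "measure lborel (P k) = C0 * (1 / real (Suc k)) ^ DIM('k)"
      using C0 by (simp add: measure_def emP)
    ultimately have "(real (Suc k))\<^sup>2 * measure lborel (P k) \<le> (real (Suc k))\<^sup>2 * (C0 * (1 / real (Suc k))\<^sup>2)"
      by (intro mult_left_mono) auto
    also have "\<dots> = C0" by (simp add: power_divide)
    finally show ?thesis .
  qed
  have igP: "integrable lborel (\<lambda>x. indicator (P k) x * (norm (g x))\<^sup>2)" for k
    by (rule Bochner_Integration.integrable_bound[OF g_sq]) (auto simp: indicator_def)
  have gP: "(\<lambda>k. LINT x|lborel. indicator (P k) x * (norm (g x))\<^sup>2) \<longlonglongrightarrow> (LINT x|lborel. 0 * (norm (g x))\<^sup>2)"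
    and QQ: "(\<lambda>k. LINT x|lborel. (1 - \<zeta> k x) * Q x) \<longlonglongrightarrow> (LINT x|lborel. (1 - 0) * Q x)"
  proof -
    have far: "\<forall>\<^sub>F k in sequentially. norm (fst x) > 1 / real (Suc k)" if "fst x \<noteq> 0" for x :: "'k \<times> 'm"
    proof -
      have "(\<lambda>k. 1 / real (Suc k)) \<longlonglongrightarrow> 0" using LIMSEQ_inverse_real_of_nat by (simp add: inverse_eq_divide)
      moreover have "norm (fst x) > 0" using that by simp
      ultimately show ?thesis by (rule order_tendstoD(2))
    qed
    show "(\<lambda>k. LINT x|lborel. indicator (P k) x * (norm (g x))\<^sup>2) \<longlonglongrightarrow> (LINT x|lborel. 0 * (norm (g x))\<^sup>2)"
    proof (rule integral_dominated_convergence[where w = "\<lambda>x. (norm (g x))\<^sup>2"])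
      show "AE x in lborel. (\<lambda>k. indicator (P k) x * (norm (g x))\<^sup>2) \<longlonglongrightarrow> 0 * (norm (g x))\<^sup>2"
        using AE_fst_nonzero
      proof eventually_elim
        case (elim x)
        show ?case
          by (rule tendsto_eventually, rule eventually_mono[OF far[OF elim]]) (auto simp: P_def indicator_def)
      qed
    qed (use g_sq in \<open>auto simp: indicator_def\<close>)
    show "(\<lambda>k. LINT x|lborel. (1 - \<zeta> k x) * Q x) \<longlonglongrightarrow> (LINT x|lborel. (1 - 0) * Q x)"
    proof (rule integral_dominated_convergence[where w = "\<lambda>x. \<bar>Q x\<bar>"])
      show "AE x in lborel. (\<lambda>k. (1 - \<zeta> k x) * Q x) \<longlonglongrightarrow> (1 - 0) * Q x"
        using AE_fst_nonzero
      proof eventually_elim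
        case (elim x)
        have "\<zeta> k x = 0" if "norm (fst x) > 1 / real (Suc k)" for k
        proof -
          have "norm (L k x) \<ge> 1" using that by (simp add: normL field_simps)
          then show ?thesis by (simp add: \<zeta>_def cutoff_eq_0)
        qed
        then show ?case
          by (intro tendsto_eventually eventually_mono[OF far[OF elim]]) simp
      qed
      show "AE x in lborel. norm ((1 - \<zeta> k x) * Q x) \<le> \<bar>Q x\<bar>" for k
        using \<zeta>01 by (auto simp: abs_mult intro!: mult_left_le_one_le)
    qed (use Qi in auto)
  qed
  \<comment> \<open>The limit k \<rightarrow> \<infinity> is taken with \<eta> fixed; the remaining
    error is proportional to \<eta>, which is arbitrary.\<close>
  have lim: "(LINT x|lborel. Q x) \<le> (LINT x|lborel. \<bar>f (u x)\<bar> * \<phi> x) + B * M * C0 * \<eta>" if \<eta>: "\<eta> > 0" for \<eta>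
  proof (rule LIMSEQ_le)
    show "(\<lambda>k. LINT x|lborel. (1 - \<zeta> k x) * Q x) \<longlonglongrightarrow> (LINT x|lborel. Q x)" using QQ by simp
    have "(\<lambda>k. (LINT x|lborel. \<bar>f (u x)\<bar> * \<phi> x) + B * M * ((1/\<eta>) * (LINT x|lborel. indicator (P k) x * (norm (g x))\<^sup>2) + \<eta> * C0))
      \<longlonglongrightarrow> (LINT x|lborel. \<bar>f (u x)\<bar> * \<phi> x) + B * M * ((1/\<eta>) * (LINT x|lborel. 0 * (norm (g x))\<^sup>2) + \<eta> * C0)"
      by (intro tendsto_intros gP)
    then show "(\<lambda>k. (LINT x|lborel. \<bar>f (u x)\<bar> * \<phi> x) + B * M * ((1/\<eta>) * (LINT x|lborel. indicator (P k) x * (norm (g x))\<^sup>2) + \<eta> * C0))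
      \<longlonglongrightarrow> (LINT x|lborel. \<bar>f (u x)\<bar> * \<phi> x) + B * M * C0 * \<eta>" by (simp add: mult_ac)
    have "(LINT x|lborel. (1 - \<zeta> k x) * Q x) \<le> (LINT x|lborel. \<bar>f (u x)\<bar> * \<phi> x) + B * M * ((1/\<eta>) * (LINT x|lborel. indicator (P k) x * (norm (g x))\<^sup>2) + \<eta> * C0)" for k
    proof -
      have "(LINT x|lborel. \<bar>\<phi> x * (g x \<bullet> pgrad (\<zeta> k) x)\<bar>)
        \<le> (LINT x|lborel. B * M * ((1/\<eta>) * (indicator (P k) x * (norm (g x))\<^sup>2) + \<eta> * ((real (Suc k))\<^sup>2 * indicator (P k) x)))"
        using erri[of k] igP[of k] iP[of k] err_bound[OF \<eta>] by (intro integral_mono) auto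
      also have "\<dots> = B * M * ((1/\<eta>) * (LINT x|lborel. indicator (P k) x * (norm (g x))\<^sup>2) + \<eta> * ((real (Suc k))\<^sup>2 * measure lborel (P k)))"
        using igP[of k] iP[of k] by simp
      also have "\<dots> \<le> B * M * ((1/\<eta>) * (LINT x|lborel. indicator (P k) x * (norm (g x))\<^sup>2) + \<eta> * C0)"
        using \<eta> mP[of k] B(1) cd(4) by (intro mult_left_mono add_left_mono) auto
      finally show ?thesis using step[of k] by linarith
    qed
    then show "\<exists>N. \<forall>k\<ge>N. (LINT x|lborel. (1 - \<zeta> k x) * Q x) \<le> (LINT x|lborel. \<bar>f (u x)\<bar> * \<phi> x) + B * M * ((1/\<eta>) * (LINT x|lborel. indicator (P k) x * (norm (g x))\<^sup>2) + \<eta> * C0)"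
      by blast
  qed
  have "(LINT x|lborel. Q x) \<le> (LINT x|lborel. \<bar>f (u x)\<bar> * \<phi> x)"
  proof (rule field_le_epsilon)
    fix e :: real assume e: "e > 0"
    define D where "D = B * M * C0 + 1"
    have D: "D > 0" "B * M * C0 \<le> D" using B(1) cd(4) C0 by (auto simp: D_def add_nonneg_pos)
    have "B * M * C0 * (e / D) \<le> D * (e / D)" using D e by (intro mult_right_mono) auto
    then have "B * M * C0 * (e / D) \<le> e" using D by simp
    moreover have "e / D > 0" using D e by simp
    ultimately show "(LINT x|lborel. Q x) \<le> (LINT x|lborel. \<bar>f (u x)\<bar> * \<phi> x) + e" using lim[of "e / D"] by linarith
  qed
  moreover have "(LINT x|lborel. Q x) = (LINT x|lborel. g x \<bullet> pgrad \<phi> x) + c0 * (LINT x|lborel. u x * \<phi> x)"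
    unfolding Q_def using LP iu\<phi> by simp
  ultimately show ?thesis using LP(3) by simp
qed

text \<open>The subsolution inequality is tested with \<open>newt\<close>. The c0 term has a
  favourable sign, and the Laplacian of the kernel returns the mollified u up to a bounded error.
  Division by the mass of the bubble yields A.\<close>

lemma u_riesz_bound:
  obtains A where "A > 0"
    "AE x in lborel. ennreal (u x) \<le> riesz (real DIM('k \<times> 'm) - 2) (\<lambda>y. A * (u y + u y powr (p - 1))) x"
proof -
  let ?n = "real DIM('k \<times> 'm)"
  let ?c = "LINT z|lborel. bubble 1 (z::'k \<times> 'm)"
  have cpos: "?c > 0" by (rule bubble_mass_pos[OF DIM3])
  obtain M where M: "M > 0"
    "\<And>\<rho> a (y::'k \<times> 'm). \<rho> > 0 \<Longrightarrow> \<bar>lap (\<lambda>y. newt \<rho> (y - a)) y + moll \<rho> (y - a)\<bar> \<le> M * indicator (cball a 1) y"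
    by (rule newt_kernel_bounds[OF DIM3]) blast
  define h where "h y = (M + C) * (u y + u y powr (p - 1))" for y
  have [measurable]: "h \<in> borel_measurable borel" unfolding h_def[abs_def] by measurable
  have h0: "h y \<ge> 0" for y using M C u_nonneg[of y] by (simp add: h_def)
  have hl: "set_integrable lborel (cball 0 r) h" for r
    using u_loc[of r] loc_powr[of "p - 1" 0 r] p unfolding h_def
    by (intro set_integrable_mult_right set_integral_add) auto
  have "AE x in lborel. ennreal (?c * u x) \<le> riesz (?n - 2) h x"
  proof (rule riesz_bound[OF DIM3 _ _ u_meas _ u_loc hl h0])
    fix \<rho> :: real and x :: "'k \<times> 'm" assume \<rho>: "\<rho> > 0"
    define k where "k = (\<lambda>y. newt \<rho> (y - x))"
    have ka: "smooth_alg k" and tk: "test_fun k" unfolding k_def using smooth_alg_newt[OF \<rho>] test_fun_newt[OF \<rho>] by auto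
    have k0: "k y \<ge> 0" for y by (simp add: k_def newt_nonneg)
    have i: "integrable lborel (\<lambda>y. u y * moll \<rho> (y - x))"
      by (rule lborel_loc_times_test[OF u_meas u_loc test_fun_moll[OF \<rho>]])
    have ik: "integrable lborel (\<lambda>y. \<bar>f (u y)\<bar> * k y)" by (rule lborel_loc_times_test[OF _ fu_loc tk]) measurable
    note P = lap_pairing[OF u_meas g_meas u_weak_grad tk]
    have "c0 * (LINT y|lborel. u y * k y) \<ge> 0"
      using c0 k0 u_nonneg by (intro mult_nonneg_nonneg integral_nonneg_AE) auto
    then have "- (LINT y|lborel. u y * lap k y) \<le> (LINT y|lborel. \<bar>f (u y)\<bar> * k y)"
      using subsolution[OF ka tk k0] by linarith
    then have "(LINT y|lborel. u y * moll \<rho> (y - x)) \<le> (LINT y|lborel. u y * (lap k y + moll \<rho> (y - x)) + \<bar>f (u y)\<bar> * k y)"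
      using P(1) i ik by (simp add: distrib_left)
    then have "ennreal (LINT y|lborel. u y * moll \<rho> (y - x)) \<le> ennreal (LINT y|lborel. u y * (lap k y + moll \<rho> (y - x)) + \<bar>f (u y)\<bar> * k y)"
      by (rule ennreal_leI)
    also have "\<dots> \<le> riesz (?n - 2) h x"
    proof (rule integral_le_riesz)
      fix y :: "'k \<times> 'm" assume y: "y \<noteq> x"
      have c: "indicator (cball x 1) y = (indicator (cball 0 1) (y - x) :: real)"
        by (simp add: indicator_def dist_norm norm_minus_commute)
      have n2: "?n - 2 \<ge> 0" using DIM3 by linarith
      have A: "lap k y + moll \<rho> (y - x) \<le> M * rkern (?n - 2) (y - x)"
      proof -
        have "lap k y + moll \<rho> (y - x) \<le> M * indicator (cball 0 1) (y - x)"
          using M(2)[OF \<rho>, of x y] unfolding k_def c by linarith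
        also have "\<dots> \<le> M * rkern (?n - 2) (y - x)"
          using M(1) n2 y by (intro mult_left_mono rkern_ge_indicator) auto
        finally show ?thesis .
      qed
      have Bk: "k y \<le> rkern (?n - 2) (y - x)"
      proof (cases "norm (y - x) \<le> 1")
        case True
        then show ?thesis using newt_le[of "y - x" \<rho>] y DIM3 by (simp add: k_def rkern_def)
      next
        case False
        then show ?thesis using newt_eq_0[of "y - x" \<rho>] by (simp add: k_def rkern_nonneg)
      qed
      have "\<bar>f (u y)\<bar> * k y \<le> (C * (u y + u y powr (p - 1))) * rkern (?n - 2) (y - x)"
        using f_bound[of "u y"] u_nonneg[of y] Bk k0[of y] C by (intro mult_mono) auto
      moreover have "u y * (lap k y + moll \<rho> (y - x)) \<le> u y * (M * rkern (?n - 2) (y - x))"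
        by (rule mult_left_mono[OF A u_nonneg])
      moreover have "u y * (M * rkern (?n - 2) (y - x)) \<le> (M * (u y + u y powr (p - 1))) * rkern (?n - 2) (y - x)"
        using M(1) u_nonneg[of y] rkern_nonneg[of "?n - 2" "y - x"] by (simp add: algebra_simps)
      ultimately show "u y * (lap k y + moll \<rho> (y - x)) + \<bar>f (u y)\<bar> * k y \<le> h y * rkern (?n - 2) (y - x)"
        by (simp add: h_def algebra_simps)
    qed
    finally show "ennreal (LINT y|lborel. u y * moll \<rho> (y - x)) \<le> riesz (?n - 2) h x" .
  qed (use DIM3 in auto)
  then have "AE x in lborel. ennreal (u x) \<le> riesz (?n - 2) (\<lambda>y. (M + C) / ?c * (u y + u y powr (p - 1))) x"
  proof eventually_elim
    case (elim x)
    have "ennreal (u x) = ennreal (1 / ?c) * ennreal (?c * u x)"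
      using cpos u_nonneg[of x] by (simp flip: ennreal_mult)
    also have "\<dots> \<le> ennreal (1 / ?c) * riesz (?n - 2) h x" by (intro mult_left_mono elim) simp
    also have "\<dots> = riesz (?n - 2) (\<lambda>y. (M + C) / ?c * (u y + u y powr (p - 1))) x"
      unfolding riesz_def using cpos
      by (subst nn_integral_cmult[symmetric]) (auto simp: h_def mult.assoc simp flip: ennreal_mult')
    finally show ?case .
  qed
  then show ?thesis using M C cpos by (intro that[of "(M + C) / ?c"]) auto
qed

end


section \<open>Boundedness and uniform decay\<close>

lemma small_powr:
  fixes c a e :: real
  assumes "c \<ge> 0" "a > 0" "e > 0"
  obtains t where "t > 0" "\<And>s. 0 < s \<Longrightarrow> s \<le> t \<Longrightarrow> c * s powr a \<le> e"
proof (rule that)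
  show "(e / (c + 1)) powr (1 / a) > 0" using assms by simp
  fix s assume s: "0 < s" "s \<le> (e / (c + 1)) powr (1 / a)"
  then have "s powr a \<le> ((e / (c + 1)) powr (1 / a)) powr a" using assms by (intro powr_mono2) auto
  also have "\<dots> = e / (c + 1)" using assms by (simp add: powr_powr)
  finally have "c * s powr a \<le> c * (e / (c + 1))" using assms by (intro mult_left_mono) auto
  also have "\<dots> \<le> e" using assms by (simp add: field_simps)
  finally show "c * s powr a \<le> e" .
qed

text \<open>Young's inequality for l a and b / l. The free scale l decides which of the two terms is
  made small.\<close>

lemma young_scaled:
  fixes a b l t :: real
  assumes "t > 1" "l > 0" "a \<ge> 0" "b \<ge> 0"
  shows "a * b \<le> l powr t * a powr t + l powr (- (t / (t - 1))) * b powr (t / (t - 1))"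
proof -
  let ?s = "t / (t - 1)"
  have s: "?s > 1" "1 / t + 1 / ?s = 1" using assms(1) by (auto simp: field_simps)
  have "(l * a) * (b / l) \<le> (l * a) powr t / t + (b / l) powr ?s / ?s"
    using assms s by (intro Youngs_inequality) auto
  also have "\<dots> \<le> (l * a) powr t + (b / l) powr ?s"
  proof (intro add_mono)
    have d: "x / c \<le> x" if "x \<ge> 0" "c > 1" for x c :: real
      using mult_left_mono[of 1 c x] that by (simp add: divide_le_eq)
    show "(l * a) powr t / t \<le> (l * a) powr t" "(b / l) powr ?s / ?s \<le> (b / l) powr ?s"
      by (rule d[OF powr_ge_zero assms(1)], rule d[OF powr_ge_zero s(1)])
  qed
  also have "\<dots> = l powr t * a powr t + l powr (- ?s) * b powr ?s"
    using assms by (simp add: powr_mult powr_divide powr_minus field_simps)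
  finally show ?thesis using assms(2) by simp
qed

lemma inverse_powr: "l > 0 \<Longrightarrow> (1 / l) powr a = (l::real) powr (- a)"
  by (simp add: powr_divide powr_minus_divide)

lemma rkern_cball:
  assumes "\<tau> \<le> 1"
  shows "rkern a z * indicator (cball 0 \<tau>) z = norm z powr (- a) * indicator (cball 0 \<tau>) z"
  using assms by (auto simp: rkern_def indicator_def)

context regular_solution
begin

lemma dimN3: "real DIM('k \<times> 'm) \<ge> 3"
  using DIM3 by linarith

text \<open>u^(p-2) is paired with the kernel by Young's inequality with exponents t > n/2 and s = t
  / (t - 1) < n / (n - 2). The first factor is globally integrable to the power t, the second
  locally to the power s, and neither bound depends on the centre x.\<close>

lemma kato_small:
  assumes e: "e > 0"
  obtains \<tau> where "0 < \<tau>" "\<tau> \<le> 1"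
    "\<And>x. (\<integral>\<^sup>+y. ennreal ((1 + u y powr (p - 2)) * (rkern (real DIM('k \<times> 'm) - 2) (y - x) * indicator (cball 0 \<tau>) (y - x))) \<partial>lborel) \<le> ennreal e"
proof -
  let ?n = "real DIM('k \<times> 'm)"
  \<comment> \<open>Exceeding (p - 2) n / 2 gives t > n/2; exceeding p gives q > 2 and t > 1. Both
    numbers lie below the critical exponent because p does.\<close>
  define q0 where "q0 = max p ((p - 2) * ?n / 2)"
  have pn: "p * (?n - 2) < 2 * ?n" using p dimN3 by (simp add: field_simps)
  have "(p - 2) * ?n / 2 < 2 * ?n / (?n - 2)"
  proof -
    have "(p - 2) * (?n - 2) < 4" using pn by (simp add: algebra_simps)
    then have "(p - 2) * (?n - 2) * ?n < 4 * ?n" using dimN3 by (intro mult_strict_right_mono) auto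
    then show ?thesis using dimN3 by (simp add: field_simps)
  qed
  then have "q0 < 2 * ?n / (?n - 2)" using p by (simp add: q0_def)
  then obtain q where q: "q0 < q" "q < 2 * ?n / (?n - 2)" using dense by blast
  have qp: "q > p" "q > (p - 2) * ?n / 2" using q(1) by (auto simp: q0_def)
  define t where "t = q / (p - 2)"
  have t: "t > ?n / 2" "t > 1" "(p - 2) * t = q" using qp p dimN3 by (auto simp: t_def field_simps)
  define s where "s = t / (t - 1)"
  have s: "s > 1" using t(2) by (simp add: s_def field_simps)
  have ns: "(?n - 2) * s < ?n"
  proof -
    have "?n * (t - 1) - (?n - 2) * t = 2 * t - ?n" by (simp add: algebra_simps)
    then have "(?n - 2) * t < ?n * (t - 1)" using t(1) by linarith
    then show ?thesis using t(2) by (simp add: s_def field_simps)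
  qed
  have ns0: "0 \<le> (?n - 2) * s" using s dimN3 by (intro mult_nonneg_nonneg) linarith+
  have n2: "0 \<le> ?n - 2" "?n - 2 < ?n" using dimN3 by linarith+
  define Uq where "Uq = (LINT x|lborel. u x powr q)"
  have iq: "integrable lborel (\<lambda>x. u x powr q)" using u_Lq[of q] q qp p by auto
  have Uq0: "Uq \<ge> 0" unfolding Uq_def by (intro integral_nonneg_AE) auto
  obtain K1 where K1: "K1 > 0" "\<And>\<tau>. \<tau> > 0 \<Longrightarrow> (\<integral>\<^sup>+z. ennreal (norm (z::'k\<times>'m) powr (- ((?n - 2) * s)) * indicator (cball 0 \<tau>) z) \<partial>lborel)
        \<le> ennreal (K1 * \<tau> powr (?n - (?n - 2) * s))"
    using nn_integral_powr_cball[where 'a = "'k \<times> 'm", OF ns0 ns] by blast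
  obtain K2 where K2': "K2 > 0" "\<And>\<tau>. \<tau> > 0 \<Longrightarrow> (\<integral>\<^sup>+z. ennreal (norm (z::'k\<times>'m) powr (- (?n - 2)) * indicator (cball 0 \<tau>) z) \<partial>lborel)
        \<le> ennreal (K2 * \<tau> powr (?n - (?n - 2)))"
    using nn_integral_powr_cball[where 'a = "'k \<times> 'm", OF n2] by blast
  \<comment> \<open>The scale l makes the u-term small at the price of a large factor
    \<open>l powr (- s)\<close>, which is compensated by choosing the radius afterwards.\<close>
  obtain l where l: "l > 0" "Uq * l powr t \<le> e / 3"
    using small_powr[of Uq t "e / 3"] Uq0 t e by auto
  obtain t1 where t1: "t1 > 0" "\<And>\<tau>. 0 < \<tau> \<Longrightarrow> \<tau> \<le> t1 \<Longrightarrow> (l powr (- s) * K1) * \<tau> powr (?n - (?n - 2) * s) \<le> e / 3"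
    using small_powr[of "l powr (- s) * K1" "?n - (?n - 2) * s" "e / 3"] K1(1) ns e by auto
  obtain t2 where t2: "t2 > 0" "\<And>\<tau>. 0 < \<tau> \<Longrightarrow> \<tau> \<le> t2 \<Longrightarrow> K2 * \<tau> powr (?n - (?n - 2)) \<le> e / 3"
    using small_powr[of K2 "?n - (?n - 2)" "e / 3"] K2'(1) e by auto
  define \<tau> where "\<tau> = min 1 (min t1 t2)"
  have \<tau>: "0 < \<tau>" "\<tau> \<le> 1" "\<tau> \<le> t1" "\<tau> \<le> t2" using t1(1) t2(1) by (auto simp: \<tau>_def)
  show ?thesis
  proof (rule that[OF \<tau>(1,2)])
    fix x :: "'k \<times> 'm"
    let ?k = "\<lambda>a z. norm (z::'k\<times>'m) powr (- a) * indicator (cball 0 \<tau>) z"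
    have pt: "(1 + u y powr (p - 2)) * (rkern (?n - 2) (y - x) * indicator (cball 0 \<tau>) (y - x))
       \<le> l powr t * u y powr q + (l powr (- s) * ?k ((?n - 2) * s) (y - x) + ?k (?n - 2) (y - x))" for y
    proof -
      have "u y powr (p - 2) * ?k (?n - 2) (y - x) \<le> l powr t * (u y powr (p - 2)) powr t + l powr (- s) * (?k (?n - 2) (y - x)) powr s"
        unfolding s_def by (rule young_scaled) (use t l in auto)
      moreover have "(u y powr (p - 2)) powr t = u y powr q" using t by (simp add: powr_powr)
      moreover have "(?k a z) powr s = ?k (a * s) z" for a z
        by (simp add: indicator_def powr_powr)
      then have "(?k (?n - 2) (y - x)) powr s = ?k ((?n - 2) * s) (y - x)" .
      ultimately show ?thesis unfolding rkern_cball[OF \<tau>(2)] by (simp add: algebra_simps)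
    qed
    have "(\<integral>\<^sup>+y. ennreal ((1 + u y powr (p - 2)) * (rkern (?n - 2) (y - x) * indicator (cball 0 \<tau>) (y - x))) \<partial>lborel)
      \<le> (\<integral>\<^sup>+y. ennreal (l powr t * u y powr q) + (ennreal (l powr (- s)) * ennreal (?k ((?n - 2) * s) (y - x)) + ennreal (?k (?n - 2) (y - x))) \<partial>lborel)"
      by (intro nn_integral_mono order_trans[OF ennreal_leI[OF pt]]) (simp flip: ennreal_mult ennreal_plus)
    also have "\<dots> = (\<integral>\<^sup>+y. ennreal (l powr t * u y powr q) \<partial>lborel)
       + (ennreal (l powr (- s)) * (\<integral>\<^sup>+y. ennreal (?k ((?n - 2) * s) (y - x)) \<partial>lborel) + (\<integral>\<^sup>+y. ennreal (?k (?n - 2) (y - x)) \<partial>lborel))"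
      by (simp add: nn_integral_add nn_integral_cmult)
    also have "(\<integral>\<^sup>+y. ennreal (l powr t * u y powr q) \<partial>lborel) = ennreal (Uq * l powr t)"
      using iq by (subst nn_integral_eq_integral) (auto simp: Uq_def mult.commute)
    also have "(\<integral>\<^sup>+y. ennreal (?k ((?n - 2) * s) (y - x)) \<partial>lborel) = (\<integral>\<^sup>+y. ennreal (?k ((?n - 2) * s) y) \<partial>lborel)"
      by (rule nn_integral_lborel_shift[of "\<lambda>y. ennreal (?k ((?n - 2) * s) y)"]) measurable
    also have "(\<integral>\<^sup>+y. ennreal (?k (?n - 2) (y - x)) \<partial>lborel) = (\<integral>\<^sup>+y. ennreal (?k (?n - 2) y) \<partial>lborel)"
      by (rule nn_integral_lborel_shift[of "\<lambda>y. ennreal (?k (?n - 2) y)"]) measurable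
    also have "ennreal (Uq * l powr t) + (ennreal (l powr (- s)) * (\<integral>\<^sup>+y. ennreal (?k ((?n - 2) * s) y) \<partial>lborel) + (\<integral>\<^sup>+y. ennreal (?k (?n - 2) y) \<partial>lborel))
      \<le> ennreal (e / 3) + (ennreal (l powr (- s)) * ennreal (K1 * \<tau> powr (?n - (?n - 2) * s)) + ennreal (K2 * \<tau> powr (?n - (?n - 2))))"
      by (intro add_mono mult_left_mono ennreal_leI l K1(2) K2'(2) \<tau>) simp
    also have "\<dots> \<le> ennreal (e / 3) + (ennreal (e / 3) + ennreal (e / 3))"
    proof (intro add_mono order_refl)
      have "ennreal (l powr (- s)) * ennreal (K1 * \<tau> powr (?n - (?n - 2) * s)) = ennreal ((l powr (- s) * K1) * \<tau> powr (?n - (?n - 2) * s))"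
        using K1(1) by (simp add: mult.assoc flip: ennreal_mult)
      also have "\<dots> \<le> ennreal (e / 3)" by (intro ennreal_leI t1 \<tau>)
      finally show "ennreal (l powr (- s)) * ennreal (K1 * \<tau> powr (?n - (?n - 2) * s)) \<le> ennreal (e / 3)" .
      show "ennreal (K2 * \<tau> powr (?n - (?n - 2))) \<le> ennreal (e / 3)" by (intro ennreal_leI t2 \<tau>)
    qed
    also have "\<dots> = ennreal e" using e by (simp flip: ennreal_plus)
    finally show "(\<integral>\<^sup>+y. ennreal ((1 + u y powr (p - 2)) * (rkern (?n - 2) (y - x) * indicator (cball 0 \<tau>) (y - x))) \<partial>lborel) \<le> ennreal e" .
  qed
qed

lemma u_powr_split: "u y + u y powr (p - 1) = u y * (1 + u y powr (p - 2))"
proof (cases "u y = 0")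
  case False
  then have "u y powr (p - 1) = u y powr 1 * u y powr (p - 2)" unfolding powr_add[symmetric] by simp
  then show ?thesis using u_nonneg[of y] by (simp add: algebra_simps)
qed simp

text \<open>The excess \<open>\<psi> = (u - 2D)\<^sup>+\<close> satisfies \<open>\<psi> \<le> T \<psi>\<close> for an operator \<open>T\<close> that is a contraction on the
  weighted space \<open>L\<^sup>1(W dx)\<close>, because its kernel is symmetric and has small mass against \<open>W\<close>.\<close>

theorem u_bounded:
  obtains D where "D > 0" "AE x in lborel. u x \<le> D"
proof -
  let ?n = "real DIM('k \<times> 'm)"
  obtain A where A: "A > 0" "AE x in lborel. ennreal (u x) \<le> riesz (?n - 2) (\<lambda>y. A * (u y + u y powr (p - 1))) x"
    using u_riesz_bound by blast
  define W where "W y = 1 + u y powr (p - 2)" for y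
  have [measurable]: "W \<in> borel_measurable borel" unfolding W_def[abs_def] by measurable
  have W1: "W y \<ge> 1" for y by (simp add: W_def)
  have W0: "W y \<ge> 0" for y using W1[of y] by linarith
  \<comment> \<open>This smallness makes the near part of the potential, including its factor A,
    have norm at most 1/2.\<close>
  have "1 / (2 * A) > 0" using A by simp
  then obtain \<tau> where \<tau>: "0 < \<tau>" "\<tau> \<le> 1"
    "\<And>x. (\<integral>\<^sup>+y. ennreal (W y * (rkern (?n - 2) (y - x) * indicator (cball 0 \<tau>) (y - x))) \<partial>lborel) \<le> ennreal (1 / (2 * A))"
    unfolding W_def using kato_small by blast
  \<comment> \<open>The near part of the kernel; what remains is bounded, since it lives outside the
    ball of radius \<tau>.\<close>
  define k where "k z = rkern (?n - 2) z * indicator (cball 0 \<tau>) z" for z :: "'k \<times> 'm"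
  have [measurable]: "k \<in> borel_measurable borel" unfolding k_def[abs_def] by measurable
  have k0: "k z \<ge> 0" for z by (simp add: k_def rkern_nonneg)
  have ksym: "k (x - y) = k (y - x)" for x y by (simp add: k_def rkern_def indicator_def norm_minus_commute)
  have kato: "(\<integral>\<^sup>+y. ennreal (A * (W y * k (y - x))) \<partial>lborel) \<le> ennreal (1/2)" for x
  proof -
    have "(\<integral>\<^sup>+y. ennreal (A * (W y * k (y - x))) \<partial>lborel) = ennreal A * (\<integral>\<^sup>+y. ennreal (W y * k (y - x)) \<partial>lborel)"
      using A W0 k0 by (simp add: ennreal_mult nn_integral_cmult)
    also have "\<dots> \<le> ennreal A * ennreal (1 / (2 * A))" using \<tau>(3)[of x] unfolding k_def by (rule mult_left_mono) simp
    also have "\<dots> = ennreal (1/2)" using A by (simp flip: ennreal_mult)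
    finally show ?thesis .
  qed
  define vb where "vb = measure lborel (cball (0::'k\<times>'m) 1)"
  \<comment> \<open>A bound for the far part, uniform in x: the kernel is at most \<tau>^(-(n-2)),
    and u W \<le> 2 + 2 u^p is integrable over unit balls.\<close>
  define A0 where "A0 = A * \<tau> powr (- (?n - 2)) * (2 * vb + 2 * (LINT y|lborel. u y powr p))"
  define D where "D = max 1 A0"
  have D: "D \<ge> 1" "A0 \<le> D" by (auto simp: D_def)
  have far: "(\<integral>\<^sup>+y. ennreal (A * (u y * W y) * (rkern (?n - 2) (y - x) - k (y - x))) \<partial>lborel) \<le> ennreal A0" for x
  proof -
    have pt: "A * (u y * W y) * (rkern (?n - 2) (y - x) - k (y - x)) \<le> A * \<tau> powr (- (?n - 2)) * (2 * indicator (cball 0 1) (y - x) + 2 * u y powr p)" for y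
    proof -
      have uw: "u y * W y \<le> 2 + 2 * u y powr p"
      proof -
        have "u y powr 1 \<le> 1 + u y powr p" "u y powr (p - 1) \<le> 1 + u y powr p"
          using u_nonneg[of y] p by (intro powr_le_one_plus; simp)+
        then show ?thesis using u_powr_split[of y] u_nonneg[of y] by (simp add: W_def)
      qed
      have kk: "rkern (?n - 2) z - k z \<le> \<tau> powr (- (?n - 2)) * indicator (cball 0 1) z" "rkern (?n - 2) z - k z \<ge> 0" for z
      proof -
        show "rkern (?n - 2) z - k z \<le> \<tau> powr (- (?n - 2)) * indicator (cball 0 1) z"
        proof (cases "norm z \<le> \<tau>")
          case False
          then have "norm z powr (- (?n - 2)) \<le> \<tau> powr (- (?n - 2))" using \<tau> dimN3 by (intro powr_mono2') auto
          then show ?thesis using False by (auto simp: k_def rkern_def indicator_def)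
        qed (simp add: k_def)
        show "rkern (?n - 2) z - k z \<ge> 0" using rkern_nonneg[of "?n - 2" z] by (simp add: k_def indicator_def)
      qed
      have "A * (u y * W y) * (rkern (?n - 2) (y - x) - k (y - x)) \<le> A * (2 + 2 * u y powr p) * (\<tau> powr (- (?n - 2)) * indicator (cball 0 1) (y - x))"
        using kk[of "y - x"] uw A(1) by (intro mult_mono mult_left_mono) auto
      also have "\<dots> \<le> A * \<tau> powr (- (?n - 2)) * (2 * indicator (cball 0 1) (y - x) + 2 * u y powr p)"
        using A(1) by (auto simp: indicator_def algebra_simps)
      finally show ?thesis .
    qed
    have iB: "integrable lborel (\<lambda>y. indicat_real (cball (0::'k\<times>'m) 1) (y - x))"
    proof -
      have "(\<lambda>y. indicat_real (cball (0::'k\<times>'m) 1) (y - x)) = indicator (cball x 1)"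
        by (auto simp: indicator_def fun_eq_iff dist_norm norm_minus_commute)
      then show ?thesis using emeasure_lborel_cball_finite[of x 1] by (simp add: integrable_real_indicator)
    qed
    have vB: "(LINT y|lborel. indicat_real (cball (0::'k\<times>'m) 1) (y - x)) = vb"
      using integral_lborel_shift[of "indicat_real (cball (0::'k\<times>'m) 1)" "- x"] by (simp add: vb_def)
    have "(\<integral>\<^sup>+y. ennreal (A * (u y * W y) * (rkern (?n - 2) (y - x) - k (y - x))) \<partial>lborel)
      \<le> (\<integral>\<^sup>+y. ennreal (A * \<tau> powr (- (?n - 2)) * (2 * indicator (cball 0 1) (y - x) + 2 * u y powr p)) \<partial>lborel)"
      by (intro nn_integral_mono ennreal_leI pt)
    also have "\<dots> = ennreal (LINT y|lborel. A * \<tau> powr (- (?n - 2)) * (2 * indicator (cball 0 1) (y - x) + 2 * u y powr p))"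
      using iB u_Lp A(1) by (intro nn_integral_eq_integral) auto
    also have "(LINT y|lborel. A * \<tau> powr (- (?n - 2)) * (2 * indicator (cball 0 1) (y - x) + 2 * u y powr p)) = A0"
      using iB u_Lp by (simp add: A0_def vB)
    finally show ?thesis .
  qed
  \<comment> \<open>The threshold 2 D reproduces itself: the far part contributes at most D, and the
    near part applied to the constant 2 D at most half of it.\<close>
  define \<psi> where "\<psi> y = max 0 (u y - 2 * D)" for y
  have [measurable]: "\<psi> \<in> borel_measurable borel" unfolding \<psi>_def[abs_def] by measurable
  have \<psi>0: "\<psi> y \<ge> 0" for y by (simp add: \<psi>_def)
  define T where "T x = (\<integral>\<^sup>+y. ennreal (A * (\<psi> y * W y * k (y - x))) \<partial>lborel)" for x
  have main: "AE x in lborel. ennreal (\<psi> x) \<le> T x"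
    using A(2)
  proof eventually_elim
    case (elim x)
    have "ennreal (u x) \<le> (\<integral>\<^sup>+y. ennreal (A * (u y * W y) * (rkern (?n - 2) (y - x) - k (y - x))) + (ennreal (A * (\<psi> y * W y * k (y - x))) + ennreal (2 * D) * ennreal (A * (W y * k (y - x)))) \<partial>lborel)"
    proof (rule order_trans[OF elim], unfold riesz_def, rule nn_integral_mono)
      fix y
      have "u y \<le> \<psi> y + 2 * D" by (simp add: \<psi>_def)
      then have "(A * W y * k (y - x)) * u y \<le> (A * W y * k (y - x)) * (\<psi> y + 2 * D)"
        using A W0 k0 by (intro mult_left_mono) auto
      then have "A * (u y + u y powr (p - 1)) * rkern (?n - 2) (y - x)
        \<le> A * (u y * W y) * (rkern (?n - 2) (y - x) - k (y - x)) + (A * (\<psi> y * W y * k (y - x)) + (2 * D) * (A * (W y * k (y - x))))"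
        unfolding u_powr_split W_def[symmetric] by (simp add: algebra_simps)
      moreover have "rkern (?n - 2) (y - x) - k (y - x) \<ge> 0" using rkern_nonneg[of "?n - 2" "y - x"] by (simp add: k_def indicator_def)
      ultimately show "ennreal (A * (u y + u y powr (p - 1)) * rkern (?n - 2) (y - x))
        \<le> ennreal (A * (u y * W y) * (rkern (?n - 2) (y - x) - k (y - x))) + (ennreal (A * (\<psi> y * W y * k (y - x))) + ennreal (2 * D) * ennreal (A * (W y * k (y - x))))"
        using A(1) u_nonneg[of y] W0[of y] k0[of "y - x"] \<psi>0[of y] D(1)
        by (simp add: ennreal_leI flip: ennreal_mult ennreal_plus)
    qed
    also have "\<dots> = (\<integral>\<^sup>+y. ennreal (A * (u y * W y) * (rkern (?n - 2) (y - x) - k (y - x))) \<partial>lborel) + (T x + ennreal (2 * D) * (\<integral>\<^sup>+y. ennreal (A * (W y * k (y - x))) \<partial>lborel))"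
      unfolding T_def by (simp add: nn_integral_add nn_integral_cmult)
    also have "\<dots> \<le> ennreal D + (T x + ennreal (2 * D) * ennreal (1/2))"
      using D(2) by (intro add_mono mult_left_mono order_trans[OF far] ennreal_leI kato order_refl) auto
    also have "\<dots> = T x + ennreal (2 * D)"
    proof -
      have "ennreal (2 * D) * ennreal (1/2) = ennreal (2 * D * (1/2))"
        by (rule ennreal_mult[symmetric]) (use D(1) in auto)
      then have "ennreal (2 * D) * ennreal (1/2) = ennreal D" by simp
      moreover have "ennreal D + ennreal D = ennreal (2 * D)" using D(1) by (simp flip: ennreal_plus)
      ultimately show ?thesis by (metis add.commute add.left_commute)
    qed
    finally have le: "ennreal (u x) \<le> T x + ennreal (2 * D)" .
    show ?case
    proof (cases "T x")
      case (real r)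
      then have "ennreal (u x) \<le> ennreal (r + 2 * D)" using le D(1) by (simp add: ennreal_plus)
      then have "u x \<le> r + 2 * D" by (subst (asm) ennreal_le_iff) (use real D(1) in auto)
      then show ?thesis using real by (simp add: \<psi>_def ennreal_leI)
    qed simp
  qed
  define I where "I = (\<integral>\<^sup>+x. ennreal (\<psi> x * W x) \<partial>lborel)"
  have "I \<le> (\<integral>\<^sup>+x. T x * ennreal (W x) \<partial>lborel)" unfolding I_def
    by (rule nn_integral_mono_AE, rule eventually_mono[OF main])
       (simp add: ennreal_mult \<psi>0 W0 mult_right_mono)
  also have "\<dots> = (\<integral>\<^sup>+x. \<integral>\<^sup>+y. ennreal (\<psi> y * W y) * ennreal (A * (W x * k (x - y))) \<partial>lborel \<partial>lborel)"
  proof (rule nn_integral_cong)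
    fix x
    have "T x * ennreal (W x) = (\<integral>\<^sup>+y. ennreal (A * (\<psi> y * W y * k (y - x))) * ennreal (W x) \<partial>lborel)"
      unfolding T_def by (rule nn_integral_multc[symmetric]) measurable
    also have "\<dots> = (\<integral>\<^sup>+y. ennreal (\<psi> y * W y) * ennreal (A * (W x * k (x - y))) \<partial>lborel)"
    proof (rule nn_integral_cong)
      fix y
      have "A * (\<psi> y * W y * k (y - x)) * W x = (\<psi> y * W y) * (A * (W x * k (x - y)))" by (simp add: ksym)
      then show "ennreal (A * (\<psi> y * W y * k (y - x))) * ennreal (W x) = ennreal (\<psi> y * W y) * ennreal (A * (W x * k (x - y)))"
        using A(1) \<psi>0 W0 k0 by (simp flip: ennreal_mult)
    qed
    finally show "T x * ennreal (W x) = (\<integral>\<^sup>+y. ennreal (\<psi> y * W y) * ennreal (A * (W x * k (x - y))) \<partial>lborel)" .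
  qed
  also have "\<dots> = (\<integral>\<^sup>+y. \<integral>\<^sup>+x. ennreal (\<psi> y * W y) * ennreal (A * (W x * k (x - y))) \<partial>lborel \<partial>lborel)"
    by (rule lborel_pair.Fubini'[symmetric]) measurable
  also have "\<dots> = (\<integral>\<^sup>+y. ennreal (\<psi> y * W y) * (\<integral>\<^sup>+x. ennreal (A * (W x * k (x - y))) \<partial>lborel) \<partial>lborel)"
    by (simp add: nn_integral_cmult)
  also have "\<dots> \<le> (\<integral>\<^sup>+y. ennreal (\<psi> y * W y) * ennreal (1/2) \<partial>lborel)"
    by (intro nn_integral_mono mult_left_mono kato) simp
  also have "\<dots> = I * ennreal (1/2)" unfolding I_def by (rule nn_integral_multc) measurable
  finally have half: "I \<le> I * ennreal (1/2)" .
  \<comment> \<open>Only a finite norm is forced to vanish by the halving inequality. Since u > 1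
    wherever \<psi> > 0, lower powers of u are controlled there by u^p.\<close>
  have "I < \<infinity>"
  proof -
    have "\<psi> x * W x \<le> 2 * u x powr p" for x
    proof (cases "u x \<le> 2 * D")
      case False
      then have u1: "u x \<ge> 1" using D(1) by linarith
      have "\<psi> x * W x \<le> u x * W x" using D(1) u1 W0[of x] by (intro mult_right_mono) (auto simp: \<psi>_def)
      also have "\<dots> = u x powr 1 + u x powr (p - 1)" using u_powr_split[of x] u1 by (simp add: W_def)
      also have "\<dots> \<le> u x powr p + u x powr p" using u1 p by (intro add_mono powr_mono) auto
      finally show ?thesis by simp
    qed (simp add: \<psi>_def)
    then have "I \<le> (\<integral>\<^sup>+x. ennreal (2 * u x powr p) \<partial>lborel)" unfolding I_def by (intro nn_integral_mono ennreal_leI)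
    also have "\<dots> < \<infinity>" using u_Lp by (subst nn_integral_eq_integral) auto
    finally show ?thesis .
  qed
  have "I = 0"
  proof (cases I)
    case (real i)
    have "ennreal i * ennreal (1/2) = ennreal (i * (1/2))" by (rule ennreal_mult[symmetric]) (use real in auto)
    then have "ennreal i \<le> ennreal (i * (1/2))" using half real by (simp only:)
    then have "i \<le> i * (1/2)" by (subst (asm) ennreal_le_iff) (use real in auto)
    then have "i = 0" using real by simp
    then show ?thesis using real by simp
  qed (use \<open>I < \<infinity>\<close> in simp)
  then have "AE x in lborel. ennreal (\<psi> x * W x) = 0" unfolding I_def by (subst (asm) nn_integral_0_iff_AE) auto
  then have "AE x in lborel. u x \<le> 2 * D"
  proof eventually_elim
    case (elim x)
    then have "\<psi> x * W x \<le> 0" by (simp add: ennreal_eq_0_iff)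
    then have "\<psi> x \<le> 0" using W1[of x] \<psi>0[of x] by (auto simp: mult_le_0_iff)
    then show ?case by (simp add: \<psi>_def)
  qed
  then show ?thesis using D(1) by (intro that[of "2 * D"]) auto
qed

text \<open>For bounded u the density of the potential is at most A1 u. Young's inequality with
  exponents n and n / (n - 1) separates a fixed integrable kernel from u^n \<le> D^(n-2) u^2. As the
  kernel has range 1, only the tail of the integral of u^2 matters far out.\<close>

theorem u_vanishes_at_infinity:
  assumes e: "e > 0"
  obtains R where "R > 0" "AE x in lborel. R < norm x \<longrightarrow> u x \<le> e"
proof -
  let ?n = "real DIM('k \<times> 'm)"
  obtain A where A: "A > 0" "AE x in lborel. ennreal (u x) \<le> riesz (?n - 2) (\<lambda>y. A * (u y + u y powr (p - 1))) x"
    using u_riesz_bound by blast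
  obtain D where D: "D > 0" "AE x in lborel. u x \<le> D" using u_bounded by blast
  define A1 where "A1 = A * (1 + D powr (p - 2))"
  have A1: "A1 > 0" using A D by (simp add: A1_def add_pos_nonneg)
  define s where "s = ?n / (?n - 1)"
  have s0: "s > 0" using dimN3 by (simp only: s_def) (intro divide_pos_pos; linarith)
  moreover have "(?n - 2) * s < ?n"
  proof -
    have "(?n - 2) * ?n < ?n * (?n - 1)" using dimN3 by (simp only: algebra_simps)
    then show ?thesis using dimN3 by (simp only: s_def times_divide_eq_right) (subst pos_divide_less_eq; linarith)
  qed
  moreover have "0 \<le> (?n - 2) * s" using s0 dimN3 by (intro mult_nonneg_nonneg) linarith+
  ultimately have s: "s > 0" "(?n - 2) * s < ?n" "0 \<le> (?n - 2) * s" by blast+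
  obtain K where K: "K > 0" "(\<integral>\<^sup>+z. ennreal (rkern ((?n - 2) * s) (z::'k\<times>'m)) \<partial>lborel) \<le> ennreal K"
    using nn_integral_rkern[where 'a = "'k \<times> 'm", OF s(3,2)] by blast
  have AK: "A1 * K \<ge> 0" and e2: "e / 2 > 0" using A1 K(1) e by simp_all
  \<comment> \<open>The kernel term is made at most e/2 by l; the resulting large constant Q is then
    beaten by a large radius R0.\<close>
  obtain l where l: "l > 0" "(A1 * K) * l powr s \<le> e / 2"
    by (rule small_powr[OF AK s0 e2]) blast
  define Q where "Q = A1 * l powr (- ?n) * D powr (?n - 2)"
  have Q: "Q > 0" using A1 l D by (simp add: Q_def)
  have "(\<lambda>R::nat. LINT y|lborel. indicator (- cball 0 (real R)) y * (u y)\<^sup>2) \<longlonglongrightarrow> (LINT y|lborel. 0 * (u y)\<^sup>2)"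
  proof (rule integral_dominated_convergence[where w = "\<lambda>y. (u y)\<^sup>2"])
    show "AE y in lborel. (\<lambda>R::nat. indicator (- cball 0 (real R)) y * (u y)\<^sup>2) \<longlonglongrightarrow> 0 * (u y)\<^sup>2"
    proof (rule AE_I2, rule tendsto_eventually)
      fix y :: "'k \<times> 'm"
      obtain R0 :: nat where "norm y \<le> real R0" using real_arch_simple by blast
      then show "\<forall>\<^sub>F R::nat in sequentially. indicator (- cball 0 (real R)) y * (u y)\<^sup>2 = 0 * (u y)\<^sup>2"
        by (intro eventually_sequentiallyI[of R0]) auto
    qed
  qed (use u_sq in \<open>auto simp: indicator_def\<close>)
  then have "(\<lambda>R::nat. LINT y|lborel. indicator (- cball 0 (real R)) y * (u y)\<^sup>2) \<longlonglongrightarrow> 0" by simp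
  moreover have "0 < e / (2 * Q)" using e Q by simp
  ultimately have "\<forall>\<^sub>F R::nat in sequentially. (LINT y|lborel. indicator (- cball 0 (real R)) y * (u y)\<^sup>2) < e / (2 * Q)"
    by (rule order_tendstoD(2))
  then obtain R0 :: nat where R0: "(LINT y|lborel. indicator (- cball 0 (real R0)) y * (u y)\<^sup>2) < e / (2 * Q)"
    by (auto simp: eventually_sequentially)
  have iR: "integrable lborel (\<lambda>y. indicator (- cball 0 (real R0)) y * (u y)\<^sup>2)"
    by (rule Bochner_Integration.integrable_bound[OF u_sq]) (auto simp: indicator_def)
  show ?thesis
  proof (rule that[of "real R0 + 1"])
    show "AE x in lborel. real R0 + 1 < norm x \<longrightarrow> u x \<le> e"
      using A(2)
    proof eventually_elim
      case (elim x)
      show ?case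
      proof
        assume x: "real R0 + 1 < norm x"
        have "riesz (?n - 2) (\<lambda>y. A * (u y + u y powr (p - 1))) x
          \<le> (\<integral>\<^sup>+y. ennreal (A1 * l powr s) * ennreal (rkern ((?n - 2) * s) (y - x)) + ennreal (Q * (indicator (- cball 0 (real R0)) y * (u y)\<^sup>2)) \<partial>lborel)"
          unfolding riesz_def
        proof (rule nn_integral_mono_AE, rule eventually_mono[OF D(2)])
          fix y assume uD: "u y \<le> D"
          let ?k = "rkern (?n - 2) (y - x)"
          have "u y powr (p - 2) \<le> D powr (p - 2)" using u_nonneg[of y] uD p by (intro powr_mono2) auto
          then have "A * (u y * (1 + u y powr (p - 2))) \<le> A * (u y * (1 + D powr (p - 2)))"
            using A(1) u_nonneg[of y] by (intro mult_left_mono) auto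
          then have "A * (u y + u y powr (p - 1)) * ?k \<le> A1 * u y * ?k"
            unfolding u_powr_split by (intro mult_right_mono) (auto simp: A1_def rkern_nonneg mult_ac)
          also have "\<dots> = A1 * (u y * ?k)" by simp
          also have "\<dots> \<le> A1 * (l powr s * ?k powr s + (if norm (y - x) \<le> 1 then l powr (- ?n) * u y powr ?n else 0))"
          proof (rule mult_left_mono)
            show "u y * ?k \<le> l powr s * ?k powr s + (if norm (y - x) \<le> 1 then l powr (- ?n) * u y powr ?n else 0)"
            proof (cases "norm (y - x) \<le> 1")
              case True
              \<comment> \<open>The scale is 1 / l because u plays the first role; the kernel
                thereby receives the small factor \<open>l powr s\<close>.\<close>
              have "u y * ?k \<le> (1 / l) powr ?n * u y powr ?n + (1 / l) powr (- (?n / (?n - 1))) * ?k powr (?n / (?n - 1))"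
                by (rule young_scaled) (use dimN3 l u_nonneg[of y] rkern_nonneg in auto)
              moreover have "(1 / l) powr ?n = l powr (- ?n)" "(1 / l) powr (- (?n / (?n - 1))) = l powr (?n / (?n - 1))"
                using inverse_powr[OF l(1)] inverse_powr[OF l(1), of "- (?n / (?n - 1))"] by (simp_all only: minus_minus)
              ultimately show ?thesis using True by (simp add: s_def)
            next
              case False
              then show ?thesis by (simp add: rkern_def)
            qed
          qed (use A1 in simp)
          also have "\<dots> \<le> (A1 * l powr s) * rkern ((?n - 2) * s) (y - x) + Q * (indicator (- cball 0 (real R0)) y * (u y)\<^sup>2)"
          proof -
            have "A1 * (if norm (y - x) \<le> 1 then l powr (- ?n) * u y powr ?n else 0) \<le> Q * (indicator (- cball 0 (real R0)) y * (u y)\<^sup>2)"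
            proof (cases "norm (y - x) \<le> 1")
              case True
              have "norm x \<le> norm y + norm (y - x)" using norm_triangle_ineq4[of y "y - x"] by simp
              then have ny: "y \<in> - cball 0 (real R0)" using True x by simp
              have "u y powr ?n \<le> D powr (?n - 2) * (u y)\<^sup>2"
              proof (cases "u y = 0")
                case False
                then have up: "u y > 0" using u_nonneg[of y] by simp
                have "u y powr ?n = u y powr (?n - 2) * u y powr 2" unfolding powr_add[symmetric] by simp
                also have "\<dots> = u y powr (?n - 2) * (u y)\<^sup>2" using up by simp
                also have "\<dots> \<le> D powr (?n - 2) * (u y)\<^sup>2" using up uD dimN3 by (intro mult_right_mono powr_mono2) auto
                finally show ?thesis .
              qed simp
              then have "(A1 * l powr (- ?n)) * u y powr ?n \<le> (A1 * l powr (- ?n)) * (D powr (?n - 2) * (u y)\<^sup>2)"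
                using A1 by (intro mult_left_mono) auto
              then show ?thesis using True ny by (simp add: Q_def mult_ac)
            qed (use Q in simp)
            then show ?thesis by (simp add: rkern_powr distrib_left mult.assoc)
          qed
          finally have "A * (u y + u y powr (p - 1)) * ?k \<le> (A1 * l powr s) * rkern ((?n - 2) * s) (y - x) + Q * (indicator (- cball 0 (real R0)) y * (u y)\<^sup>2)" .
          then show "ennreal (A * (u y + u y powr (p - 1)) * ?k) \<le> ennreal (A1 * l powr s) * ennreal (rkern ((?n - 2) * s) (y - x)) + ennreal (Q * (indicator (- cball 0 (real R0)) y * (u y)\<^sup>2))"
            using A1 Q rkern_nonneg[of "(?n - 2) * s" "y - x"] by (simp add: ennreal_leI flip: ennreal_mult ennreal_plus)
        qed
        also have "\<dots> = ennreal (A1 * l powr s) * (\<integral>\<^sup>+y. ennreal (rkern ((?n - 2) * s) (y - x)) \<partial>lborel) + (\<integral>\<^sup>+y. ennreal (Q * (indicator (- cball 0 (real R0)) y * (u y)\<^sup>2)) \<partial>lborel)"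
          by (simp add: nn_integral_add nn_integral_cmult)
        also have "(\<integral>\<^sup>+y. ennreal (rkern ((?n - 2) * s) (y - x)) \<partial>lborel) = (\<integral>\<^sup>+y. ennreal (rkern ((?n - 2) * s) (y::'k\<times>'m)) \<partial>lborel)"
          by (rule nn_integral_lborel_shift[of "\<lambda>y. ennreal (rkern ((?n - 2) * s) y)"]) measurable
        also have "(\<integral>\<^sup>+y. ennreal (Q * (indicator (- cball 0 (real R0)) y * (u y)\<^sup>2)) \<partial>lborel) = ennreal (Q * (LINT y|lborel. indicator (- cball 0 (real R0)) y * (u y)\<^sup>2))"
          using iR Q by (subst nn_integral_eq_integral) auto
        also have "ennreal (A1 * l powr s) * (\<integral>\<^sup>+y. ennreal (rkern ((?n - 2) * s) (y::'k\<times>'m)) \<partial>lborel) + ennreal (Q * (LINT y|lborel. indicator (- cball 0 (real R0)) y * (u y)\<^sup>2))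
          \<le> ennreal (A1 * l powr s) * ennreal K + ennreal (Q * (e / (2 * Q)))"
          using R0 Q K(2) by (intro add_mono mult_left_mono ennreal_leI) auto
        also have "\<dots> = ennreal (A1 * l powr s * K + e / 2)"
          using A1 K(1) Q e by (simp flip: ennreal_mult ennreal_plus)
        also have "\<dots> \<le> ennreal e" using l(2) by (intro ennreal_leI) (simp add: mult_ac)
        finally have "ennreal (u x) \<le> ennreal e" using elim by (rule order_trans[rotated])
        then show "u x \<le> e" using e by (simp add: ennreal_le_iff)
      qed
    qed
  qed simp
qed

end


section \<open>Maximum principle and decay\<close>

lemma second_derivative_nonpos_at_max:
  fixes q :: "real \<Rightarrow> real"
  assumes q1: "\<And>t. (q has_real_derivative q1 t) (at t)" and q2: "(q1 has_real_derivative q2) (at 0)"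
    and max: "\<And>t. q t \<le> q 0"
  shows "q2 \<le> 0"
proof (rule ccontr)
  assume "\<not> q2 \<le> 0"
  then have "q2 > 0" by simp
  have "q1 0 = 0" by (rule DERIV_local_max[OF q1[of 0], of 1]) (use max in auto)
  moreover obtain d where d: "d > 0" "\<And>h. 0 < h \<Longrightarrow> h < d \<Longrightarrow> q1 0 < q1 (0 + h)"
    using DERIV_pos_inc_right[OF q2 \<open>q2 > 0\<close>] by auto
  moreover obtain z where "0 < z" "z < d / 2" "q (d / 2) - q 0 = (d / 2 - 0) * q1 z"
    using MVT2[of 0 "d / 2" q q1] q1 d(1) by auto
  ultimately have "q1 z > 0" "q (d / 2) - q 0 = d / 2 * q1 z" using d(2)[of z] by auto
  moreover have "d / 2 * q1 z > 0" using d(1) \<open>q1 z > 0\<close> by (intro mult_pos_pos) auto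
  ultimately have "q (d / 2) - q 0 > 0" by linarith
  then show False using max[of "d / 2"] by linarith
qed

section \<open>Regularity of mollified functions\<close>

lemma iter_pd_shift:
  assumes "smooth_fun \<phi>"
  shows "iter_pd [b] (\<lambda>y. \<phi> (y - a)) = (\<lambda>y. iter_pd [b] \<phi> (y - a))"
proof -
  have "((\<lambda>y. \<phi> (y - a)) has_derivative frechet_derivative \<phi> (at (y - a))) (at y)" for y
  proof -
    have "((\<lambda>y. y - a) has_derivative (\<lambda>v. v)) (at y)" by (auto intro!: derivative_eq_intros)
    from has_derivative_compose[OF this smooth_fun_has_derivative[OF assms]] show ?thesis by simp
  qed
  from iter_pd_eqI[OF this] show ?thesis by simp
qed

lemma lap_shift:
  assumes "smooth_fun \<phi>"
  shows "lap (\<lambda>y. \<phi> (y - a)) y = lap \<phi> (y - a)"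
proof -
  have "iter_pd [b, b] (\<lambda>y. \<phi> (y - a)) y = iter_pd [b, b] \<phi> (y - a)" if "b \<in> Basis" for b
    by (simp only: iter_pd_pair iter_pd_shift[OF assms] iter_pd_shift[OF smooth_fun_pd[OF assms that]])
  then show ?thesis by (simp only: lap_def cong: sum.cong)
qed

lemma smooth_line_derivative:
  fixes b :: "'a::euclidean_space"
  assumes "smooth_fun \<phi>"
  shows "((\<lambda>t. \<phi> (x + t *\<^sub>R b)) has_real_derivative iter_pd [b] \<phi> (x + t *\<^sub>R b)) (at t)"
proof -
  have "((\<lambda>t. x + t *\<^sub>R b) has_derivative (\<lambda>h. h *\<^sub>R b)) (at t)" by (auto intro!: derivative_eq_intros)
  from has_derivative_compose[OF this smooth_fun_has_derivative[OF assms]]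
  have D: "((\<lambda>t. \<phi> (x + t *\<^sub>R b)) has_derivative (\<lambda>h. frechet_derivative \<phi> (at (x + t *\<^sub>R b)) (h *\<^sub>R b))) (at t)" .
  have "linear (frechet_derivative \<phi> (at (x + t *\<^sub>R b)))"
    using smooth_fun_has_derivative[OF assms] has_derivative_linear by blast
  then show ?thesis using D by (simp add: has_field_derivative_def linear_cmul mult_commute_abs)
qed

text \<open>All derivatives fall on the test function; the sign comes from its argument y - x.
  Applied again to a partial derivative of \<psi>, it gives second derivatives. The limit is taken
  at parameter 0 from an arbitrary base point and then shifted.\<close>

lemma convolution_line_derivative:
  fixes u \<psi> :: "'a::euclidean_space \<Rightarrow> real"
  assumes um[measurable]: "u \<in> borel_measurable borel" and ul: "\<And>r. set_integrable lborel (cball 0 r) u"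
    and \<psi>: "test_fun \<psi>" and b: "b \<in> Basis"
  shows "((\<lambda>t. LINT y|lborel. u y * \<psi> (y - (x + t *\<^sub>R b))) has_real_derivative
     - (LINT y|lborel. u y * iter_pd [b] \<psi> (y - (x + t *\<^sub>R b)))) (at t)"
proof -
  have s\<psi>: "smooth_fun \<psi>" using \<psi> by (simp add: test_fun_def)
  have [measurable]: "\<psi> \<in> borel_measurable borel" "iter_pd [b] \<psi> \<in> borel_measurable borel"
    using test_fun_measurable \<psi> test_fun_pd[OF \<psi> b] by blast+
  obtain B r where B: "B > 0" "r > 0" "\<And>x. \<bar>iter_pd [b] \<psi> x\<bar> \<le> B * indicator (cball 0 r) x"
    using test_fun_bounded[OF test_fun_pd[OF \<psi> b]] by metis
  have at0: "((\<lambda>t. LINT y|lborel. u y * \<psi> (y - (z + t *\<^sub>R b))) has_real_derivative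
     (LINT y|lborel. - (u y * iter_pd [b] \<psi> (y - (z + 0 *\<^sub>R b))))) (at 0)" for z
  proof (rule has_real_derivative_integral_at_0[where w = "\<lambda>y. \<bar>indicator (cball 0 (r + norm z + 1)) y *\<^sub>R u y\<bar> * B"])
    fix y t
    have "((\<lambda>t. \<psi> ((y - z) + (- t) *\<^sub>R b)) has_real_derivative iter_pd [b] \<psi> ((y - z) + (- t) *\<^sub>R b) * (- 1)) (at t)"
      by (rule DERIV_chain2[OF smooth_line_derivative[OF s\<psi>]]) (auto intro!: derivative_eq_intros)
    moreover have "(y - z) + (- t) *\<^sub>R b = y - (z + t *\<^sub>R b)" for t by simp
    ultimately have "((\<lambda>t. \<psi> (y - (z + t *\<^sub>R b))) has_real_derivative - iter_pd [b] \<psi> (y - (z + t *\<^sub>R b))) (at t)"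
      by (simp only: mult_minus1_right)
    from DERIV_cmult[OF this, of "u y"]
    show "((\<lambda>t. u y * \<psi> (y - (z + t *\<^sub>R b))) has_real_derivative - (u y * iter_pd [b] \<psi> (y - (z + t *\<^sub>R b)))) (at t)"
      by (simp only: mult_minus_right)
    assume t: "\<bar>t\<bar> < 1"
    show "\<bar>- (u y * iter_pd [b] \<psi> (y - (z + t *\<^sub>R b)))\<bar> \<le> \<bar>indicator (cball 0 (r + norm z + 1)) y *\<^sub>R u y\<bar> * B"
    proof (cases "norm (y - (z + t *\<^sub>R b)) \<le> r")
      case True
      have "norm y \<le> norm (y - (z + t *\<^sub>R b)) + norm (z + t *\<^sub>R b)" using norm_triangle_sub[of y "z + t *\<^sub>R b"] by linarith
      also have "norm (z + t *\<^sub>R b) \<le> norm z + norm (t *\<^sub>R b)" by (rule norm_triangle_ineq)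
      also have "norm (t *\<^sub>R b) \<le> 1" using t b by simp
      finally have "norm y \<le> r + norm z + 1" using True by linarith
      moreover have "\<bar>iter_pd [b] \<psi> (y - (z + t *\<^sub>R b))\<bar> \<le> B" using B(3)[of "y - (z + t *\<^sub>R b)"] True by simp
      ultimately show ?thesis by (simp add: abs_mult mult_left_mono del: iter_pd.simps)
    next
      case False
      then have "iter_pd [b] \<psi> (y - (z + t *\<^sub>R b)) = 0" using B(3)[of "y - (z + t *\<^sub>R b)"] by simp
      then have "\<bar>- (u y * iter_pd [b] \<psi> (y - (z + t *\<^sub>R b)))\<bar> = 0" by (simp del: iter_pd.simps)
      moreover have "0 \<le> \<bar>indicator (cball 0 (r + norm z + 1)) y *\<^sub>R u y\<bar> * B" using B(1) by simp
      ultimately show ?thesis by linarith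
    qed
  next
    show "integrable lborel (\<lambda>y. \<bar>indicator (cball 0 (r + norm z + 1)) y *\<^sub>R u y\<bar> * B)"
      using ul[of "r + norm z + 1"] unfolding set_integrable_def by (intro integrable_mult_left integrable_abs)
    obtain B' r' where B': "B' > 0" "\<And>x. \<bar>\<psi> x\<bar> \<le> B' * indicator (cball 0 r') x" using test_fun_bounded[OF \<psi>] by metis
    show "integrable lborel (\<lambda>y. u y * \<psi> (y - (z + 0 *\<^sub>R b)))"
    proof (rule lborel_loc_times_bounded[OF um _ ul, where B = B' and r = "r' + norm z"])
      fix y
      show "\<bar>\<psi> (y - (z + 0 *\<^sub>R b))\<bar> \<le> B' * indicator (cball 0 (r' + norm z)) y"
      proof (cases "norm (y - z) \<le> r'")
        case True
        then have "norm y \<le> r' + norm z" using norm_triangle_ineq2[of y z] by linarith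
        then show ?thesis using B'(2)[of "y - z"] True by simp
      next
        case False
        then have "\<psi> (y - z) = 0" using B'(2)[of "y - z"] by simp
        then show ?thesis using B'(1) by simp
      qed
    qed (use B' in auto)
  qed measurable
  have "((\<lambda>s. LINT y|lborel. u y * \<psi> (y - ((x + t *\<^sub>R b) + s *\<^sub>R b))) has_real_derivative
     - (LINT y|lborel. u y * iter_pd [b] \<psi> (y - (x + t *\<^sub>R b)))) (at 0)"
    using at0[of "x + t *\<^sub>R b"] by (simp del: iter_pd.simps)
  moreover have "(x + t *\<^sub>R b) + s *\<^sub>R b = x + (s + t) *\<^sub>R b" for s by (simp add: algebra_simps)
  ultimately have "((\<lambda>s. LINT y|lborel. u y * \<psi> (y - (x + (s + t) *\<^sub>R b))) has_real_derivative
     - (LINT y|lborel. u y * iter_pd [b] \<psi> (y - (x + t *\<^sub>R b)))) (at 0)"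
    by (simp only:)
  then show ?thesis using DERIV_shift[of "\<lambda>t. LINT y|lborel. u y * \<psi> (y - (x + t *\<^sub>R b))" _ 0 t] by simp
qed

lemma convolution_continuous:
  fixes u \<psi> :: "'a::euclidean_space \<Rightarrow> real"
  assumes [measurable]: "u \<in> borel_measurable borel" and ul: "\<And>r. set_integrable lborel (cball 0 r) u"
    and \<psi>: "test_fun \<psi>"
  shows "continuous_on UNIV (\<lambda>x. LINT y|lborel. u y * \<psi> (y - x))"
  unfolding continuous_on_sequentially comp_def
proof (intro allI ballI impI)
  fix X :: "nat \<Rightarrow> 'a" and x assume "(\<forall>n. X n \<in> UNIV) \<and> X \<longlonglongrightarrow> x"
  then have X: "X \<longlonglongrightarrow> x" by blast
  have [measurable]: "\<psi> \<in> borel_measurable borel" using \<psi> by measurable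
  have c: "continuous_on UNIV \<psi>" using \<psi> smooth_fun_continuous by (auto simp: test_fun_def)
  obtain B r where B: "B > 0" "r > 0" "\<And>x. \<bar>\<psi> x\<bar> \<le> B * indicator (cball 0 r) x"
    using test_fun_bounded[OF \<psi>] by metis
  obtain r0 where r0: "\<And>n. norm (X n) \<le> r0" using convergent_imp_Bseq[of X] X by (auto simp: convergent_def Bseq_def)
  show "(\<lambda>n. LINT y|lborel. u y * \<psi> (y - X n)) \<longlonglongrightarrow> (LINT y|lborel. u y * \<psi> (y - x))"
  proof (rule integral_dominated_convergence[where w = "\<lambda>y. \<bar>indicator (cball 0 (r + r0)) y *\<^sub>R u y\<bar> * B"])
    show "integrable lborel (\<lambda>y. \<bar>indicator (cball 0 (r + r0)) y *\<^sub>R u y\<bar> * B)"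
      using ul[of "r + r0"] unfolding set_integrable_def by (intro integrable_mult_left integrable_abs)
    show "AE y in lborel. (\<lambda>n. u y * \<psi> (y - X n)) \<longlonglongrightarrow> u y * \<psi> (y - x)"
    proof (rule AE_I2, intro tendsto_mult tendsto_const)
      fix y
      have "(\<lambda>n. y - X n) \<longlonglongrightarrow> y - x" by (intro tendsto_intros X)
      then show "(\<lambda>n. \<psi> (y - X n)) \<longlonglongrightarrow> \<psi> (y - x)"
        using c by (intro isCont_tendsto_compose[of _ \<psi>]) (auto simp: continuous_on_eq_continuous_at)
    qed
    show "AE y in lborel. norm (u y * \<psi> (y - X n)) \<le> \<bar>indicator (cball 0 (r + r0)) y *\<^sub>R u y\<bar> * B" for n
    proof (rule AE_I2)
      fix y
      show "norm (u y * \<psi> (y - X n)) \<le> \<bar>indicator (cball 0 (r + r0)) y *\<^sub>R u y\<bar> * B"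
      proof (cases "norm (y - X n) \<le> r")
        case True
        then have "norm y \<le> r + r0" using norm_triangle_ineq2[of y "X n"] r0[of n] by linarith
        moreover have "\<bar>\<psi> (y - X n)\<bar> \<le> B" using B(3)[of "y - X n"] True by simp
        ultimately show ?thesis by (simp add: abs_mult mult_left_mono)
      next
        case False
        then have "\<psi> (y - X n) = 0" using B(3)[of "y - X n"] by simp
        then show ?thesis using B(1) by simp
      qed
    qed
  qed measurable
qed

lemma moll_integral_le:
  fixes x :: "'a::euclidean_space"
  assumes n: "DIM('a) \<ge> 3" and \<rho>: "\<rho> > 0"
  shows "(LINT y|lborel. moll \<rho> (y - x)) \<le> (LINT z|lborel. bubble 1 (z::'a))"
proof -
  have "moll \<rho> (y - x) = moll \<rho> (x - y)" for y
    by (simp add: moll_def bubble_def norm_minus_commute)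
  then show ?thesis using moll_convolution_bounds(2)[OF n \<rho>, of UNIV x] by simp
qed

context regular_solution
begin

lemma conv_le:
  assumes \<rho>: "\<rho> > 0" and e: "e \<ge> 0" and le: "AE y in lborel. norm (y - x) < 1 \<longrightarrow> u y \<le> e"
  shows "(LINT y|lborel. u y * moll \<rho> (y - x)) \<le> e * (LINT z|lborel. bubble 1 (z::'k\<times>'m))"
proof -
  have t: "test_fun (\<lambda>y::'k\<times>'m. moll \<rho> (y - x))" by (rule test_fun_moll[OF \<rho>])
  have m0: "moll \<rho> z \<ge> 0" for z :: "'k\<times>'m" using DIM3 by (intro moll_nonneg) linarith
  have i: "integrable lborel (\<lambda>y::'k\<times>'m. moll \<rho> (y - x))"
  proof -
    obtain r where "\<And>y::'k\<times>'m. moll \<rho> (y - x) \<noteq> 0 \<Longrightarrow> norm y < r" using test_fun_support[OF t] by blast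
    then show ?thesis
      using compact_support_integrable[OF smooth_fun_continuous] t unfolding test_fun_def by blast
  qed
  have "(LINT y|lborel. u y * moll \<rho> (y - x)) \<le> (LINT y|lborel. e * moll \<rho> (y - x))"
  proof (rule integral_mono_AE[OF lborel_loc_times_test[OF u_meas u_loc t] integrable_mult_right[OF i]])
    show "AE y in lborel. u y * moll \<rho> (y - x) \<le> e * moll \<rho> (y - x)"
      using le
    proof eventually_elim
      case (elim y)
      then show ?case using m0[of "y - x"] moll_eq_0[of "y - x" \<rho>] by (cases "norm (y - x) < 1") (auto intro: mult_right_mono)
    qed
  qed
  also have "\<dots> = e * (LINT y|lborel. moll \<rho> (y - x))" by simp
  also have "\<dots> \<le> e * (LINT z|lborel. bubble 1 (z::'k\<times>'m))"
    by (rule mult_left_mono[OF moll_integral_le[OF DIM3 \<rho>] e])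
  finally show ?thesis .
qed

text \<open>u has only weak derivatives, so the maximum principle is applied to its mollification U,
  for which the subsolution inequality tested with a translated mollifier is a pointwise
  differential inequality. The barrier does not depend on \<rho>, so the bound passes to u in the
  limit.\<close>

theorem u_decay:
  assumes F2: "((\<lambda>t. f t / t) \<longlongrightarrow> 0) (at 0)" and m: "m > 0"
  obtains A where "A > 0" "AE x in lborel. u x \<le> A * (1 + (norm x)\<^sup>2) powr (- m)"
proof -
  let ?n = "real DIM('k \<times> 'm)"
  define mass where "mass = (LINT z|lborel. bubble 1 (z::'k\<times>'m))"
  have mass: "mass > 0" unfolding mass_def by (rule bubble_mass_pos[OF DIM3])
  \<comment> \<open>Half of c0 absorbs f(u) far out, and the other half remains for the maximum
    principle.\<close>
  define c where "c = c0 / 2"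
  have c: "c > 0" using c0 by (simp add: c_def)
  have "\<forall>\<^sub>F t in at 0. \<bar>f t / t\<bar> < c" using F2 c by (auto simp: tendsto_iff dist_norm)
  then obtain \<delta> where \<delta>: "\<delta> > 0" "\<And>t. t \<noteq> 0 \<Longrightarrow> \<bar>t\<bar> < \<delta> \<Longrightarrow> \<bar>f t / t\<bar> < c"
    unfolding eventually_at by (auto simp: dist_norm)
  have fs: "\<bar>f t\<bar> \<le> c * t" if "0 \<le> t" "t \<le> \<delta> / 2" for t
  proof (cases "t = 0")
    case True
    then show ?thesis using f_bound[of 0] by simp
  next
    case False
    then show ?thesis using \<delta>(1) \<delta>(2)[of t] that by (simp add: abs_divide field_simps)
  qed
  obtain D where D: "D > 0" "AE x in lborel. u x \<le> D" using u_bounded by blast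
  obtain R1 where R1: "R1 > 0" "AE x in lborel. R1 < norm x \<longrightarrow> u x \<le> \<delta> / 2"
    using u_vanishes_at_infinity[of "\<delta> / 2"] \<delta>(1) by auto
  \<comment> \<open>The entry R1 + 1 leaves room for the unit range of the mollifier; the other one
    makes the barrier a supersolution outside the ball of radius R2.\<close>
  define R2 where "R2 = max (R1 + 1) (4 * m * (m + 1) / c + 1)"
  have R2: "R2 \<ge> R1 + 1" "R2 \<ge> 4 * m * (m + 1) / c" "R2 \<ge> 1" using R1(1) by (auto simp: R2_def)
  \<comment> \<open>Chosen so that the barrier is at least D times the mass, hence at least U, on
    the ball of radius R2.\<close>
  define A where "A = D * mass * (1 + R2\<^sup>2) powr m"
  have "1 + R2\<^sup>2 > 0" by (simp add: add_pos_nonneg)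
  then have A: "A > 0" unfolding A_def using D(1) mass by (intro mult_pos_pos) auto
  define Bm where "Bm x = A * (1 + (norm x)\<^sup>2) powr (- m)" for x :: "'k \<times> 'm"
  have Bma: "smooth_alg Bm"
  proof -
    have "smooth_alg (\<lambda>x::'k\<times>'m. A * ((norm (x - 0))\<^sup>2 + 1\<^sup>2) powr (- m))"
      by (intro smooth_alg.mult smooth_alg.const smooth_alg_radial_powr) simp
    then show ?thesis by (simp add: Bm_def[abs_def] add.commute)
  qed
  have sB: "smooth_fun Bm" by (rule smooth_alg_imp_smooth_fun[OF Bma])
  have "1 + (norm x)\<^sup>2 > 0" for x :: "'k \<times> 'm" by (simp add: add_pos_nonneg)
  then have Bm0: "Bm x > 0" for x unfolding Bm_def using A by (intro mult_pos_pos) (auto simp: less_le)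
  have B_big: "Bm x \<ge> D * mass" if "norm x \<le> R2" for x
  proof -
    have "(1 + R2\<^sup>2) powr (- m) \<le> (1 + (norm x)\<^sup>2) powr (- m)"
      using that m R2(3) by (intro powr_mono2') (auto intro!: power_mono add_pos_nonneg)
    then have "A * (1 + R2\<^sup>2) powr (- m) \<le> Bm x" unfolding Bm_def using A by (intro mult_left_mono) auto
    moreover have "A * (1 + R2\<^sup>2) powr (- m) = D * mass"
    proof -
      have "(1 + R2\<^sup>2) powr m * (1 + R2\<^sup>2) powr (- m) = 1"
        unfolding powr_add[symmetric] by (simp add: add_nonneg_eq_0_iff)
      then show ?thesis by (simp add: A_def mult.assoc)
    qed
    ultimately show ?thesis by simp
  qed
  \<comment> \<open>The H' part of the radial Laplacian is negative and dropped; the rest is at most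
    4 m (m + 1) / (1 + |x|^2) times the barrier.\<close>
  have lapB: "lap Bm x \<le> c * Bm x" if x: "norm x \<ge> R2" for x
  proof -
    let ?H = "\<lambda>s. A * (1 + s) powr (- m)" and ?Ha = "\<lambda>s. - m * A * (1 + s) powr (- m - 1)"
      and ?Hb = "\<lambda>s. m * (m + 1) * A * (1 + s) powr (- m - 2)"
    define s where "s = (norm x)\<^sup>2"
    have s0: "s \<ge> 0" by (simp add: s_def)
    have "lap (\<lambda>y::'k\<times>'m. ?H ((norm (y - 0))\<^sup>2)) x = 4 * (norm (x - 0))\<^sup>2 * ?Hb ((norm (x - 0))\<^sup>2) + 2 * ?n * ?Ha ((norm (x - 0))\<^sup>2)"
      by (rule radial_lap) (auto intro!: derivative_eq_intros simp: algebra_simps)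
    moreover have "(\<lambda>y::'k\<times>'m. ?H ((norm (y - 0))\<^sup>2)) = Bm" by (simp add: Bm_def fun_eq_iff)
    ultimately have "lap Bm x = 4 * s * ?Hb s + 2 * ?n * ?Ha s" by (simp only: s_def diff_zero)
    also have "\<dots> \<le> 4 * s * ?Hb s"
    proof -
      have "2 * ?n * (m * A * (1 + s) powr (- m - 1)) \<ge> 0" using m A by (intro mult_nonneg_nonneg) auto
      then show ?thesis by simp
    qed
    also have "\<dots> = (4 * m * (m + 1)) * (s * (1 + s) powr (- m - 2)) * A" by simp
    also have "\<dots> \<le> (c * (1 + s)) * ((1 + s) powr (- m - 1)) * A"
    proof (rule mult_right_mono[OF mult_mono])
      have "R2 \<le> R2\<^sup>2" using R2(3) by (simp add: power2_eq_square)
      also have "\<dots> \<le> s" unfolding s_def using x R2(3) by (intro power_mono) auto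
      finally have "4 * m * (m + 1) / c \<le> s" using R2(2) by linarith
      then have "4 * m * (m + 1) \<le> c * s" using c by (simp add: field_simps)
      also have "\<dots> \<le> c * (1 + s)" using c by simp
      finally show "4 * m * (m + 1) \<le> c * (1 + s)" .
      have "(1 + s) powr (- m - 1) = (1 + s) powr (1 + (- m - 2))"
        by (rule arg_cong[where f = "\<lambda>a. (1 + s) powr a"]) simp
      also have "\<dots> = (1 + s) * (1 + s) powr (- m - 2)" unfolding powr_add using s0 by simp
      finally show "s * (1 + s) powr (- m - 2) \<le> (1 + s) powr (- m - 1)" by (simp add: distrib_right)
    qed (use c s0 A in auto)
    also have "\<dots> = c * Bm x"
    proof -
      have "(1 + s) powr (- m) = (1 + s) powr (1 + (- m - 1))" by simp
      also have "\<dots> = (1 + s) * (1 + s) powr (- m - 1)" unfolding powr_add using s0 by simp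
      finally show ?thesis by (simp add: Bm_def s_def[symmetric])
    qed
    finally show ?thesis .
  qed
  have U_le: "(LINT y|lborel. u y * moll \<rho> (y - x)) \<le> Bm x" if \<rho>: "\<rho> > 0" for \<rho> x
  proof -
    define U where "U x = (LINT y|lborel. u y * moll \<rho> (y - x))" for x
    have t: "test_fun (moll \<rho> :: 'k\<times>'m \<Rightarrow> real)" using test_fun_moll[OF \<rho>, of 0] by simp
    have sm: "smooth_fun (moll \<rho> :: 'k\<times>'m \<Rightarrow> real)" using t by (simp add: test_fun_def)
    have ts: "test_fun (\<lambda>y::'k\<times>'m. moll \<rho> (y - x))" for x by (rule test_fun_moll[OF \<rho>])
    have m0: "moll \<rho> z \<ge> 0" for z :: "'k\<times>'m" using DIM3 by (intro moll_nonneg) linarith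
    have Uc: "continuous_on UNIV U" unfolding U_def[abs_def] by (rule convolution_continuous[OF u_meas u_loc t])
    have UD: "U x \<le> D * mass" for x
      unfolding U_def mass_def by (rule conv_le[OF \<rho>]) (use D in \<open>auto elim: eventually_mono\<close>)
    \<comment> \<open>For |x| > R2 the mollifier only sees points with |y| > R1, where |f(u)| \<le>
      c u; half of the zeroth-order term is left over.\<close>
    have lapU: "c * U x \<le> (LINT y|lborel. u y * lap (moll \<rho>) (y - x))" if x: "norm x > R2" for x
    proof -
      have sub: "c0 * (LINT y|lborel. u y * moll \<rho> (y - x)) - (LINT y|lborel. u y * lap (\<lambda>y. moll \<rho> (y - x)) y)
         \<le> (LINT y|lborel. \<bar>f (u y)\<bar> * moll \<rho> (y - x))"
        by (rule subsolution[OF smooth_alg_moll[OF \<rho>] ts m0])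
      have iu: "integrable lborel (\<lambda>y. u y * moll \<rho> (y - x))" by (rule lborel_loc_times_test[OF u_meas u_loc ts])
      have "(LINT y|lborel. \<bar>f (u y)\<bar> * moll \<rho> (y - x)) \<le> (LINT y|lborel. c * (u y * moll \<rho> (y - x)))"
      proof (rule integral_mono_AE)
        show "integrable lborel (\<lambda>y. \<bar>f (u y)\<bar> * moll \<rho> (y - x))"
          by (rule lborel_loc_times_test[OF _ fu_loc ts]) measurable
        show "integrable lborel (\<lambda>y. c * (u y * moll \<rho> (y - x)))" by (rule integrable_mult_right[OF iu])
        show "AE y in lborel. \<bar>f (u y)\<bar> * moll \<rho> (y - x) \<le> c * (u y * moll \<rho> (y - x))"
          using R1(2)
        proof eventually_elim
          case (elim y)
          show ?case
          proof (cases "norm (y - x) < 1")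
            case True
            have "norm x \<le> norm y + norm (y - x)" using norm_triangle_ineq4[of y "y - x"] by simp
            then have "R1 < norm y" using True x R2(1) by linarith
            then have "\<bar>f (u y)\<bar> \<le> c * u y" using fs[OF u_nonneg] elim by blast
            then have "\<bar>f (u y)\<bar> * moll \<rho> (y - x) \<le> (c * u y) * moll \<rho> (y - x)" using m0 by (intro mult_right_mono) auto
            then show ?thesis by simp
          qed (simp add: moll_eq_0)
        qed
      qed
      moreover have "(LINT y|lborel. c * (u y * moll \<rho> (y - x))) = c * U x" by (simp add: U_def)
      ultimately have "c0 * U x - (LINT y|lborel. u y * lap (moll \<rho>) (y - x)) \<le> c * U x"
        using sub unfolding lap_shift[OF sm] U_def[symmetric] by linarith
      then show ?thesis by (simp add: c_def)
    qed
    have "U x \<le> Bm x" for x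
    proof (rule ccontr)
      assume "\<not> U x \<le> Bm x"
      define w where "w x = U x - Bm x" for x
      have w0: "w x > 0" using \<open>\<not> U x \<le> Bm x\<close> by (simp add: w_def)
      \<comment> \<open>Half of the supposed positive value, divided by the mass: far out U is at
        most this half, so the supremum of w is attained on a compact ball.\<close>
      define e where "e = w x / (2 * mass)"
      have e: "e > 0" "e * mass < w x" using w0 mass by (auto simp: e_def)
      obtain Re where Re: "Re > 0" "AE y in lborel. Re < norm y \<longrightarrow> u y \<le> e"
        using u_vanishes_at_infinity[OF e(1)] by blast
      define R3 where "R3 = max (Re + 1) (norm x)"
      have far: "w z < w x" if z: "norm z > R3" for z
      proof -
        have "U z \<le> e * mass" unfolding U_def mass_def
        proof (rule conv_le[OF \<rho>])
          show "AE y in lborel. norm (y - z) < 1 \<longrightarrow> u y \<le> e" using Re(2)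
          proof eventually_elim
            case (elim y)
            have "norm z \<le> norm y + norm (y - z)" using norm_triangle_ineq4[of y "y - z"] by simp
            moreover have "norm z > Re + 1" using z by (simp add: R3_def)
            ultimately show ?case using elim by linarith
          qed
        qed (use e in simp)
        then show ?thesis using e(2) Bm0[of z] by (simp add: w_def)
      qed
      have wc: "continuous_on (cball 0 R3) w"
        unfolding w_def[abs_def]
        by (intro continuous_on_diff continuous_on_subset[OF Uc] continuous_on_subset[OF smooth_fun_continuous[OF sB]]) auto
      have "x \<in> cball 0 R3" by (simp add: R3_def)
      then obtain x1 where x1: "x1 \<in> cball 0 R3" "\<And>z. z \<in> cball 0 R3 \<Longrightarrow> w z \<le> w x1"
        using continuous_attains_sup[OF compact_cball _ wc] by blast
      have wx1: "w x \<le> w x1" by (rule x1(2)) fact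
      have max: "w z \<le> w x1" for z
        using x1(2)[of z] far[of z] wx1 by (cases "norm z \<le> R3") auto
      have nx1: "norm x1 > R2"
      proof (rule ccontr)
        assume "\<not> norm x1 > R2"
        then have "w x1 \<le> 0" using B_big[of x1] UD[of x1] by (simp add: w_def)
        then show False using wx1 w0 by linarith
      qed
      \<comment> \<open>At the global maximum x1 every pure second derivative of w is nonpositive.
        Their sum compares the Laplacians of U and the barrier, which contradicts w x1 > 0.\<close>
      have second: "(LINT y|lborel. u y * iter_pd [b, b] (moll \<rho>) (y - x1)) - iter_pd [b, b] Bm x1 \<le> 0" if b: "b \<in> Basis" for b
      proof (rule second_derivative_nonpos_at_max[where q = "\<lambda>t. w (x1 + t *\<^sub>R b)"
            and ?q1.0 = "\<lambda>t. - (LINT y|lborel. u y * iter_pd [b] (moll \<rho>) (y - (x1 + t *\<^sub>R b))) - iter_pd [b] Bm (x1 + t *\<^sub>R b)"])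
        show "((\<lambda>t. w (x1 + t *\<^sub>R b)) has_real_derivative
           - (LINT y|lborel. u y * iter_pd [b] (moll \<rho>) (y - (x1 + t *\<^sub>R b))) - iter_pd [b] Bm (x1 + t *\<^sub>R b)) (at t)" for t
          unfolding w_def U_def
          by (intro DERIV_diff convolution_line_derivative[OF u_meas u_loc t b] smooth_line_derivative[OF sB])
        have "((\<lambda>t. - (LINT y|lborel. u y * iter_pd [b] (moll \<rho>) (y - (x1 + t *\<^sub>R b))) - iter_pd [b] Bm (x1 + t *\<^sub>R b))
          has_real_derivative - (- (LINT y|lborel. u y * iter_pd [b] (iter_pd [b] (moll \<rho>)) (y - (x1 + 0 *\<^sub>R b)))) - iter_pd [b] (iter_pd [b] Bm) (x1 + 0 *\<^sub>R b)) (at 0)"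
          by (intro DERIV_diff DERIV_minus convolution_line_derivative[OF u_meas u_loc test_fun_pd[OF t b] b]
              smooth_line_derivative[OF smooth_fun_pd[OF sB b]])
        then show "((\<lambda>t. - (LINT y|lborel. u y * iter_pd [b] (moll \<rho>) (y - (x1 + t *\<^sub>R b))) - iter_pd [b] Bm (x1 + t *\<^sub>R b))
          has_real_derivative (LINT y|lborel. u y * iter_pd [b, b] (moll \<rho>) (y - x1)) - iter_pd [b, b] Bm x1) (at 0)"
          by (simp only: iter_pd_pair minus_minus scaleR_zero_left add_0_right)
        show "w (x1 + t *\<^sub>R b) \<le> w (x1 + 0 *\<^sub>R b)" for t using max by simp
      qed
      have int: "integrable lborel (\<lambda>y. u y * iter_pd [b, b] (moll \<rho>) (y - x1))" if b: "b \<in> Basis" for b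
      proof -
        have "test_fun (iter_pd [b] (iter_pd [b] (\<lambda>y. moll \<rho> (y - x1))))"
          by (intro test_fun_pd ts b)
        then have "integrable lborel (\<lambda>y. u y * iter_pd [b] (iter_pd [b] (\<lambda>y. moll \<rho> (y - x1))) y)"
          by (rule lborel_loc_times_test[OF u_meas u_loc])
        then show ?thesis
          by (simp only: iter_pd_pair iter_pd_shift[OF sm] iter_pd_shift[OF smooth_fun_pd[OF sm b]])
      qed
      have "(LINT y|lborel. u y * lap (moll \<rho>) (y - x1)) - lap Bm x1
        = (\<Sum>b\<in>Basis. (LINT y|lborel. u y * iter_pd [b, b] (moll \<rho>) (y - x1)) - iter_pd [b, b] Bm x1)"
        unfolding lap_def sum_distrib_left sum_subtractf
        by (subst Bochner_Integration.integral_sum) (use int in \<open>auto simp del: iter_pd.simps\<close>)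
      also have "\<dots> \<le> 0" by (rule sum_nonpos) (rule second)
      finally have "c * U x1 \<le> c * Bm x1" using lapU[OF nx1] lapB[of x1] nx1 by linarith
      then have "w x1 \<le> 0" using c by (simp add: w_def)
      then show False using wx1 w0 by linarith
    qed
    then show ?thesis by (simp add: U_def)
  qed
  have "AE x in lborel. x \<in> UNIV \<longrightarrow> mass * u x \<le> Bm x"
    unfolding mass_def
  proof (rule approx_identity_le[OF DIM3 u_meas _ u_loc])
    show "Bm \<in> borel_measurable borel" by (rule borel_measurable_continuous_onI[OF smooth_fun_continuous[OF sB]])
    show "set_integrable lborel (cball 0 r) Bm" for r
      unfolding set_integrable_def
      by (intro borel_integrable_compact continuous_on_subset[OF smooth_fun_continuous[OF sB]]) auto
  qed (use U_le in auto)
  then have "AE x in lborel. u x \<le> A / mass * (1 + (norm x)\<^sup>2) powr (- m)"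
    by eventually_elim (use mass in \<open>simp add: Bm_def field_simps\<close>)
  then show ?thesis using A mass by (intro that[of "A / mass"]) auto
qed

end

section \<open>Changing representatives\<close>

text \<open>The predicates \<open>L2grad u\<close> and \<open>L2grad u'\<close> are equal, so
  Hilbert choice returns the same function, with no exceptional set.\<close>

lemma wgrad_cong_AE:
  assumes "u \<in> borel_measurable lebesgue" "u' \<in> borel_measurable lebesgue" "AE x in lebesgue. u x = u' x"
  shows "wgrad u = wgrad u'"
proof -
  have "L2grad u = L2grad u'" using L2grad_iff_AE[OF assms] by (intro ext)
  then show ?thesis by (simp only: wgrad_def)
qed

lemma H1_cong_AE:
  fixes u u' :: "'a::euclidean_space \<Rightarrow> real"
  assumes m: "u \<in> borel_measurable lebesgue" "u' \<in> borel_measurable lebesgue" "AE x in lebesgue. u x = u' x"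
    and u: "H1 u"
  shows "H1 u'"
proof -
  note [measurable] = m(1,2)
  have i: "integrable lebesgue (\<lambda>x. (u x)\<^sup>2)" using u by (simp add: H1_def)
  have "integrable lebesgue (\<lambda>x. (u' x)\<^sup>2)"
    by (rule integrable_cong_AE_imp[OF i]) (use m(3) in \<open>auto elim: eventually_mono\<close>)
  then show ?thesis using u L2grad_iff_AE[OF m] by (auto simp: H1_def m)
qed

text \<open>The energy along u + t v depends only on the class of u modulo null sets, so the two
  functions of t are identical and so are their derivatives.\<close>

lemma weak_solution_cong_AE:
  fixes V :: "('k::euclidean_space \<times> 'm::euclidean_space) \<Rightarrow> real"
  assumes V: "continuous_on UNIV V" and f: "continuous_on UNIV f"
    and m: "u \<in> borel_measurable lebesgue" "u' \<in> borel_measurable lebesgue" "AE x in lebesgue. u x = u' x"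
    and sol: "weak_solution V f u"
  shows "weak_solution V f u'"
proof -
  note [measurable] = m(1,2)
  have [measurable]: "V \<in> borel_measurable lebesgue" "(\<lambda>x::'k\<times>'m. norm (fst x)) \<in> borel_measurable lebesgue"
    using V by (auto intro!: measurable_completion borel_measurable_continuous_onI continuous_intros)
  have [measurable]: "primF f \<in> borel_measurable borel"
    by (intro borel_measurable_continuous_onI)
       (auto simp: continuous_on_eq_continuous_at intro: DERIV_isCont primF_has_derivative[OF f])
  have Xu: "X1 V u" using sol by (simp add: weak_solution_def)
  have i: "integrable lebesgue (\<lambda>x. (u x)\<^sup>2 / (norm (fst x))\<^sup>2 + V x * (u x)\<^sup>2)" using Xu by (simp add: X1_def)
  have "integrable lebesgue (\<lambda>x. (u' x)\<^sup>2 / (norm (fst x))\<^sup>2 + V x * (u' x)\<^sup>2)"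
    by (rule integrable_cong_AE_imp[OF i]) (use m(3) in \<open>auto elim: eventually_mono\<close>)
  then have X': "X1 V u'" using Xu H1_cong_AE[OF m] by (simp add: X1_def)
  have en: "energy V f (\<lambda>x. u' x + t * v x) = energy V f (\<lambda>x. u x + t * v x)" if v: "X1 V v" for v t
  proof -
    have [measurable]: "v \<in> borel_measurable lebesgue" using v by (simp add: X1_def H1_def)
    have w: "wgrad (\<lambda>x. u x + t * v x) = wgrad (\<lambda>x. u' x + t * v x)"
      by (rule wgrad_cong_AE) (use m(3) in \<open>auto elim: eventually_mono\<close>)
    have [measurable]: "wgrad (\<lambda>x. u' x + t * v x) \<in> borel_measurable lebesgue"
    proof -
      obtain gu gv where "L2grad u' gu" "L2grad v gv" using X' v by (auto simp: X1_def H1_def)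
      from L2grad_add_scaled[OF this, of t] have "L2grad (\<lambda>x. u' x + t * v x) (wgrad (\<lambda>x. u' x + t * v x))"
        unfolding wgrad_def by (rule someI[of "L2grad _"])
      then show ?thesis by (simp add: L2grad_def)
    qed
    have 1: "(LINT x|lebesgue. (norm (wgrad (\<lambda>x. u' x + t * v x) x))\<^sup>2 + (u' x + t * v x)\<^sup>2 / (norm (fst x))\<^sup>2 + V x * (u' x + t * v x)\<^sup>2)
      = (LINT x|lebesgue. (norm (wgrad (\<lambda>x. u' x + t * v x) x))\<^sup>2 + (u x + t * v x)\<^sup>2 / (norm (fst x))\<^sup>2 + V x * (u x + t * v x)\<^sup>2)"
      by (rule integral_cong_AE) (use m(3) in \<open>auto elim: eventually_mono\<close>)
    have 2: "(LINT x|lebesgue. primF f (u' x + t * v x)) = (LINT x|lebesgue. primF f (u x + t * v x))"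
      by (rule integral_cong_AE) (use m(3) in \<open>auto elim: eventually_mono\<close>)
    show ?thesis unfolding energy_def w 1 2 ..
  qed
  have "((\<lambda>t. energy V f (\<lambda>x. u' x + t * v x)) has_real_derivative 0) (at 0)" if v: "X1 V v" for v
    using sol v unfolding weak_solution_def en[OF v] by blast
  then show ?thesis using X' by (simp add: weak_solution_def)
qed

section \<open>Transfer to the given solution and to each exponent \<nu>\<close>

theorem theorem6p1:
  fixes V :: "((real^('k::finite)) \<times> (real^('m::finite))) \<Rightarrow> real"
    and f :: "real \<Rightarrow> real"
    and u :: "((real^('k::finite)) \<times> (real^('m::finite))) \<Rightarrow> real"
  defines "N \<equiv> CARD('k) + CARD('m)"
  assumes K2: "CARD('k) \<ge> 2"
    and V_cont: "continuous_on UNIV V"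
    and V_inf: "\<exists>c>0. \<forall>x. c \<le> V x"
    and F1: "continuous_on UNIV f"
      "\<exists>C p. 2 < p \<and> p < 2 * real N / (real N - 2) \<and>
             (\<forall>t. \<bar>f t\<bar> \<le> C * (1 + \<bar>t\<bar> powr (p - 1)))"
    and F2: "((\<lambda>t. f t / t) \<longlongrightarrow> 0) (at 0)"
    and F3: "filterlim (\<lambda>t. primF f t / t\<^sup>2) at_top at_infinity"
    and F4: "strict_mono_on {..<0} (\<lambda>t. f t / \<bar>t\<bar>)" "strict_mono_on {0<..} (\<lambda>t. f t / \<bar>t\<bar>)"
    and sol: "weak_solution V f u"
    and nonneg: "AE x in lebesgue. 0 \<le> u x"
  shows "(\<exists>C. AE x in lebesgue. \<bar>u x\<bar> \<le> C) \<and>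
         (\<forall>\<nu>::real. \<nu> < (real N - 2 + sqrt ((real N - 2)\<^sup>2 + 4)) / 2 \<longrightarrow>
            (\<forall>\<epsilon>>0. \<exists>R. AE x in lebesgue. R < norm x \<longrightarrow> norm x powr \<nu> * \<bar>u x\<bar> \<le> \<epsilon>))"
proof -
  obtain c0 where c0: "c0 > 0" "\<And>x. c0 \<le> V x" using V_inf by blast
  obtain C0 p where p: "2 < p" "p < 2 * real N / (real N - 2)" "\<And>t. \<bar>f t\<bar> \<le> C0 * (1 + \<bar>t\<bar> powr (p - 1))"
    using F1(2) by blast
  obtain C where C: "C > 0" "\<And>t. \<bar>f t\<bar> \<le> C * (\<bar>t\<bar> + \<bar>t\<bar> powr (p - 1))"
    using nonlinearity_bound[OF F1(1) p(3) F2] by blast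
  have N: "DIM((real^'k) \<times> (real^'m)) = N" by (simp add: N_def)
  have pN: "p < 2 * real DIM((real^'k) \<times> (real^'m)) / (real DIM((real^'k) \<times> (real^'m)) - 2)"
    using p(2) by (simp only: N)
  have um: "u \<in> borel_measurable lebesgue" using sol by (simp add: weak_solution_def X1_def H1_def)
  obtain u0 where u0: "u0 \<in> borel_measurable borel" "AE x in lebesgue. u x = u0 x"
    using borel_representative_real[OF um] by blast
  \<comment> \<open>The Borel representative is truncated at 0 so that nonnegativity holds at every
    point, as the locale demands.\<close>
  define u' where "u' x = max 0 (u0 x)" for x
  have u'm: "u' \<in> borel_measurable borel" unfolding u'_def[abs_def] using u0(1) by measurable
  then have u'l: "u' \<in> borel_measurable lebesgue" by (intro measurable_completion) simp
  have uu': "AE x in lebesgue. u x = u' x" using u0(2) nonneg by eventually_elim (simp add: u'_def)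
  have sol': "weak_solution V f u'" by (rule weak_solution_cong_AE[OF V_cont F1(1) um u'l uu' sol])
  obtain g0 where g0: "L2grad u' g0" using sol' by (auto simp: weak_solution_def X1_def H1_def)
  then have "g0 \<in> borel_measurable lebesgue" by (simp add: L2grad_def)
  then obtain g where g: "g \<in> borel_measurable borel" "AE x in lebesgue. g0 x = g x"
    using borel_representative_vector by blast
  have gl: "g \<in> borel_measurable lebesgue" using g(1) by (intro measurable_completion) simp
  have ug: "L2grad u' g" by (rule L2grad_cong_AE[OF u'l u'l _ gl g(2) g0]) simp
  interpret regular_solution V f u' g c0 C p
    by unfold_locales (use K2 V_cont c0 F1(1) C p(1) pN u'm g(1) ug sol' in \<open>auto simp: u'_def\<close>)
  obtain D where D: "AE x in lborel. u' x \<le> D" using u_bounded by blast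
  have "AE x in lebesgue. u' x \<le> D" using D by (rule AE_completion)
  with uu' have "AE x in lebesgue. \<bar>u x\<bar> \<le> D" by eventually_elim (use u_nonneg in simp)
  moreover have "\<exists>R. AE x in lebesgue. R < norm x \<longrightarrow> norm x powr \<nu> * \<bar>u x\<bar> \<le> \<epsilon>" if e: "\<epsilon> > 0" for \<nu> \<epsilon> :: real
  proof -
    \<comment> \<open>Then 2 m \<ge> \<nu> + 1, so |x|^\<nu> u is at most A / |x|, which is below
      \<epsilon> once |x| > A / \<epsilon>.\<close>
    define m where "m = (\<bar>\<nu>\<bar> + 1) / 2"
    have m: "m > 0" "\<nu> - 2 * m \<le> - 1" by (auto simp: m_def field_simps)
    obtain A where A: "A > 0" "AE x in lborel. u' x \<le> A * (1 + (norm x)\<^sup>2) powr (- m)"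
      using u_decay[OF F2 m(1)] by blast
    have "AE x in lebesgue. u' x \<le> A * (1 + (norm x)\<^sup>2) powr (- m)" using A(2) by (rule AE_completion)
    with uu' have "AE x in lebesgue. max 1 (A / \<epsilon>) < norm x \<longrightarrow> norm x powr \<nu> * \<bar>u x\<bar> \<le> \<epsilon>"
    proof eventually_elim
      case (elim x)
      show ?case
      proof
        assume "max 1 (A / \<epsilon>) < norm x"
        then have x: "norm x > 1" "A / \<epsilon> < norm x" by auto
        have px: "norm x > 0" using x by linarith
        have "(1 + (norm x)\<^sup>2) powr (- m) \<le> ((norm x)\<^sup>2) powr (- m)"
          using x m by (intro powr_mono2') auto
        also have "\<dots> = norm x powr (- (2 * m))"
          using powr_square_half[OF px, of "- (2 * m)"] by simp
        finally have "A * (1 + (norm x)\<^sup>2) powr (- m) \<le> A * norm x powr (- (2 * m))" using A(1) by (intro mult_left_mono) auto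
        then have ux: "\<bar>u x\<bar> \<le> A * norm x powr (- (2 * m))" using elim u_nonneg[of x] by simp
        have "norm x powr \<nu> * \<bar>u x\<bar> \<le> norm x powr \<nu> * (A * norm x powr (- (2 * m)))" by (rule mult_left_mono[OF ux]) simp
        also have "\<dots> = A * norm x powr (\<nu> - 2 * m)" by (simp add: powr_add[symmetric])
        also have "\<dots> \<le> A * norm x powr (- 1)" using A(1) x m by (intro mult_left_mono powr_mono) auto
        also have "\<dots> = A / norm x" using px by (simp add: powr_minus_divide)
        also have "\<dots> \<le> \<epsilon>" using x(2) px e by (simp add: pos_divide_le_eq pos_divide_less_eq mult.commute)
        finally show "norm x powr \<nu> * \<bar>u x\<bar> \<le> \<epsilon>" .
      qed
    qed
    then show ?thesis by blast
  qed
  ultimately show ?thesis by blast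
qed

end
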